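(* Let $v>0$, $\sigma>0$ and let $\mu_1,\mu_2$ be the sailboat navigation coefficients defined in the context. Then for every $(r,\theta)\in\mathbb{R}_+\times\mathbb{R}$ there exists a unique (in the sense of pathwise uniqueness) strong solution up to $\tau$, i.e. on $[0,\tau]$ where $\tau=\inf\{t\ge 0: R_t=0\}$, in the sense of the definition given in the context, to the system $$dR_t=\mu_1(R_t,\Theta_t)\,dt,\quad R_0=r,\qquad d\Theta_t=\mu_2(R_t,\Theta_t)\,dt+\sigma\,dB_t,\quad \Theta_0=\theta.$$
   Context: $(\Omega,\mathcal{F},\{\mathcal{F}_t\}_{t\ge0},\mathbb{P})$ is a filtered probability space supporting a standard Brownian motion $(B_t)_{t\ge0}$; $\mathbb{R}_+=\,]0,\infty[$. Sailboat navigation coefficients. With $v>0$ a constant, for $r>0$ and $\theta\in[0,2\pi[$, $\mu_1(r,\theta)=\mu_1(\theta)$ (it does not depend on $r$) and - for $\theta\in[0,\frac{\pi}{4}[$: $\mu_1=-v\cos\theta$, $\mu_2=\frac{v\sin\theta}{r}$; - for $\theta\in[\frac{\pi}{4},\frac{\pi}{2}[$: $\mu_1=-v\sin\theta$, $\mu_2=-\frac{v\cos\theta}{r}$; - for $\theta\in[\frac{\pi}{2},\pi[$: $\mu_1=-v$, $\mu_2=0$; - for $\theta\in[\pi,\frac{5\pi}{4}[$: $\mu_1=v\cos\theta$, $\mu_2=-\frac{v\sin\theta}{r}$; - for $\theta\in[\frac{5\pi}{4},\frac{3\pi}{2}[$: $\mu_1=v\sin\theta$, $\mu_2=\frac{v\cos\theta}{r}$;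 - for $\theta\in[\frac{3\pi}{2},2\pi[$: $\mu_1=-v$, $\mu_2=0$; and $\mu_1,\mu_2$ are extended to all $\theta\in\mathbb{R}$ by $2\pi$-periodicity in $\theta$. Definition (strong solution up to $\tau$). Let $\tau=\inf\{t\ge0:R_t=0\}$. An $(\mathcal{F}_t)$-adapted process $(R_t,\Theta_t)_{t\in[0,\tau]}$ is a strong solution up to $\tau$ if: 1. for every $t<\tau$ one has $R_t>0$, and $(R_s,\Theta_s)_{s\in[0,t]}$ is a strong solution of the system on $[0,t]$ in the usual sense (with respect to the given Brownian motion $B$ and the given initial condition, adapted to the augmented filtration generated by $B$); in particular it is continuous, $\int_0^t(|\mu_1(R_s,\Theta_s)|+|\mu_2(R_s,\Theta_s)|)\,ds<\infty$ for every $t<\tau$, and $$R_t=r+\int_0^t\mu_1(R_s,\Theta_s)\,ds,\qquad \Theta_t=\theta+\int_0^t\mu_2(R_s,\Theta_s)\,ds+\sigma B_t;$$ 2. the limit $(R_\tau,\Theta_\tau):=\lim_{t\nearrow\tau}(R_t,\Theta_t)$ exists almost surely. Pathwise uniqueness up to $\tau$: if $(R,\Theta)$ and $(\widetilde R,\widetilde\Theta)$ are two strong solutions up to their respective hitting times $\tau,\widetilde\tau$ of the origin, driven by the same $B$ with the same initial condition, then almost surely $\tau=\widetilde\tau$ and $(R_t,\Theta_t)=(\widetilde R_t,\widetilde\Theta_t)$ for all $t\in[0,\tau]$. *)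

theory Defs
  imports "HOL-Probability.Probability" "HOL-Library.Real_Mod"
begin

section \<open>Filtered probability spaces and Brownian motion\<close>

text \<open>The time set is \<open>[0,\<infinity>)\<close>; values of filtrations and processes at negative times are never used.
  Neither completeness nor right-continuity of the filtration is assumed.\<close>

definition filtered_prob_space :: "'a measure \<Rightarrow> (real \<Rightarrow> 'a measure) \<Rightarrow> bool" where
  "filtered_prob_space M F \<longleftrightarrow>
     prob_space M \<and>
     (\<forall>t\<ge>0. subalgebra M (F t)) \<and>
     (\<forall>s t. 0 \<le> s \<and> s \<le> t \<longrightarrow> sets (F s) \<subseteq> sets (F t))"

definition brownian_motion ::
  "'a measure \<Rightarrow> (real \<Rightarrow> 'a measure) \<Rightarrow> (real \<Rightarrow> 'a \<Rightarrow> real) \<Rightarrow> bool" where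
  "brownian_motion M F B \<longleftrightarrow>
     (\<forall>t\<ge>0. B t \<in> borel_measurable (F t)) \<and>
     (AE \<omega> in M. B 0 \<omega> = 0) \<and>
     (AE \<omega> in M. continuous_on {0..} (\<lambda>t. B t \<omega>)) \<and>
     (\<forall>s t. 0 \<le> s \<and> s < t \<longrightarrow>
        distributed M lborel (\<lambda>\<omega>. B t \<omega> - B s \<omega>) (normal_density 0 (sqrt (t - s))) \<and>
        prob_space.indep_set M (sets (F s))
          {(\<lambda>\<omega>. B t \<omega> - B s \<omega>) -` A \<inter> space M | A. A \<in> sets borel})"

text \<open>The members of \<open>null_sets (completion M)\<close> are all subsets of null sets of \<open>M\<close>, measurable or not.\<close>

definition augmented_filtration :: "'a measure \<Rightarrow> (real \<Rightarrow> 'a \<Rightarrow> real) \<Rightarrow> real \<Rightarrow> 'a measure" where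
  "augmented_filtration M B t =
     sigma (space M)
       ({B s -` A \<inter> space M | s A. 0 \<le> s \<and> s \<le> t \<and> A \<in> sets borel} \<union> null_sets (completion M))"


section \<open>Strong solutions up to the hitting time of the origin\<close>

text \<open>The infimum of the empty set is \<open>\<infinity>\<close>.\<close>

definition hitting_time :: "(real \<Rightarrow> 'a \<Rightarrow> real) \<Rightarrow> 'a \<Rightarrow> ereal" where
  "hitting_time R \<omega> = (INF t\<in>{t. 0 \<le> t \<and> R t \<omega> = 0}. ereal t)"

text \<open>Adaptedness of a process whose time set is the random interval \<open>[0,\<tau>]\<close>.\<close>

definition adapted_upto ::
  "'a measure \<Rightarrow> (real \<Rightarrow> 'a measure) \<Rightarrow> ('a \<Rightarrow> ereal) \<Rightarrow> (real \<Rightarrow> 'a \<Rightarrow> 'b::topological_space) \<Rightarrow> bool"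
where
  "adapted_upto M F \<tau> X \<longleftrightarrow>
     (\<forall>t\<ge>0. \<forall>A\<in>sets borel. {\<omega> \<in> space M. ereal t \<le> \<tau> \<omega> \<and> X t \<omega> \<in> A} \<in> sets (F t))"

text \<open>A process on \<open>[0,\<tau>]\<close> is represented by functions on all times, whose values after \<open>\<tau>\<close> carry no
  meaning. As the process lives on \<open>[0,\<tau>]\<close> only, the infimum \<open>\<tau>\<close> of its zeros, when finite, is
  attained; the clause on \<open>R t \<omega> = 0\<close> says so, and thereby keeps the values after \<open>\<tau>\<close> from having
  any influence on \<open>\<tau>\<close>. The initial condition is stated separately from the integral equations,
  since the latter say nothing if \<open>\<tau> = 0\<close>. In the last clause the left limit at \<open>\<tau>\<close> is taken in the
  extended reals, so that it is a limit at infinity on the event \<open>\<tau> = \<infinity>\<close>.\<close>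

definition strong_solution_upto_hitting ::
  "'a measure \<Rightarrow> (real \<Rightarrow> 'a measure) \<Rightarrow> (real \<Rightarrow> 'a \<Rightarrow> real) \<Rightarrow>
   (real \<Rightarrow> real \<Rightarrow> real) \<Rightarrow> (real \<Rightarrow> real \<Rightarrow> real) \<Rightarrow> real \<Rightarrow> real \<Rightarrow> real \<Rightarrow>
   (real \<Rightarrow> 'a \<Rightarrow> real) \<Rightarrow> (real \<Rightarrow> 'a \<Rightarrow> real) \<Rightarrow> bool"
where
  "strong_solution_upto_hitting M F B \<mu>1 \<mu>2 \<sigma> r \<theta> R \<Theta> \<longleftrightarrow>
     (let \<tau> = hitting_time R in
        adapted_upto M F \<tau> (\<lambda>t \<omega>. (R t \<omega>, \<Theta> t \<omega>)) \<and>
        adapted_upto M (augmented_filtration M B) \<tau> (\<lambda>t \<omega>. (R t \<omega>, \<Theta> t \<omega>)) \<and>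
        (AE \<omega> in M. R 0 \<omega> = r \<and> \<Theta> 0 \<omega> = \<theta>) \<and>
        (AE \<omega> in M. \<forall>t. \<tau> \<omega> = ereal t \<longrightarrow> R t \<omega> = 0) \<and>
        (AE \<omega> in M. \<forall>t. 0 \<le> t \<and> ereal t < \<tau> \<omega> \<longrightarrow>
           R t \<omega> > 0 \<and>
           continuous_on {0..t} (\<lambda>s. (R s \<omega>, \<Theta> s \<omega>)) \<and>
           set_integrable lborel {0..t} (\<lambda>s. \<bar>\<mu>1 (R s \<omega>) (\<Theta> s \<omega>)\<bar> + \<bar>\<mu>2 (R s \<omega>) (\<Theta> s \<omega>)\<bar>) \<and>
           R t \<omega> = r + (LINT s:{0..t}|lborel. \<mu>1 (R s \<omega>) (\<Theta> s \<omega>)) \<and>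
           \<Theta> t \<omega> = \<theta> + (LINT s:{0..t}|lborel. \<mu>2 (R s \<omega>) (\<Theta> s \<omega>)) + \<sigma> * B t \<omega>) \<and>
        (AE \<omega> in M. \<exists>l.
           ((\<lambda>s. (R (real_of_ereal s) \<omega>, \<Theta> (real_of_ereal s) \<omega>)) \<longlongrightarrow> l) (at_left (\<tau> \<omega>)) \<and>
           (\<forall>t. \<tau> \<omega> = ereal t \<longrightarrow> (R t \<omega>, \<Theta> t \<omega>) = l)))"

definition pathwise_unique_upto_hitting ::
  "'a measure \<Rightarrow> (real \<Rightarrow> 'a measure) \<Rightarrow> (real \<Rightarrow> 'a \<Rightarrow> real) \<Rightarrow>
   (real \<Rightarrow> real \<Rightarrow> real) \<Rightarrow> (real \<Rightarrow> real \<Rightarrow> real) \<Rightarrow> real \<Rightarrow> real \<Rightarrow> real \<Rightarrow> bool"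
where
  "pathwise_unique_upto_hitting M F B \<mu>1 \<mu>2 \<sigma> r \<theta> \<longleftrightarrow>
     (\<forall>R \<Theta> R' \<Theta>'.
        strong_solution_upto_hitting M F B \<mu>1 \<mu>2 \<sigma> r \<theta> R \<Theta> \<and>
        strong_solution_upto_hitting M F B \<mu>1 \<mu>2 \<sigma> r \<theta> R' \<Theta>' \<longrightarrow>
        (AE \<omega> in M. hitting_time R \<omega> = hitting_time R' \<omega> \<and>
           (\<forall>t. 0 \<le> t \<and> ereal t \<le> hitting_time R \<omega> \<longrightarrow>
              R t \<omega> = R' t \<omega> \<and> \<Theta> t \<omega> = \<Theta>' t \<omega>)))"


section \<open>Sailboat navigation coefficients\<close>

text \<open>Reduction of \<open>\<theta>\<close> modulo \<open>2\<pi>\<close> into \<open>[0,2\<pi>)\<close> gives the \<open>2\<pi>\<close>-periodic extension.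
  The first coefficient does not depend on \<open>r\<close>.\<close>

definition sail_mu1 :: "real \<Rightarrow> real \<Rightarrow> real \<Rightarrow> real" where
  "sail_mu1 v r \<theta> =
     (let \<phi> = \<theta> rmod (2 * pi) in
      if \<phi> < pi / 4 then - v * cos \<phi>
      else if \<phi> < pi / 2 then - v * sin \<phi>
      else if \<phi> < pi then - v
      else if \<phi> < 5 * pi / 4 then v * cos \<phi>
      else if \<phi> < 3 * pi / 2 then v * sin \<phi>
      else - v)"

definition sail_mu2 :: "real \<Rightarrow> real \<Rightarrow> real \<Rightarrow> real" where
  "sail_mu2 v r \<theta> =
     (let \<phi> = \<theta> rmod (2 * pi) in
      if \<phi> < pi / 4 then v * sin \<phi> / r
      else if \<phi> < pi / 2 then - (v * cos \<phi> / r)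
      else if \<phi> < pi then 0
      else if \<phi> < 5 * pi / 4 then - (v * sin \<phi> / r)
      else if \<phi> < 3 * pi / 2 then v * cos \<phi> / r
      else 0)"

end

theory Submission
  imports Defs
begin

text \<open>
  Both claims are proved path by path. The radial speed depends on the angle only, in a Lipschitz way, and the
  angular drift \<open>g(\<theta>) / r\<close> has only downward jumps, so that it is one-sided Lipschitz in \<open>\<theta>\<close>: away from the origin,
  Gronwall's inequality compares any two approximate solutions driven by the same path. This gives uniqueness,
  and it makes the Euler polygons converge. Their limit solves the equation because the angle differs from
  \<open>\<sigma> B\<close> by a Lipschitz function, and almost surely a Brownian path spends no time on a Lipschitz curve; hence the angle
  spends no time at the jumps of \<open>g\<close>. The hitting time \<open>\<tau>\<close> is finite, but the angular drift blows up there. Since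
  \<open>g\<close> has a constant sign on the pieces of the circle and the noise hardly moves near \<open>\<tau>\<close>, the angle can
  cross a piece in one direction only, and therefore converges.
\<close>

section \<open>Stability of perturbed solutions\<close>

text \<open>Up to measurability, everything concerns one continuous path \<open>w\<close> in place
  of \<open>\<sigma> * B\<close>, and \<open>m\<close>, \<open>g\<close> are the coefficients at
  radius 1. The radial speed lies between \<open>- v\<close> and \<open>- v / 2\<close> whatever the
  angle does. Hence the radius decreases, for solutions and polygons alike: a lower bound
  \<open>\<epsilon>\<close> at the end of an interval holds on all of it, and the origin is reached
  by time \<open>2 * r / v\<close>. The jumps of \<open>g\<close> sit at \<open>pi / 4\<close>
  modulo \<open>pi\<close>, and the drift pushes towards them from both sides. This is harmless for
  stability but not for existence: without noise a path would be held at the jump, where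
  \<open>g\<close> does not take the value 0 that staying there requires. So it is existence that
  calls for a property of Brownian paths. Because the polygons form Cauchy sequences, no subsequence
  depending on the path is selected. The solution is an explicit functional of the path up to the
  current time, and its adaptedness to both filtrations is read off from the construction.\<close>

lemma gronwall_integral:
  fixes f :: "real \<Rightarrow> real"
  assumes cont: "continuous_on {0..T} f" and K: "0 \<le> K"
    and bound: "\<And>t. t \<in> {0..T} \<Longrightarrow> f t \<le> a + K * integral {0..t} f"
    and t: "t \<in> {0..T}"
  shows "f t \<le> a * exp (K * t)"
proof -
  define U where "U s = integral {0..s} f" for s
  define H where "H s = (a + K * U s) * exp (- K * s)" for s
  have U: "(U has_real_derivative f s) (at s within {0..T})" if "s \<in> {0..T}" for s
    unfolding U_def using integral_has_real_derivative[OF cont that] .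
  have H: "(H has_real_derivative K * f s * exp (- K * s) - K * (a + K * U s) * exp (- K * s))
      (at s within {0..T})" if "s \<in> {0..T}" for s
    unfolding H_def
    by (auto intro!: derivative_eq_intros U[OF that] simp: algebra_simps)
  have "H t \<le> H 0"
  proof (rule DERIV_nonpos_imp_decreasing_open[where f = H])
    show "0 \<le> t" using t by simp
    have "continuous_on {0..T} H"
      using H DERIV_continuous continuous_on_eq_continuous_within by blast
    then show "continuous_on {0..t} H"
      using t by (auto intro: continuous_on_subset)
    fix s assume s: "0 < s" "s < t"
    then have "s \<in> {0<..<T}" using t by auto
    then have "at s within {0..T} = at s"
      by (intro at_within_interior) auto
    moreover have "K * (f s - (a + K * U s)) * exp (- K * s) \<le> 0"
    proof -
      have "f s - (a + K * U s) \<le> 0" using bound[of s] s t by (auto simp: U_def)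
      then show ?thesis using K by (simp add: mult_nonneg_nonpos mult_nonpos_nonneg)
    qed
    ultimately show "\<exists>y. DERIV H s :> y \<and> y \<le> 0"
      using H[of s] s t by (auto simp: algebra_simps)
  qed
  then have "(a + K * U t) * exp (- K * t) \<le> a" by (simp add: H_def U_def)
  then have "(a + K * U t) * exp (- K * t) * exp (K * t) \<le> a * exp (K * t)"
    by (intro mult_right_mono) auto
  then have "a + K * U t \<le> a * exp (K * t)"
    by (simp add: mult.assoc flip: exp_add)
  then show ?thesis using bound[OF t] by (simp add: U_def)
qed

text \<open>The supremum of the closed level set is the last passage; a later dip below
  \<open>c\<close> would force one more passage, by the intermediate value theorem.\<close>

lemma last_passage:
  fixes y :: "real \<Rightarrow> real"
  assumes cont: "continuous_on {s..t} y" and st: "s \<le> t" and "y s \<le> c" "c < y t"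
  obtains q where "q \<in> {s..t}" "y q = c" "\<And>p. p \<in> {q..t} \<Longrightarrow> c \<le> y p"
proof -
  define S where "S = {q \<in> {s..t}. y q = c}"
  have "closed S"
    unfolding S_def using continuous_closed_preimage_constant[OF cont] by simp
  moreover have "\<exists>q\<ge>s. q \<le> t \<and> y q = c"
    using assms by (intro IVT') auto
  then have "S \<noteq> {}" by (auto simp: S_def)
  moreover have bdd: "bdd_above S" by (auto simp: S_def intro: bdd_aboveI[of _ t])
  ultimately have "Sup S \<in> S" by (simp add: closed_contains_Sup)
  then obtain q where q: "q = Sup S" "q \<in> {s..t}" "y q = c" by (auto simp: S_def)
  have "c \<le> y p" if "p \<in> {q..t}" for p
  proof (rule ccontr)
    assume "\<not> c \<le> y p"
    moreover have "continuous_on {p..t} y"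
      using cont that q by (auto intro: continuous_on_subset)
    ultimately have "\<exists>q'\<ge>p. q' \<le> t \<and> y q' = c"
      using assms that by (intro IVT') auto
    then obtain q' where q': "p \<le> q'" "q' \<le> t" "y q' = c" by blast
    then have "q' \<in> S" using that q by (auto simp: S_def)
    then have "q' \<le> q" using bdd q by (auto intro: cSup_upper)
    then have "q' = p" using q'(1) that by simp
    then show False using q'(3) \<open>\<not> c \<le> y p\<close> by simp
  qed
  with q that show ?thesis by blast
qed

text \<open>Only the part of the path after its last passage through the level \<open>c\<close> contributes.\<close>

lemma growth_above_level:
  fixes D u p :: "real \<Rightarrow> real"
  assumes D: "\<And>t. t \<in> {0..T} \<Longrightarrow> (u has_integral D t) {0..t}"
    and p: "continuous_on {0..T} p" "\<And>s. s \<in> {0..T} \<Longrightarrow> 0 \<le> p s"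
    and up: "\<And>s. s \<in> {0..T} \<Longrightarrow> c \<le> D s \<Longrightarrow> u s \<le> p s"
    and c: "0 \<le> c" and t: "t \<in> {0..T}"
  shows "D t \<le> c + integral {0..t} p"
proof (cases "D t \<le> c")
  case True
  have "continuous_on {0..t} p" using p(1) t by (auto intro: continuous_on_subset)
  then have "0 \<le> integral {0..t} p"
    using p(2) t by (intro integral_nonneg integrable_continuous_real) auto
  with True show ?thesis by simp
next
  case False
  have int: "u integrable_on {0..T}" using D[of T] t by (auto simp: integrable_on_def)
  have Deq: "D s = integral {0..s} u" if "s \<in> {0..T}" for s
    using D[OF that] by (simp add: integral_unique)
  have "continuous_on {0..T} (\<lambda>s. integral {0..s} u)"
    by (rule indefinite_integral_continuous_1[OF int])
  then have cont: "continuous_on {0..T} D"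
    by (rule continuous_on_eq) (simp add: Deq)
  have D0: "D 0 = 0" using t by (simp add: Deq)
  have "continuous_on {0..t} D" using cont t by (auto intro: continuous_on_subset)
  then obtain s0 where s0: "s0 \<in> {0..t}" "D s0 = c" and above: "\<And>s. s \<in> {s0..t} \<Longrightarrow> c \<le> D s"
    using False D0 c t by (rule_tac last_passage[of 0 t D c]) auto
  have i1: "u integrable_on {0..t}" "u integrable_on {s0..t}"
    using t s0 by (auto intro: integrable_on_subinterval[OF int])
  have cp: "continuous_on {0..t} p" "continuous_on {s0..t} p"
    using p(1) t s0 by (auto intro: continuous_on_subset)
  have "D t = integral {0..s0} u + integral {s0..t} u"
    using Deq[OF t] i1 s0 by (simp add: Henstock_Kurzweil_Integration.integral_combine)
  also have "integral {0..s0} u = c" using Deq[of s0] s0 t by auto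
  also have "integral {s0..t} u \<le> integral {s0..t} p"
    using i1 integrable_continuous_real[OF cp(2)] up above s0 t by (intro integral_le) auto
  also have "\<dots> \<le> integral {0..t} p"
    using cp p(2) s0 t by (intro integral_subset_le integrable_continuous_real) auto
  finally show ?thesis by simp
qed

text \<open>Here \<open>m\<close> and \<open>g\<close> stand for the two coefficients at radius 1;
  the radius enters the system only as a divisor of \<open>g\<close>. The one constant
  \<open>v\<close> serves all bounds because the profiles of the coefficients have bound 1 and
  (one-sided) Lipschitz constant 1. The factor \<open>1 / 2\<close> is a convenient number below
  \<open>cos (pi / 4)\<close>, the least value of the speed profile.\<close>

locale sail_drift =
  fixes m g :: "real \<Rightarrow> real" and v :: real
  assumes v_pos: "0 < v"
    and m_lipschitz: "\<bar>m x - m y\<bar> \<le> v * \<bar>x - y\<bar>"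
    and m_lower: "- v \<le> m x" and m_upper: "m x \<le> - v / 2"
    and g_bound: "\<bar>g x\<bar> \<le> v"
    and g_one_sided: "y \<le> x \<Longrightarrow> g x - g y \<le> v * (x - y)"
begin

text \<open>This is the one-sided Lipschitz condition read as monotonicity. It gives both the
  measurability of \<open>g\<close> and the countability of its discontinuities.\<close>

lemma drift_compensated_mono: "mono (\<lambda>x. v * x - g x)"
  using g_one_sided by (intro monoI) (fastforce simp: algebra_simps)

lemma g_measurable [measurable]: "g \<in> borel_measurable borel"
proof -
  have "(\<lambda>x. v * x - (v * x - g x)) \<in> borel_measurable borel"
    by (intro borel_measurable_diff borel_measurable_mono[OF drift_compensated_mono]) measurable
  then show ?thesis by simp
qed

lemma g_discontinuities: "countable {a. \<not> isCont g a}"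
proof (rule countable_subset[OF _ mono_ctble_discont[OF drift_compensated_mono]])
  have "isCont (\<lambda>x. v * x - (v * x - g x)) a" if "isCont (\<lambda>x. v * x - g x) a" for a
    by (intro continuous_intros that)
  then show "{a. \<not> isCont g a} \<subseteq> {a. \<not> isCont (\<lambda>x. v * x - g x) a}" by auto
qed

lemma m_abs: "\<bar>m x\<bar> \<le> v"
  using m_lower[of x] m_upper[of x] v_pos by linarith

lemma m_continuous: "continuous_on A m"
proof -
  have "v-lipschitz_on A m"
    using m_lipschitz v_pos by (intro lipschitz_onI) (auto simp: dist_real_def)
  then show ?thesis by (rule lipschitz_on_continuous_on)
qed

text \<open>The coefficients are evaluated at a path \<open>(\<rho>', x')\<close> that stays within \<open>\<delta>\<close> of \<open>(\<rho>, x)\<close>: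
  for an exact solution both coincide, for an Euler polygon it is the path frozen at the grid points.\<close>

definition perturbed_solution ::
  "real \<Rightarrow> real \<Rightarrow> real \<Rightarrow> (real \<Rightarrow> real) \<Rightarrow> real \<Rightarrow> real \<Rightarrow> (real \<Rightarrow> real) \<Rightarrow> (real \<Rightarrow> real) \<Rightarrow>
   (real \<Rightarrow> real) \<Rightarrow> (real \<Rightarrow> real) \<Rightarrow> bool"
where
  "perturbed_solution \<delta> \<epsilon> T w r \<theta> \<rho> x \<rho>' x' \<longleftrightarrow>
     (\<forall>t\<in>{0..T}. \<bar>\<rho>' t - \<rho> t\<bar> \<le> \<delta> \<and> \<bar>x' t - x t\<bar> \<le> \<delta> \<and> \<epsilon> \<le> \<rho>' t \<and>
        ((\<lambda>s. m (x' s)) has_integral \<rho> t - r) {0..t} \<and>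
        ((\<lambda>s. g (x' s) / \<rho>' s) has_integral x t - \<theta> - w t) {0..t})"

text \<open>The angle is changed at fixed radius \<open>a\<close>, where the one-sided bound applies
  thanks to \<open>y \<le> x\<close>; then the radius is changed at fixed angle \<open>y\<close>,
  where the size of \<open>g\<close> suffices.\<close>

lemma drift_difference:
  assumes "0 < \<epsilon>" "\<epsilon> \<le> a" "\<epsilon> \<le> b" "y \<le> x"
  shows "g x / a - g y / b \<le> (v / \<epsilon>) * (x - y) + (v / \<epsilon>\<^sup>2) * \<bar>a - b\<bar>"
proof -
  have "g x / a - g y / b = (g x - g y) / a + g y * (b - a) / (a * b)"
    using assms by (simp add: field_simps)
  also have "(g x - g y) / a \<le> v * (x - y) / a"
    using assms g_one_sided[of y x] by (intro divide_right_mono) auto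
  also have "\<dots> \<le> v * (x - y) / \<epsilon>"
    using assms v_pos by (intro divide_left_mono) auto
  also have "g y * (b - a) / (a * b) \<le> \<bar>g y * (b - a)\<bar> / (a * b)"
    using assms by (intro divide_right_mono) auto
  also have "\<dots> \<le> (v * \<bar>a - b\<bar>) / (a * b)"
    using assms g_bound[of y] by (intro divide_right_mono) (auto simp: abs_mult abs_minus_commute mult_right_mono)
  also have "\<dots> \<le> (v * \<bar>a - b\<bar>) / \<epsilon>\<^sup>2"
    using assms v_pos by (intro divide_left_mono) (auto simp: power2_eq_square mult_mono)
  finally show ?thesis by simp
qed

text \<open>The path \<open>w\<close> cancels in the difference of the two angles, which is thus the
  integral of a difference of drifts. At \<open>\<delta> = 0\<close> the estimate is uniqueness; for
  \<open>\<delta>\<close> tending to 0 with \<open>\<epsilon>\<close> and \<open>T\<close> fixed it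
  is the Cauchy property of the polygons.\<close>

lemma perturbed_solution_stability:
  assumes sol1: "perturbed_solution \<delta> \<epsilon> T w r \<theta> \<rho>1 x1 \<rho>1' x1'"
    and sol2: "perturbed_solution \<delta> \<epsilon> T w r \<theta> \<rho>2 x2 \<rho>2' x2'"
    and \<epsilon>: "0 < \<epsilon>" and \<delta>: "0 \<le> \<delta>" and t: "t \<in> {0..T}"
  shows "\<bar>\<rho>1 t - \<rho>2 t\<bar> + \<bar>x1 t - x2 t\<bar> \<le> 4 * \<delta> * exp ((v + v / \<epsilon> + v / \<epsilon>\<^sup>2) * t)"
proof -
  define K where "K = v / \<epsilon> + v / \<epsilon>\<^sup>2"
  have K: "0 \<le> K" using v_pos \<epsilon> by (simp add: K_def)
  note P1 = sol1[unfolded perturbed_solution_def, rule_format]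
  note P2 = sol2[unfolded perturbed_solution_def, rule_format]
  define d where "d s = \<rho>1 s - \<rho>2 s" for s
  define D where "D s = x1 s - x2 s" for s
  \<comment> \<open>The summand \<open>2 * \<delta>\<close> makes \<open>\<phi>\<close> dominate the
    distances between the perturbed positions too, and it is there that the coefficients are
    evaluated.\<close>
  define \<phi> where "\<phi> s = \<bar>d s\<bar> + \<bar>D s\<bar> + 2 * \<delta>" for s
  have d_int: "((\<lambda>s. m (x1' s) - m (x2' s)) has_integral d s) {0..s}" if "s \<in> {0..T}" for s
    using has_integral_diff[of "\<lambda>s. m (x1' s)" "\<rho>1 s - r" "{0..s}" "\<lambda>s. m (x2' s)" "\<rho>2 s - r"]
      P1[OF that] P2[OF that] by (simp add: d_def)
  have D_int: "((\<lambda>s. g (x1' s) / \<rho>1' s - g (x2' s) / \<rho>2' s) has_integral D s) {0..s}"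
    if "s \<in> {0..T}" for s
    using has_integral_diff[of "\<lambda>s. g (x1' s) / \<rho>1' s" "x1 s - \<theta> - w s" "{0..s}"
        "\<lambda>s. g (x2' s) / \<rho>2' s" "x2 s - \<theta> - w s"]
      P1[OF that] P2[OF that] by (simp add: D_def)
  have cont: "continuous_on {0..T} f" if f: "\<And>s. s \<in> {0..T} \<Longrightarrow> (u has_integral f s) {0..s}"
    for u f :: "real \<Rightarrow> real"
  proof -
    have "u integrable_on {0..T}" using f[of T] t by (auto simp: integrable_on_def)
    then have "continuous_on {0..T} (\<lambda>s. integral {0..s} u)"
      by (rule indefinite_integral_continuous_1)
    then show ?thesis by (rule continuous_on_eq) (use f in \<open>simp add: integral_unique\<close>)
  qed
  have \<phi>_cont: "continuous_on {0..T} \<phi>"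
    unfolding \<phi>_def by (intro continuous_intros cont[OF d_int] cont[OF D_int])
  have \<phi>_nonneg: "0 \<le> \<phi> s" for s using \<delta> by (simp add: \<phi>_def)
  have near: "\<bar>x1' s - x1 s\<bar> \<le> \<delta>" "\<bar>x2' s - x2 s\<bar> \<le> \<delta>" "\<bar>\<rho>1' s - \<rho>1 s\<bar> \<le> \<delta>"
    "\<bar>\<rho>2' s - \<rho>2 s\<bar> \<le> \<delta>" "\<epsilon> \<le> \<rho>1' s" "\<epsilon> \<le> \<rho>2' s" if "s \<in> {0..T}" for s
    using P1[OF that] P2[OF that] by auto
  have x_near: "\<bar>x1' s - x2' s\<bar> \<le> \<bar>D s\<bar> + 2 * \<delta>" if "s \<in> {0..T}" for s
    using near[OF that] by (simp add: D_def)
  have \<rho>_near: "\<bar>\<rho>1' s - \<rho>2' s\<bar> \<le> \<bar>d s\<bar> + 2 * \<delta>" if "s \<in> {0..T}" for s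
    using near[OF that] by (simp add: d_def)
  have bound: "v / \<epsilon> * \<bar>x1' s - x2' s\<bar> + v / \<epsilon>\<^sup>2 * \<bar>\<rho>1' s - \<rho>2' s\<bar> \<le> K * \<phi> s"
    if "s \<in> {0..T}" for s
  proof -
    have "v / \<epsilon> * \<bar>x1' s - x2' s\<bar> \<le> v / \<epsilon> * \<phi> s"
      using x_near[OF that] v_pos \<epsilon> by (intro mult_left_mono) (auto simp: \<phi>_def)
    moreover have "v / \<epsilon>\<^sup>2 * \<bar>\<rho>1' s - \<rho>2' s\<bar> \<le> v / \<epsilon>\<^sup>2 * \<phi> s"
      using \<rho>_near[OF that] v_pos \<epsilon> by (intro mult_left_mono) (auto simp: \<phi>_def)
    ultimately show ?thesis by (simp add: K_def distrib_right)
  qed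
  \<comment> \<open>Once the angles differ by \<open>2 * \<delta>\<close>, the perturbed angles are
    in the same order as the angles themselves, so the one-sided bound applies. Below that level
    nothing is known about the sign of the drift difference.\<close>
  have D_upper: "D s \<le> 2 * \<delta> + integral {0..s} (\<lambda>s. K * \<phi> s)" if "s \<in> {0..T}" for s
  proof (rule growth_above_level[OF D_int _ _ _ _ that])
    show "continuous_on {0..T} (\<lambda>s. K * \<phi> s)" by (intro continuous_intros \<phi>_cont)
    show "0 \<le> K * \<phi> s" for s using K \<phi>_nonneg by simp
    show "0 \<le> 2 * \<delta>" using \<delta> by simp
    fix s assume s: "s \<in> {0..T}" "2 * \<delta> \<le> D s"
    then have "x2' s \<le> x1' s" using near[OF s(1)] by (simp add: D_def)
    then have "g (x1' s) / \<rho>1' s - g (x2' s) / \<rho>2' s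
        \<le> v / \<epsilon> * \<bar>x1' s - x2' s\<bar> + v / \<epsilon>\<^sup>2 * \<bar>\<rho>1' s - \<rho>2' s\<bar>"
      using drift_difference[OF \<epsilon>, of "\<rho>1' s" "\<rho>2' s" "x2' s" "x1' s"] near[OF s(1)] by simp
    also have "\<dots> \<le> K * \<phi> s" by (rule bound[OF s(1)])
    finally show "g (x1' s) / \<rho>1' s - g (x2' s) / \<rho>2' s \<le> K * \<phi> s" .
  qed
  have D_int': "((\<lambda>s. g (x2' s) / \<rho>2' s - g (x1' s) / \<rho>1' s) has_integral - D s) {0..s}"
    if "s \<in> {0..T}" for s
    using has_integral_neg[OF D_int[OF that]] by simp
  have D_lower: "- D s \<le> 2 * \<delta> + integral {0..s} (\<lambda>s. K * \<phi> s)" if "s \<in> {0..T}" for s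
  proof (rule growth_above_level[OF D_int' _ _ _ _ that])
    show "continuous_on {0..T} (\<lambda>s. K * \<phi> s)" by (intro continuous_intros \<phi>_cont)
    show "0 \<le> K * \<phi> s" for s using K \<phi>_nonneg by simp
    show "0 \<le> 2 * \<delta>" using \<delta> by simp
    fix s assume s: "s \<in> {0..T}" "2 * \<delta> \<le> - D s"
    then have "x1' s \<le> x2' s" using near[OF s(1)] by (simp add: D_def)
    then have "g (x2' s) / \<rho>2' s - g (x1' s) / \<rho>1' s
        \<le> v / \<epsilon> * \<bar>x1' s - x2' s\<bar> + v / \<epsilon>\<^sup>2 * \<bar>\<rho>1' s - \<rho>2' s\<bar>"
      using drift_difference[OF \<epsilon>, of "\<rho>2' s" "\<rho>1' s" "x1' s" "x2' s"] near[OF s(1)]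
      by (simp add: abs_minus_commute)
    also have "\<dots> \<le> K * \<phi> s" by (rule bound[OF s(1)])
    finally show "g (x2' s) / \<rho>2' s - g (x1' s) / \<rho>1' s \<le> K * \<phi> s" .
  qed
  have d_bound: "\<bar>d s\<bar> \<le> integral {0..s} (\<lambda>s. v * \<phi> s)" if s: "s \<in> {0..T}" for s
  proof -
    have "continuous_on {0..s} (\<lambda>s. v * \<phi> s)"
      using s by (intro continuous_intros continuous_on_subset[OF \<phi>_cont]) auto
    then have i: "(\<lambda>s. v * \<phi> s) integrable_on {0..s}" by (rule integrable_continuous_real)
    have *: "norm (m (x1' q) - m (x2' q)) \<le> v * \<phi> q" if "q \<in> {0..s}" for q
    proof -
      have q: "q \<in> {0..T}" using that s by auto
      have "\<bar>m (x1' q) - m (x2' q)\<bar> \<le> v * \<bar>x1' q - x2' q\<bar>" by (rule m_lipschitz)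
      also have "\<dots> \<le> v * \<phi> q"
        using x_near[OF q] v_pos by (intro mult_left_mono) (auto simp: \<phi>_def)
      finally show ?thesis by simp
    qed
    have "norm (integral {0..s} (\<lambda>s. m (x1' s) - m (x2' s))) \<le> integral {0..s} (\<lambda>s. v * \<phi> s)"
      using d_int[OF s] i * by (intro integral_norm_bound_integral) (auto simp: integrable_on_def)
    then show ?thesis using d_int[OF s] by (simp add: integral_unique)
  qed
  \<comment> \<open>One \<open>2 * \<delta>\<close> is the level used above, the other is built into
    \<open>\<phi>\<close>.\<close>
  have "\<phi> s \<le> 4 * \<delta> + (v + K) * integral {0..s} \<phi>" if s: "s \<in> {0..T}" for s
  proof -
    have "\<phi> s \<le> 4 * \<delta> + integral {0..s} (\<lambda>s. v * \<phi> s) + integral {0..s} (\<lambda>s. K * \<phi> s)"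
      using D_upper[OF s] D_lower[OF s] d_bound[OF s] by (simp add: \<phi>_def)
    then show ?thesis by (simp add: algebra_simps)
  qed
  then have "\<phi> t \<le> 4 * \<delta> * exp ((v + K) * t)"
    using K v_pos by (intro gronwall_integral[OF \<phi>_cont _ _ t]) auto
  then show ?thesis using \<delta> by (simp add: \<phi>_def d_def D_def K_def add.assoc)
qed

end

section \<open>The Euler scheme\<close>

definition grid_index :: "real \<Rightarrow> real \<Rightarrow> nat" where
  "grid_index h t = nat \<lfloor>t / h\<rfloor>"

lemma grid_index_eq:
  assumes "0 < h" "real n * h \<le> t" "t < real (Suc n) * h"
  shows "grid_index h t = n"
proof -
  have "real n \<le> t / h" "t / h < real n + 1"
    using assms by (simp_all add: field_simps)
  then have "\<lfloor>t / h\<rfloor> = int n" by linarith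
  then show ?thesis by (simp add: grid_index_def)
qed

lemma grid_index_bounds:
  assumes "0 < h" "0 \<le> t"
  shows "real (grid_index h t) * h \<le> t" "t < real (Suc (grid_index h t)) * h"
proof -
  have "real (grid_index h t) = of_int \<lfloor>t / h\<rfloor>"
    using assms by (simp add: grid_index_def)
  moreover have "of_int \<lfloor>t / h\<rfloor> \<le> t / h" "t / h < of_int \<lfloor>t / h\<rfloor> + 1" by linarith+
  ultimately have "real (grid_index h t) \<le> t / h" "t / h < real (Suc (grid_index h t))"
    unfolding of_nat_Suc by linarith+
  then show "real (grid_index h t) * h \<le> t" "t < real (Suc (grid_index h t)) * h"
    using assms(1) by (simp_all add: field_simps)
qed

lemma has_integral_grid:
  fixes f :: "nat \<Rightarrow> real"
  assumes h: "0 < h" and t: "0 \<le> t"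
  shows "((\<lambda>s. f (grid_index h s)) has_integral
     h * (\<Sum>j<grid_index h t. f j) + (t - real (grid_index h t) * h) * f (grid_index h t)) {0..t}"
proof -
  have last: "((\<lambda>s. f (grid_index h s)) has_integral (t - real n * h) * f n) {real n * h..t}"
    if "real n * h \<le> t" "t \<le> real (Suc n) * h" for n t
  proof -
    have "((\<lambda>s. f n) has_integral (t - real n * h) * f n) {real n * h..t}"
      using has_integral_const_real[of "f n" "real n * h" t] that by simp
    then show ?thesis
    \<comment> \<open>At the right end of a full step the index has already jumped to
      \<open>Suc n\<close>; a single point does not affect the integral.\<close>
    proof (rule has_integral_spike_finite[rotated 2, where S = "{real (Suc n) * h}"])
      fix s assume "s \<in> {real n * h..t} - {real (Suc n) * h}"
      then show "f (grid_index h s) = f n"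
        using that h by (subst grid_index_eq[of h n s]) auto
    qed simp
  qed
  \<comment> \<open>Admitting \<open>t = real (Suc n) * h\<close> lets the induction hypothesis be
    used up to the next grid point.\<close>
  have "((\<lambda>s. f (grid_index h s)) has_integral h * (\<Sum>j<n. f j) + (t - real n * h) * f n) {0..t}"
    if "real n * h \<le> t" "t \<le> real (Suc n) * h" for n t
    using that
  proof (induction n arbitrary: t)
    case 0
    then show ?case using last[of 0 t] by simp
  next
    case (Suc n)
    have "((\<lambda>s. f (grid_index h s)) has_integral
        (h * (\<Sum>j<n. f j) + (real (Suc n) * h - real n * h) * f n) + (t - real (Suc n) * h) * f (Suc n)) {0..t}"
      using h Suc.prems
      by (intro has_integral_combine[OF _ _ Suc.IH last]) auto
    then show ?case by (simp add: algebra_simps)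
  qed
  then show ?thesis using grid_index_bounds[OF h t] by simp
qed

section \<open>Euler polygons driven by a fixed path\<close>

context sail_drift
begin

text \<open>The scheme is not stopped at the origin. It runs on past it, with division by 0 giving
  0, so the polygons exist for all times and their radial speed obeys the same bounds throughout;
  comparisons are made only while the radius is at least some \<open>\<epsilon>\<close>.\<close>

primrec euler_grid :: "real \<Rightarrow> (real \<Rightarrow> real) \<Rightarrow> real \<Rightarrow> real \<Rightarrow> nat \<Rightarrow> real \<times> real" where
  "euler_grid h w r \<theta> 0 = (r, \<theta>)"
| "euler_grid h w r \<theta> (Suc k) =
     (let (\<rho>, x) = euler_grid h w r \<theta> k
      in (\<rho> + h * m x, x + h * (g x / \<rho>) + (w (real (Suc k) * h) - w (real k * h))))"

definition frozen_R :: "real \<Rightarrow> (real \<Rightarrow> real) \<Rightarrow> real \<Rightarrow> real \<Rightarrow> real \<Rightarrow> real" where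
  "frozen_R h w r \<theta> t = fst (euler_grid h w r \<theta> (grid_index h t))"

definition frozen_T :: "real \<Rightarrow> (real \<Rightarrow> real) \<Rightarrow> real \<Rightarrow> real \<Rightarrow> real \<Rightarrow> real" where
  "frozen_T h w r \<theta> t = snd (euler_grid h w r \<theta> (grid_index h t))"

definition euler_R :: "real \<Rightarrow> (real \<Rightarrow> real) \<Rightarrow> real \<Rightarrow> real \<Rightarrow> real \<Rightarrow> real" where
  "euler_R h w r \<theta> t = frozen_R h w r \<theta> t + (t - real (grid_index h t) * h) * m (frozen_T h w r \<theta> t)"

text \<open>Only the drift is frozen over a step; the noise enters with its true increments. For
  \<open>w 0 = 0\<close> the difference of the angle and \<open>w\<close> is therefore piecewise
  linear, and a polygon is a perturbed solution for the very same \<open>w\<close>.\<close>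

definition euler_T :: "real \<Rightarrow> (real \<Rightarrow> real) \<Rightarrow> real \<Rightarrow> real \<Rightarrow> real \<Rightarrow> real" where
  "euler_T h w r \<theta> t = frozen_T h w r \<theta> t
     + (t - real (grid_index h t) * h) * (g (frozen_T h w r \<theta> t) / frozen_R h w r \<theta> t)
     + (w t - w (real (grid_index h t) * h))"

lemma euler_R_integral:
  assumes "0 < h" "0 \<le> t"
  shows "((\<lambda>s. m (frozen_T h w r \<theta> s)) has_integral euler_R h w r \<theta> t - r) {0..t}"
proof -
  have "fst (euler_grid h w r \<theta> k) = r + h * (\<Sum>j<k. m (snd (euler_grid h w r \<theta> j)))" for k
    by (induction k) (auto simp: algebra_simps split: prod.split)
  with has_integral_grid[OF assms, of "\<lambda>k. m (snd (euler_grid h w r \<theta> k))"]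
  show ?thesis by (simp add: euler_R_def frozen_R_def frozen_T_def)
qed

lemma euler_T_integral:
  assumes "0 < h" "0 \<le> t" "w 0 = 0"
  shows "((\<lambda>s. g (frozen_T h w r \<theta> s) / frozen_R h w r \<theta> s) has_integral euler_T h w r \<theta> t - \<theta> - w t) {0..t}"
proof -
  define f where "f j = g (snd (euler_grid h w r \<theta> j)) / fst (euler_grid h w r \<theta> j)" for j
  have "snd (euler_grid h w r \<theta> k) = \<theta> + h * (\<Sum>j<k. f j) + w (real k * h)" for k
    using assms(3) by (induction k) (simp_all add: case_prod_beta Let_def distrib_left f_def)
  then have "euler_T h w r \<theta> t - \<theta> - w t
      = h * (\<Sum>j<grid_index h t. f j) + (t - real (grid_index h t) * h) * f (grid_index h t)"
    unfolding euler_T_def frozen_T_def frozen_R_def f_def[symmetric] by simp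
  with has_integral_grid[OF assms(1,2), of f] show ?thesis by (simp add: frozen_R_def frozen_T_def f_def)
qed

lemma speed_bounds:
  assumes R: "\<And>t. 0 \<le> t \<Longrightarrow> t \<le> T \<Longrightarrow> ((\<lambda>s. m (x s)) has_integral R t - r) {0..t}"
    and st: "0 \<le> s" "s \<le> t" "t \<le> T"
  shows "R s - v * (t - s) \<le> R t" "R t \<le> R s - v / 2 * (t - s)"
proof -
  have int: "(\<lambda>s. m (x s)) integrable_on {0..t}" using R[of t] st by (auto simp: integrable_on_def)
  then have i2: "(\<lambda>s. m (x s)) integrable_on {s..t}"
    using st by (auto intro: integrable_on_subinterval)
  have eq: "R t - R s = integral {s..t} (\<lambda>s. m (x s))"
    using Henstock_Kurzweil_Integration.integral_combine[OF st(1,2) int]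
      integral_unique[OF R[of s]] integral_unique[OF R[of t]] st by simp
  have "integral {s..t} (\<lambda>_. - v) \<le> integral {s..t} (\<lambda>s. m (x s))"
    using m_lower by (intro integral_le i2) auto
  then show "R s - v * (t - s) \<le> R t" using eq st by (simp add: algebra_simps)
  have "integral {s..t} (\<lambda>s. m (x s)) \<le> integral {s..t} (\<lambda>_. - v / 2)"
    using m_upper by (intro integral_le i2) auto
  then show "R t \<le> R s - v / 2 * (t - s)" using eq st by (simp add: algebra_simps)
qed

lemma euler_R_speed:
  assumes "0 < h" "0 \<le> s" "s \<le> t"
  shows "euler_R h w r \<theta> s - v * (t - s) \<le> euler_R h w r \<theta> t"
    and "euler_R h w r \<theta> t \<le> euler_R h w r \<theta> s - v / 2 * (t - s)"
  using speed_bounds[where R = "euler_R h w r \<theta>" and x = "frozen_T h w r \<theta>" and r = r and T = t and s = s and t = t]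
    euler_R_integral[OF assms(1)] assms by auto

lemma euler_R_antimono:
  assumes "0 < h" "0 \<le> s" "s \<le> t"
  shows "euler_R h w r \<theta> t \<le> euler_R h w r \<theta> s"
proof -
  have "0 \<le> v / 2 * (t - s)" using assms v_pos by simp
  then show ?thesis using euler_R_speed(2)[OF assms, of w r \<theta>] by linarith
qed

lemma euler_R_0: "0 < h \<Longrightarrow> euler_R h w r \<theta> 0 = r"
  by (simp add: euler_R_def frozen_R_def grid_index_def)

lemma euler_R_continuous: "0 < h \<Longrightarrow> continuous_on {0..T} (euler_R h w r \<theta>)"
proof -
  assume h: "0 < h"
  have "v-lipschitz_on {0..T} (euler_R h w r \<theta>)"
  proof (rule lipschitz_onI)
    show "0 \<le> v" using v_pos by simp
    have *: "\<bar>euler_R h w r \<theta> s - euler_R h w r \<theta> t\<bar> \<le> v * (t - s)" if "0 \<le> s" "s \<le> t" for s t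
      using euler_R_speed(1)[OF h that, of w r \<theta>] euler_R_antimono[OF h that, of w r \<theta>] by auto
    fix s t assume "s \<in> {0..T}" "t \<in> {0..T}"
    then show "dist (euler_R h w r \<theta> s) (euler_R h w r \<theta> t) \<le> v * dist s t"
      using *[of s t] *[of t s] by (cases "s \<le> t") (auto simp: dist_real_def)
  qed
  then show ?thesis by (rule lipschitz_on_continuous_on)
qed

lemma euler_frozen_distance:
  assumes h: "0 < h" and t: "0 \<le> t" and \<epsilon>: "0 < \<epsilon>" "\<epsilon> \<le> euler_R h w r \<theta> t"
    and osc: "\<And>s. 0 \<le> s \<Longrightarrow> s \<le> t \<Longrightarrow> t - s \<le> h \<Longrightarrow> \<bar>w t - w s\<bar> \<le> \<eta>"
  shows "\<bar>frozen_R h w r \<theta> t - euler_R h w r \<theta> t\<bar> \<le> v * h"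
    and "\<epsilon> \<le> frozen_R h w r \<theta> t"
    and "\<bar>frozen_T h w r \<theta> t - euler_T h w r \<theta> t\<bar> \<le> v * h / \<epsilon> + \<eta>"
proof -
  define q where "q = t - real (grid_index h t) * h"
  have q: "0 \<le> q" "q \<le> h"
    using grid_index_bounds[OF h t] by (auto simp: q_def algebra_simps)
  have "q * \<bar>m (frozen_T h w r \<theta> t)\<bar> \<le> h * v"
    using q m_abs v_pos h by (intro mult_mono) auto
  then show "\<bar>frozen_R h w r \<theta> t - euler_R h w r \<theta> t\<bar> \<le> v * h"
    using q unfolding euler_R_def q_def[symmetric] by (simp add: abs_mult mult.commute)
  have "m (frozen_T h w r \<theta> t) \<le> 0" using m_upper[of "frozen_T h w r \<theta> t"] v_pos by simp
  then have "q * m (frozen_T h w r \<theta> t) \<le> 0" using q by (simp add: mult_nonneg_nonpos)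
  then show R: "\<epsilon> \<le> frozen_R h w r \<theta> t" using \<epsilon> by (simp add: euler_R_def flip: q_def)
  have "\<bar>g (frozen_T h w r \<theta> t) / frozen_R h w r \<theta> t\<bar> \<le> v / \<epsilon>"
    using R \<epsilon> g_bound v_pos unfolding abs_divide by (intro frac_le) auto
  then have "\<bar>q * (g (frozen_T h w r \<theta> t) / frozen_R h w r \<theta> t)\<bar> \<le> h * (v / \<epsilon>)"
    unfolding abs_mult using q h by (intro mult_mono) auto
  moreover have "\<bar>w t - w (real (grid_index h t) * h)\<bar> \<le> \<eta>"
    using grid_index_bounds[OF h t] h by (intro osc) (auto simp: algebra_simps)
  ultimately show "\<bar>frozen_T h w r \<theta> t - euler_T h w r \<theta> t\<bar> \<le> v * h / \<epsilon> + \<eta>"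
    unfolding euler_T_def q_def[symmetric] by (simp only: mult.commute[of v h] times_divide_eq_right)
qed

text \<open>A bound on the radius at the end \<open>s\<close> is enough because the radius
  decreases. The index \<open>N\<close> is uniform in \<open>s\<close>, since the time at which a
  polygon comes down to \<open>\<epsilon>\<close> varies with \<open>n\<close>.\<close>

lemma euler_perturbed_solution:
  assumes w: "continuous_on {0..} w" "w 0 = 0" and h: "\<And>n. 0 < h n" "h \<longlonglongrightarrow> 0"
    and \<epsilon>: "0 < \<epsilon>" and \<delta>: "0 < \<delta>"
  shows "\<exists>N. \<forall>n\<ge>N. \<forall>s. 0 \<le> s \<longrightarrow> s \<le> T \<longrightarrow> \<epsilon> \<le> euler_R (h n) w r \<theta> s \<longrightarrow>
    perturbed_solution \<delta> \<epsilon> s w r \<theta> (euler_R (h n) w r \<theta>) (euler_T (h n) w r \<theta>)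
      (frozen_R (h n) w r \<theta>) (frozen_T (h n) w r \<theta>)"
proof -
  have "continuous_on {0..T} w" using w(1) by (rule continuous_on_subset) auto
  then have "uniformly_continuous_on {0..T} w" by (rule compact_uniformly_continuous) simp
  then obtain e where e: "0 < e" "\<And>s t. s \<in> {0..T} \<Longrightarrow> t \<in> {0..T} \<Longrightarrow> dist s t < e \<Longrightarrow> dist (w s) (w t) < \<delta> / 2"
    using \<delta> unfolding uniformly_continuous_on_def by (metis half_gt_zero)
  \<comment> \<open>The bound \<open>\<delta> / v\<close> takes care of the radius. The angle
    receives half of \<open>\<delta>\<close> from the drift, by the bound
    \<open>\<delta> * \<epsilon> / (2 * v)\<close>, and the other half from the oscillation of
    \<open>w\<close> within one step, by the bound \<open>e\<close>.\<close>
  define b where "b = min e (min (\<delta> / v) (\<delta> * \<epsilon> / (2 * v)))"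
  have "0 < b" using e \<delta> \<epsilon> v_pos by (simp add: b_def)
  then have "\<forall>\<^sub>F n in sequentially. h n < b" using h(2) by (simp add: order_tendstoD)
  then obtain N where N: "\<And>n. N \<le> n \<Longrightarrow> h n < b" by (auto simp: eventually_sequentially)
  show ?thesis
  proof (intro exI allI impI)
    fix n s assume n: "N \<le> n" and s: "0 \<le> s" "s \<le> T" "\<epsilon> \<le> euler_R (h n) w r \<theta> s"
    have hb: "h n < e" "v * h n \<le> \<delta>" "v * h n / \<epsilon> \<le> \<delta> / 2"
      using N[OF n] v_pos \<epsilon> by (auto simp: b_def field_simps)
    show "perturbed_solution \<delta> \<epsilon> s w r \<theta> (euler_R (h n) w r \<theta>) (euler_T (h n) w r \<theta>)
      (frozen_R (h n) w r \<theta>) (frozen_T (h n) w r \<theta>)"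
      unfolding perturbed_solution_def
    proof
      fix t assume t: "t \<in> {0..s}"
      have Rt: "\<epsilon> \<le> euler_R (h n) w r \<theta> t"
        using euler_R_antimono[of "h n" t s w r \<theta>] h(1)[of n] t s by auto
      have osc: "\<bar>w t - w q\<bar> \<le> \<delta> / 2" if "0 \<le> q" "q \<le> t" "t - q \<le> h n" for q
        using e(2)[of t q] that t s hb(1) by (auto simp: dist_real_def)
      have t0: "0 \<le> t" using t by simp
      note d = euler_frozen_distance[OF h(1) t0 \<epsilon> Rt osc]
      have "\<bar>frozen_R (h n) w r \<theta> t - euler_R (h n) w r \<theta> t\<bar> \<le> \<delta>"
        using d(1) hb(2) by linarith
      moreover have "\<bar>frozen_T (h n) w r \<theta> t - euler_T (h n) w r \<theta> t\<bar> \<le> \<delta>"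
        using d(3) hb(3) by linarith
      ultimately show "\<bar>frozen_R (h n) w r \<theta> t - euler_R (h n) w r \<theta> t\<bar> \<le> \<delta> \<and>
        \<bar>frozen_T (h n) w r \<theta> t - euler_T (h n) w r \<theta> t\<bar> \<le> \<delta> \<and> \<epsilon> \<le> frozen_R (h n) w r \<theta> t \<and>
        ((\<lambda>s. m (frozen_T (h n) w r \<theta> s)) has_integral euler_R (h n) w r \<theta> t - r) {0..t} \<and>
        ((\<lambda>s. g (frozen_T (h n) w r \<theta> s) / frozen_R (h n) w r \<theta> s) has_integral
          euler_T (h n) w r \<theta> t - \<theta> - w t) {0..t}"
        using d(2) euler_R_integral[OF h(1) t0, of n w r \<theta>] euler_T_integral[where w = w, OF h(1) t0 w(2), of n r \<theta>]
        by blast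
    qed
  qed
qed

lemma euler_close:
  assumes w: "continuous_on {0..} w" "w 0 = 0" and h: "\<And>n. 0 < h n" "h \<longlonglongrightarrow> 0"
    and \<epsilon>: "0 < \<epsilon>" and \<eta>: "0 < \<eta>"
  shows "\<exists>N. \<forall>k\<ge>N. \<forall>n\<ge>N. \<forall>s. 0 \<le> s \<longrightarrow> s \<le> T \<longrightarrow>
     \<epsilon> \<le> euler_R (h k) w r \<theta> s \<longrightarrow> \<epsilon> \<le> euler_R (h n) w r \<theta> s \<longrightarrow>
     \<bar>euler_R (h k) w r \<theta> s - euler_R (h n) w r \<theta> s\<bar> + \<bar>euler_T (h k) w r \<theta> s - euler_T (h n) w r \<theta> s\<bar> < \<eta>"
proof -
  define C where "C = v + v / \<epsilon> + v / \<epsilon>\<^sup>2"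
  \<comment> \<open>Chosen so that \<open>4 * \<delta> * exp (C * T)\<close> is
    \<open>\<eta> / 2\<close>.\<close>
  define \<delta> where "\<delta> = \<eta> / (8 * exp (C * T))"
  have \<delta>: "0 < \<delta>" using \<eta> by (simp add: \<delta>_def)
  have C: "0 \<le> C" using v_pos \<epsilon> by (simp add: C_def)
  obtain N where N: "\<And>n s. N \<le> n \<Longrightarrow> 0 \<le> s \<Longrightarrow> s \<le> T \<Longrightarrow> \<epsilon> \<le> euler_R (h n) w r \<theta> s \<Longrightarrow>
    perturbed_solution \<delta> \<epsilon> s w r \<theta> (euler_R (h n) w r \<theta>) (euler_T (h n) w r \<theta>)
      (frozen_R (h n) w r \<theta>) (frozen_T (h n) w r \<theta>)"
    using euler_perturbed_solution[OF w h \<epsilon> \<delta>] by metis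
  show ?thesis
  proof (intro exI allI impI)
    fix k n s assume A: "N \<le> k" "N \<le> n" "0 \<le> s" "s \<le> T"
      "\<epsilon> \<le> euler_R (h k) w r \<theta> s" "\<epsilon> \<le> euler_R (h n) w r \<theta> s"
    have "\<bar>euler_R (h k) w r \<theta> s - euler_R (h n) w r \<theta> s\<bar> + \<bar>euler_T (h k) w r \<theta> s - euler_T (h n) w r \<theta> s\<bar>
        \<le> 4 * \<delta> * exp (C * s)"
      unfolding C_def using A \<delta> \<epsilon>
      by (intro perturbed_solution_stability[OF N[of k s] N[of n s]]) auto
    also have "\<dots> \<le> 4 * \<delta> * exp (C * T)"
      using A C \<delta> by (intro mult_left_mono) (auto intro: mult_left_mono)
    also have "\<dots> < \<eta>" using \<eta> by (simp add: \<delta>_def)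
    finally show "\<bar>euler_R (h k) w r \<theta> s - euler_R (h n) w r \<theta> s\<bar>
      + \<bar>euler_T (h k) w r \<theta> s - euler_T (h n) w r \<theta> s\<bar> < \<eta>" .
  qed
qed

text \<open>If one fine polygon stays away from the origin up to time \<open>T\<close>, then another one cannot come close
  to it before \<open>T\<close>, since until then the two are close to each other.\<close>

lemma euler_R_eventually_ge:
  assumes w: "continuous_on {0..} w" "w 0 = 0" and h: "\<And>n. 0 < h n" "h \<longlonglongrightarrow> 0"
    and \<epsilon>: "0 < \<epsilon>" and T: "0 \<le> T" and freq: "\<exists>\<^sub>F n in sequentially. 2 * \<epsilon> \<le> euler_R (h n) w r \<theta> T"
  shows "\<forall>\<^sub>F n in sequentially. \<epsilon> \<le> euler_R (h n) w r \<theta> T"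
proof -
  obtain N where N: "\<And>k n s. N \<le> k \<Longrightarrow> N \<le> n \<Longrightarrow> 0 \<le> s \<Longrightarrow> s \<le> T \<Longrightarrow>
     \<epsilon> \<le> euler_R (h k) w r \<theta> s \<Longrightarrow> \<epsilon> \<le> euler_R (h n) w r \<theta> s \<Longrightarrow>
     \<bar>euler_R (h k) w r \<theta> s - euler_R (h n) w r \<theta> s\<bar> + \<bar>euler_T (h k) w r \<theta> s - euler_T (h n) w r \<theta> s\<bar> < \<epsilon>"
    using euler_close[OF w h \<epsilon> \<epsilon>] by metis
  obtain n where n: "N \<le> n" "2 * \<epsilon> \<le> euler_R (h n) w r \<theta> T"
    using freq unfolding frequently_sequentially by blast
  have "\<epsilon> \<le> euler_R (h k) w r \<theta> T" if k: "N \<le> k" for k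
  proof (rule ccontr)
    assume neg: "\<not> \<epsilon> \<le> euler_R (h k) w r \<theta> T"
    have "2 * \<epsilon> \<le> r" using n(2) euler_R_antimono[of "h n" 0 T w r \<theta>] h(1)[of n] euler_R_0[OF h(1)] T by simp
    then have "\<exists>s\<ge>0. s \<le> T \<and> euler_R (h k) w r \<theta> s = \<epsilon>"
      using neg \<epsilon> T euler_R_0[OF h(1)] euler_R_continuous[OF h(1)] by (intro IVT2') auto
    then obtain s where s: "0 \<le> s" "s \<le> T" "euler_R (h k) w r \<theta> s = \<epsilon>" by blast
    moreover have "2 * \<epsilon> \<le> euler_R (h n) w r \<theta> s"
      using n(2) euler_R_antimono[of "h n" s T w r \<theta>] h(1)[of n] s by simp
    ultimately show False using N[OF k n(1) s(1,2)] \<epsilon> by simp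
  qed
  then show ?thesis by (auto simp: eventually_sequentially)
qed

end

section \<open>Convergence of the Euler scheme\<close>

text \<open>For such a \<open>w\<close>, the angular part spends no time at the countably many discontinuities of the drift,
  since its difference with \<open>w\<close> is Lipschitz.\<close>

definition no_occupation :: "(real \<Rightarrow> real) \<Rightarrow> bool" where
  "no_occupation w \<longleftrightarrow> (\<forall>T L z a. L-lipschitz_on {0..T} z \<longrightarrow> negligible {s \<in> {0..T}. z s + w s = a})"

lemma real_limsup_bounds:
  fixes a :: "nat \<Rightarrow> real"
  assumes "\<And>n. \<bar>a n\<bar> \<le> C"
  shows "ereal (real_of_ereal (limsup (\<lambda>n. ereal (a n)))) = limsup (\<lambda>n. ereal (a n))"
proof -
  have "limsup (\<lambda>n. ereal (a n)) \<le> ereal C"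
    using assms by (intro Limsup_bounded always_eventually) (auto simp: abs_le_iff)
  moreover have "ereal (- C) \<le> limsup (\<lambda>n. ereal (a n))"
  proof -
    have "limsup (\<lambda>n. ereal (- C)) \<le> limsup (\<lambda>n. ereal (a n))"
    proof (intro Limsup_mono always_eventually allI)
      show "ereal (- C) \<le> ereal (a n)" for n using assms[of n] by simp
    qed
    then show ?thesis by (simp add: Limsup_const)
  qed
  ultimately have "\<bar>limsup (\<lambda>n. ereal (a n))\<bar> \<noteq> \<infinity>" by auto
  then show ?thesis by (simp add: ereal_real)
qed

text \<open>This carries the speed bounds from the polygons to their upper limit. Boundedness keeps
  the upper limits finite, so that they can be returned to the reals.\<close>

lemma real_limsup_mono_add:
  fixes a b :: "nat \<Rightarrow> real"
  assumes a: "\<And>n. \<bar>a n\<bar> \<le> C" and b: "\<And>n. \<bar>b n\<bar> \<le> C" and le: "\<And>n. a n \<le> b n + c"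
  shows "real_of_ereal (limsup (\<lambda>n. ereal (a n))) \<le> real_of_ereal (limsup (\<lambda>n. ereal (b n))) + c"
proof -
  have "limsup (\<lambda>n. ereal (a n)) \<le> limsup (\<lambda>n. ereal (b n) + ereal c)"
    using le by (intro Limsup_mono always_eventually) simp
  also have "\<dots> = limsup (\<lambda>n. ereal (b n)) + ereal c"
    by (rule Limsup_add_ereal_right) simp_all
  finally show ?thesis
    using real_limsup_bounds[of a, OF a] real_limsup_bounds[of b, OF b]
    by (metis ereal_less_eq(3) plus_ereal.simps(1))
qed

context sail_drift
begin

abbreviation mesh :: "nat \<Rightarrow> real" where "mesh n \<equiv> (1 / 2) ^ n"

lemma mesh_tendsto: "mesh \<longlonglongrightarrow> 0"
  by (rule LIMSEQ_power_zero) simp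

text \<open>The upper limit, unlike the limit, inherits the bounds on the speed for every path \<open>w\<close>. As the filtration
  is not complete, the solution has to be adapted without discarding a null set, and the bounds make the
  event \<open>t \<le> \<tau>\<close> equal to \<open>0 \<le> R t\<close>.\<close>

definition radial :: "(real \<Rightarrow> real) \<Rightarrow> real \<Rightarrow> real \<Rightarrow> real \<Rightarrow> real" where
  "radial w r \<theta> t = real_of_ereal (limsup (\<lambda>n. ereal (euler_R (mesh n) w r \<theta> t)))"

text \<open>Where the polygons diverge, \<open>lim\<close> is a fixed unspecified number, so that
  the value depends measurably on the path in any case.\<close>

definition angular :: "(real \<Rightarrow> real) \<Rightarrow> real \<Rightarrow> real \<Rightarrow> real \<Rightarrow> real" where
  "angular w r \<theta> t = lim (\<lambda>n. euler_T (mesh n) w r \<theta> t)"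

lemma euler_R_abs: "0 < h \<Longrightarrow> 0 \<le> t \<Longrightarrow> \<bar>euler_R h w r \<theta> t\<bar> \<le> \<bar>r\<bar> + v * t"
  using euler_R_speed(1)[of h 0 t w r \<theta>] euler_R_antimono[of h 0 t w r \<theta>] v_pos
  by (simp add: euler_R_0)

lemma radial_speed:
  assumes st: "0 \<le> s" "s \<le> t"
  shows "radial w r \<theta> s - v * (t - s) \<le> radial w r \<theta> t"
    and "radial w r \<theta> t \<le> radial w r \<theta> s - v / 2 * (t - s)"
proof -
  have b: "\<bar>euler_R (mesh n) w r \<theta> q\<bar> \<le> \<bar>r\<bar> + v * t" if "q \<in> {s, t}" for n q
  proof -
    have "v * q \<le> v * t" using that st v_pos by auto
    then show ?thesis using euler_R_abs[of "mesh n" q w r \<theta>] that st by auto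
  qed
  have "radial w r \<theta> s \<le> radial w r \<theta> t + v * (t - s)"
    unfolding radial_def
  proof (rule real_limsup_mono_add[OF b b])
    show "euler_R (mesh n) w r \<theta> s \<le> euler_R (mesh n) w r \<theta> t + v * (t - s)" for n
      using euler_R_speed(1)[of "mesh n" s t w r \<theta>] st by simp
  qed auto
  then show "radial w r \<theta> s - v * (t - s) \<le> radial w r \<theta> t" by simp
  have "radial w r \<theta> t \<le> radial w r \<theta> s + - v / 2 * (t - s)"
    unfolding radial_def
  proof (rule real_limsup_mono_add[OF b b])
    show "euler_R (mesh n) w r \<theta> t \<le> euler_R (mesh n) w r \<theta> s + - v / 2 * (t - s)" for n
      using euler_R_speed(2)[of "mesh n" s t w r \<theta>] st by simp
  qed auto
  then show "radial w r \<theta> t \<le> radial w r \<theta> s - v / 2 * (t - s)" by simp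
qed

lemma radial_0: "radial w r \<theta> 0 = r"
  by (simp add: radial_def euler_R_0 Limsup_const)

lemma radial_strict_antimono: "0 \<le> s \<Longrightarrow> s < t \<Longrightarrow> radial w r \<theta> t < radial w r \<theta> s"
  using radial_speed(2)[of s t w r \<theta>] v_pos by (smt (verit, best) divide_pos_pos mult_pos_pos)

lemma radial_continuous: "continuous_on {0..} (radial w r \<theta>)"
proof -
  have *: "\<bar>radial w r \<theta> s - radial w r \<theta> t\<bar> \<le> v * (t - s)" if "0 \<le> s" "s \<le> t" for s t
    using radial_speed[OF that, of w r \<theta>] that v_pos by (smt (verit, best) divide_pos_pos mult_nonneg_nonneg)
  have "v-lipschitz_on {0..} (radial w r \<theta>)"
  proof (rule lipschitz_onI)
    show "0 \<le> v" using v_pos by simp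
    fix s t :: real assume "s \<in> {0..}" "t \<in> {0..}"
    then show "dist (radial w r \<theta> s) (radial w r \<theta> t) \<le> v * dist s t"
      using *[of s t] *[of t s] by (cases "s \<le> t") (auto simp: dist_real_def)
  qed
  then show ?thesis by (rule lipschitz_on_continuous_on)
qed

text \<open>A positive upper limit puts the radius above half of it for infinitely many polygons.
  Since two fine polygons cannot separate before reaching the origin, infinitely many becomes all
  but finitely many, at the price of another factor 2.\<close>

lemma euler_R_eventually_ge_radial:
  assumes w: "continuous_on {0..} w" "w 0 = 0" and T: "0 \<le> T" and pos: "0 < radial w r \<theta> T"
  shows "\<forall>\<^sub>F n in sequentially. radial w r \<theta> T / 4 \<le> euler_R (mesh n) w r \<theta> T"
proof (rule euler_R_eventually_ge[OF w _ mesh_tendsto _ T])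
  show "\<exists>\<^sub>F n in sequentially. 2 * (radial w r \<theta> T / 4) \<le> euler_R (mesh n) w r \<theta> T"
  proof (rule ccontr)
    assume "\<not> ?thesis"
    then have "\<forall>\<^sub>F n in sequentially. ereal (euler_R (mesh n) w r \<theta> T) \<le> ereal (radial w r \<theta> T / 2)"
      by (auto simp: frequently_def not_le elim!: eventually_mono)
    then have "limsup (\<lambda>n. ereal (euler_R (mesh n) w r \<theta> T)) \<le> ereal (radial w r \<theta> T / 2)"
      by (rule Limsup_bounded)
    moreover have "ereal (radial w r \<theta> T) = limsup (\<lambda>n. ereal (euler_R (mesh n) w r \<theta> T))"
      unfolding radial_def by (rule real_limsup_bounds[OF euler_R_abs]) (use T in auto)
    ultimately show False using pos by (metis ereal_less_eq(3) field_sum_of_halves less_add_same_cancel1 not_le half_gt_zero)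
  qed
qed (use pos in auto)

text \<open>Where the upper limit is positive, all late polygons stay in the region of stability,
  hence are Cauchy; the upper limit then is a limit.\<close>

lemma euler_tendsto:
  assumes w: "continuous_on {0..} w" "w 0 = 0" and T: "0 \<le> T" and pos: "0 < radial w r \<theta> T"
  shows "(\<lambda>n. euler_R (mesh n) w r \<theta> T) \<longlonglongrightarrow> radial w r \<theta> T"
    and "(\<lambda>n. euler_T (mesh n) w r \<theta> T) \<longlonglongrightarrow> angular w r \<theta> T"
proof -
  define \<epsilon> where "\<epsilon> = radial w r \<theta> T / 4"
  have \<epsilon>: "0 < \<epsilon>" using pos by (simp add: \<epsilon>_def)
  obtain N0 where N0: "\<And>n. N0 \<le> n \<Longrightarrow> \<epsilon> \<le> euler_R (mesh n) w r \<theta> T"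
    using euler_R_eventually_ge_radial[OF assms] by (auto simp: eventually_sequentially \<epsilon>_def)
  have ex: "\<exists>N. \<forall>k\<ge>N. \<forall>n\<ge>N. \<bar>euler_R (mesh k) w r \<theta> T - euler_R (mesh n) w r \<theta> T\<bar>
      + \<bar>euler_T (mesh k) w r \<theta> T - euler_T (mesh n) w r \<theta> T\<bar> < \<eta>" if \<eta>: "0 < \<eta>" for \<eta>
  proof -
    obtain N where N: "\<And>k n s. N \<le> k \<Longrightarrow> N \<le> n \<Longrightarrow> 0 \<le> s \<Longrightarrow> s \<le> T \<Longrightarrow>
       \<epsilon> \<le> euler_R (mesh k) w r \<theta> s \<Longrightarrow> \<epsilon> \<le> euler_R (mesh n) w r \<theta> s \<Longrightarrow>
       \<bar>euler_R (mesh k) w r \<theta> s - euler_R (mesh n) w r \<theta> s\<bar> + \<bar>euler_T (mesh k) w r \<theta> s - euler_T (mesh n) w r \<theta> s\<bar> < \<eta>"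
      using euler_close[OF w _ mesh_tendsto \<epsilon> \<eta>, of T r \<theta>] by (metis zero_less_power half_gt_zero zero_less_one)
    show ?thesis
      using N[of _ _ T] N0 T by (intro exI[of _ "max N N0"]) auto
  qed
  have "Cauchy (\<lambda>n. euler_R (mesh n) w r \<theta> T)"
    unfolding Cauchy_def
  proof (intro allI impI)
    fix e :: real assume "0 < e"
    then obtain N where "\<forall>k\<ge>N. \<forall>n\<ge>N. \<bar>euler_R (mesh k) w r \<theta> T - euler_R (mesh n) w r \<theta> T\<bar>
      + \<bar>euler_T (mesh k) w r \<theta> T - euler_T (mesh n) w r \<theta> T\<bar> < e" using ex by blast
    then show "\<exists>M. \<forall>k\<ge>M. \<forall>n\<ge>M. dist (euler_R (mesh k) w r \<theta> T) (euler_R (mesh n) w r \<theta> T) < e"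
      unfolding dist_real_def by (smt (verit, best))
  qed
  then have "convergent (\<lambda>n. euler_R (mesh n) w r \<theta> T)" by (rule Cauchy_convergent)
  then obtain l where l: "(\<lambda>n. euler_R (mesh n) w r \<theta> T) \<longlonglongrightarrow> l" by (auto simp: convergent_def)
  then have "limsup (\<lambda>n. ereal (euler_R (mesh n) w r \<theta> T)) = ereal l"
    by (intro lim_imp_Limsup) auto
  with l show "(\<lambda>n. euler_R (mesh n) w r \<theta> T) \<longlonglongrightarrow> radial w r \<theta> T"
    by (simp add: radial_def)
  have "Cauchy (\<lambda>n. euler_T (mesh n) w r \<theta> T)"
    unfolding Cauchy_def
  proof (intro allI impI)
    fix e :: real assume "0 < e"
    then obtain N where "\<forall>k\<ge>N. \<forall>n\<ge>N. \<bar>euler_R (mesh k) w r \<theta> T - euler_R (mesh n) w r \<theta> T\<bar>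
      + \<bar>euler_T (mesh k) w r \<theta> T - euler_T (mesh n) w r \<theta> T\<bar> < e" using ex by blast
    then show "\<exists>M. \<forall>k\<ge>M. \<forall>n\<ge>M. dist (euler_T (mesh k) w r \<theta> T) (euler_T (mesh n) w r \<theta> T) < e"
      unfolding dist_real_def by (smt (verit, best))
  qed
  then show "(\<lambda>n. euler_T (mesh n) w r \<theta> T) \<longlonglongrightarrow> angular w r \<theta> T"
    unfolding angular_def by (simp add: Cauchy_convergent_iff convergent_LIMSEQ_iff)
qed

lemma frozen_tendsto:
  assumes w: "continuous_on {0..} w" "w 0 = 0" and T: "0 \<le> T" and pos: "0 < radial w r \<theta> T"
  shows "(\<lambda>n. frozen_R (mesh n) w r \<theta> T) \<longlonglongrightarrow> radial w r \<theta> T"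
    and "(\<lambda>n. frozen_T (mesh n) w r \<theta> T) \<longlonglongrightarrow> angular w r \<theta> T"
proof -
  define \<epsilon> where "\<epsilon> = radial w r \<theta> T / 4"
  have \<epsilon>: "0 < \<epsilon>" using pos by (simp add: \<epsilon>_def)
  obtain N0 where N0: "\<And>n. N0 \<le> n \<Longrightarrow> \<epsilon> \<le> euler_R (mesh n) w r \<theta> T"
    using euler_R_eventually_ge_radial[OF assms] by (auto simp: eventually_sequentially \<epsilon>_def)
  have ex: "\<exists>N. \<forall>n\<ge>N. \<bar>frozen_R (mesh n) w r \<theta> T - euler_R (mesh n) w r \<theta> T\<bar> \<le> \<delta> \<and>
    \<bar>frozen_T (mesh n) w r \<theta> T - euler_T (mesh n) w r \<theta> T\<bar> \<le> \<delta>" if \<delta>: "0 < \<delta>" for \<delta>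
  proof -
    obtain N where N: "\<And>n. N \<le> n \<Longrightarrow> \<epsilon> \<le> euler_R (mesh n) w r \<theta> T \<Longrightarrow>
      perturbed_solution \<delta> \<epsilon> T w r \<theta> (euler_R (mesh n) w r \<theta>) (euler_T (mesh n) w r \<theta>)
      (frozen_R (mesh n) w r \<theta>) (frozen_T (mesh n) w r \<theta>)"
      using euler_perturbed_solution[OF w _ mesh_tendsto \<epsilon> \<delta>, of T r \<theta>] T
      by (metis zero_less_power half_gt_zero zero_less_one order_refl)
    show ?thesis
    proof (intro exI[of _ "max N N0"] allI impI)
      fix n assume "max N N0 \<le> n"
      then show "\<bar>frozen_R (mesh n) w r \<theta> T - euler_R (mesh n) w r \<theta> T\<bar> \<le> \<delta> \<and>
        \<bar>frozen_T (mesh n) w r \<theta> T - euler_T (mesh n) w r \<theta> T\<bar> \<le> \<delta>"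
        using N[of n] N0[of n] T by (auto simp: perturbed_solution_def)
    qed
  qed
  have lim: "a \<longlonglongrightarrow> l" if b: "b \<longlonglongrightarrow> l"
      and ab: "\<And>\<delta>. 0 < \<delta> \<Longrightarrow> \<exists>N. \<forall>n\<ge>N. \<bar>a n - b n\<bar> \<le> \<delta>" for a b :: "nat \<Rightarrow> real" and l
  proof -
    have "(\<lambda>n. a n - b n) \<longlonglongrightarrow> 0"
    proof (rule LIMSEQ_I)
      fix e :: real assume "0 < e"
      then obtain N where "\<forall>n\<ge>N. \<bar>a n - b n\<bar> \<le> e / 2" using ab[of "e / 2"] by auto
      then show "\<exists>N. \<forall>n\<ge>N. norm (a n - b n - 0) < e"
        using \<open>0 < e\<close> by (intro exI[of _ N]) fastforce
    qed
    from tendsto_add[OF this b] show ?thesis by simp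
  qed
  show "(\<lambda>n. frozen_R (mesh n) w r \<theta> T) \<longlonglongrightarrow> radial w r \<theta> T"
    using ex by (intro lim[OF euler_tendsto(1)[OF assms]]) blast
  show "(\<lambda>n. frozen_T (mesh n) w r \<theta> T) \<longlonglongrightarrow> angular w r \<theta> T"
    using ex by (intro lim[OF euler_tendsto(2)[OF assms]]) blast
qed

lemma limit_solution:
  assumes w: "continuous_on {0..} w" "w 0 = 0" and occ: "no_occupation w"
    and T: "0 \<le> T" and pos: "0 < radial w r \<theta> T"
  shows "continuous_on {0..T} (angular w r \<theta>)"
    and "perturbed_solution 0 (radial w r \<theta> T) T w r \<theta> (radial w r \<theta>) (angular w r \<theta>)
           (radial w r \<theta>) (angular w r \<theta>)"
proof -
  define \<epsilon> where "\<epsilon> = radial w r \<theta> T / 4"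
  have \<epsilon>: "0 < \<epsilon>" using pos by (simp add: \<epsilon>_def)
  have radial_ge: "radial w r \<theta> T \<le> radial w r \<theta> t" if "t \<in> {0..T}" for t
    using radial_strict_antimono[of t T w r \<theta>] that by (cases "t = T") auto
  then have radial_pos: "0 < radial w r \<theta> t" if "t \<in> {0..T}" for t
    using pos that by (meson less_le_trans)
  note R_lim = euler_tendsto(1)[OF w _ radial_pos] and T_lim = euler_tendsto(2)[OF w _ radial_pos]
  note fR_lim = frozen_tendsto(1)[OF w _ radial_pos] and fT_lim = frozen_tendsto(2)[OF w _ radial_pos]
  obtain N0 where N0: "\<And>n. N0 \<le> n \<Longrightarrow> \<epsilon> \<le> euler_R (mesh n) w r \<theta> T"
    using euler_R_eventually_ge_radial[OF w T pos] by (auto simp: eventually_sequentially \<epsilon>_def)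
  obtain N1 where N1: "\<And>n. N1 \<le> n \<Longrightarrow> \<epsilon> \<le> euler_R (mesh n) w r \<theta> T \<Longrightarrow>
      perturbed_solution 1 \<epsilon> T w r \<theta> (euler_R (mesh n) w r \<theta>) (euler_T (mesh n) w r \<theta>)
      (frozen_R (mesh n) w r \<theta>) (frozen_T (mesh n) w r \<theta>)"
    using euler_perturbed_solution[OF w _ mesh_tendsto \<epsilon> zero_less_one, of T r \<theta>] T
    by (metis zero_less_power half_gt_zero zero_less_one order_refl)
  define N where "N = max N0 N1"
  have frozen_ge: "\<epsilon> \<le> frozen_R (mesh (n + N)) w r \<theta> t" if "t \<in> {0..T}" for n t
    using N1[of "n + N"] N0[of "n + N"] that by (auto simp: perturbed_solution_def N_def)
  define f where "f n s = g (frozen_T (mesh (n + N)) w r \<theta> s) / frozen_R (mesh (n + N)) w r \<theta> s" for n s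
  have f_bound: "\<bar>f n s\<bar> \<le> v / \<epsilon>" if "s \<in> {0..T}" for n s
    unfolding f_def abs_divide using frozen_ge[OF that, of n] \<epsilon> g_bound v_pos by (intro frac_le) auto
  have f_int: "(f n has_integral euler_T (mesh (n + N)) w r \<theta> t - \<theta> - w t) {0..t}" if "0 \<le> t" for n t
    unfolding f_def using euler_T_integral[of "mesh (n + N)" t w r \<theta>] that w(2) by simp
  have T_lim': "(\<lambda>n. euler_T (mesh (n + N)) w r \<theta> t - \<theta> - w t) \<longlonglongrightarrow> angular w r \<theta> t - \<theta> - w t"
    if "t \<in> {0..T}" for t
    using LIMSEQ_ignore_initial_segment[OF T_lim[OF _ that], of N] that by (intro tendsto_intros) auto

  \<comment> \<open>The angle without its noise is Lipschitz with constant
    \<open>v / \<epsilon>\<close> on each late polygon, hence also in the limit. This is the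
    decomposition to which \<open>no_occupation\<close> applies.\<close>
  define z where "z t = angular w r \<theta> t - w t" for t
  have z_diff: "\<bar>z t - z s\<bar> \<le> v / \<epsilon> * (t - s)" if st: "0 \<le> s" "s \<le> t" "t \<le> T" for s t
  proof -
    have "\<bar>(euler_T (mesh (n + N)) w r \<theta> t - \<theta> - w t) - (euler_T (mesh (n + N)) w r \<theta> s - \<theta> - w s)\<bar>
      \<le> v / \<epsilon> * (t - s)" for n
    proof -
      have i: "f n integrable_on {0..t}" using f_int[of t n] st by (auto simp: integrable_on_def)
      have "(euler_T (mesh (n + N)) w r \<theta> t - \<theta> - w t) - (euler_T (mesh (n + N)) w r \<theta> s - \<theta> - w s)
          = integral {s..t} (f n)"
        using Henstock_Kurzweil_Integration.integral_combine[OF st(1,2) i] integral_unique[OF f_int[of t n]] integral_unique[OF f_int[of s n]] st by simp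
      moreover have "(f n has_integral integral {s..t} (f n)) (cbox s t)"
        using st i by (auto intro: integrable_on_subinterval simp: has_integral_integral[symmetric])
      then have "norm (integral {s..t} (f n)) \<le> v / \<epsilon> * measure lborel (cbox s t)"
        using f_bound st \<epsilon> v_pos by (intro has_integral_bound) auto
      ultimately show ?thesis using st by simp
    qed
    moreover have "(\<lambda>n. \<bar>(euler_T (mesh (n + N)) w r \<theta> t - \<theta> - w t) - (euler_T (mesh (n + N)) w r \<theta> s - \<theta> - w s)\<bar>)
       \<longlonglongrightarrow> \<bar>(angular w r \<theta> t - \<theta> - w t) - (angular w r \<theta> s - \<theta> - w s)\<bar>"
      using st by (intro tendsto_intros T_lim') auto
    ultimately have "\<bar>(angular w r \<theta> t - \<theta> - w t) - (angular w r \<theta> s - \<theta> - w s)\<bar> \<le> v / \<epsilon> * (t - s)"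
      by (intro LIMSEQ_le_const2) auto
    then show ?thesis by (simp add: z_def)
  qed
  have z_lip: "(v / \<epsilon>)-lipschitz_on {0..T} z"
  proof (rule lipschitz_onI)
    show "0 \<le> v / \<epsilon>" using v_pos \<epsilon> by simp
    fix s t assume "s \<in> {0..T}" "t \<in> {0..T}"
    then show "dist (z s) (z t) \<le> v / \<epsilon> * dist s t"
      using z_diff[of s t] z_diff[of t s] by (cases "s \<le> t") (auto simp: dist_real_def abs_minus_commute)
  qed
  have "continuous_on {0..T} (\<lambda>t. z t + w t)"
    by (intro continuous_on_add lipschitz_on_continuous_on[OF z_lip] continuous_on_subset[OF w(1)]) auto
  then show "continuous_on {0..T} (angular w r \<theta>)" by (simp add: z_def)

  \<comment> \<open>These are the times at which \<open>g\<close> cannot be passed to the limit: a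
    countable union of level sets of the Lipschitz function \<open>z\<close> plus
    \<open>w\<close>.\<close>
  define E where "E = {s \<in> {0..T}. \<not> isCont g (angular w r \<theta> s)}"
  have "E = \<Union> ((\<lambda>a. {s \<in> {0..T}. z s + w s = a}) ` {a. \<not> isCont g a})"
    by (auto simp: E_def z_def)
  then have E: "negligible E"
    using g_discontinuities occ z_lip unfolding no_occupation_def by auto
  have g_int: "((\<lambda>s. g (angular w r \<theta> s) / radial w r \<theta> s) has_integral angular w r \<theta> t - \<theta> - w t) {0..t}"
    if t: "t \<in> {0..T}" for t
  proof -
    \<comment> \<open>Setting the drifts and their limit to 0 on \<open>E\<close> makes the
      convergence hold at every point, as the dominated convergence theorem for gauge integrals
      asks; being negligible, \<open>E\<close> alters no integral.\<close>
    have "((\<lambda>s. if s \<in> E then 0 else g (angular w r \<theta> s) / radial w r \<theta> s) has_integral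
       angular w r \<theta> t - \<theta> - w t) {0..t}"
    proof (rule has_integral_dominated_convergence[where h = "\<lambda>_. v / \<epsilon>"])
      show "((\<lambda>s. if s \<in> E then 0 else f k s) has_integral euler_T (mesh (k + N)) w r \<theta> t - \<theta> - w t) {0..t}" for k
        using t by (intro has_integral_spike[OF E _ f_int]) auto
      show "\<forall>s\<in>{0..t}. norm (if s \<in> E then 0 else f k s) \<le> v / \<epsilon>" for k
        using f_bound[of _ k] t \<epsilon> v_pos by auto
      show "\<forall>s\<in>{0..t}. (\<lambda>k. if s \<in> E then 0 else f k s) \<longlonglongrightarrow>
          (if s \<in> E then 0 else g (angular w r \<theta> s) / radial w r \<theta> s)"
      proof
        fix s assume s: "s \<in> {0..t}"
        then have s': "s \<in> {0..T}" using t by auto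
        have "(\<lambda>k. f k s) \<longlonglongrightarrow> g (angular w r \<theta> s) / radial w r \<theta> s" if "s \<notin> E"
          unfolding f_def
        proof (intro tendsto_divide)
          have "isCont g (angular w r \<theta> s)" using that s' by (auto simp: E_def)
          then show "(\<lambda>k. g (frozen_T (mesh (k + N)) w r \<theta> s)) \<longlonglongrightarrow> g (angular w r \<theta> s)"
            using s' by (intro isCont_tendsto_compose[where g = g] LIMSEQ_ignore_initial_segment[OF fT_lim]) auto
          show "(\<lambda>k. frozen_R (mesh (k + N)) w r \<theta> s) \<longlonglongrightarrow> radial w r \<theta> s"
            using s' by (intro LIMSEQ_ignore_initial_segment[OF fR_lim]) auto
          show "radial w r \<theta> s \<noteq> 0" using radial_pos[OF s'] by simp
        qed
        then show "(\<lambda>k. if s \<in> E then 0 else f k s) \<longlonglongrightarrow>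
          (if s \<in> E then 0 else g (angular w r \<theta> s) / radial w r \<theta> s)" by simp
      qed
      show "(\<lambda>_. v / \<epsilon>) integrable_on {0..t}" by (rule integrable_const_ivl)
      show "(\<lambda>k. euler_T (mesh (k + N)) w r \<theta> t - \<theta> - w t) \<longlonglongrightarrow> angular w r \<theta> t - \<theta> - w t"
        by (rule T_lim'[OF t])
    qed
    then show ?thesis by (rule has_integral_spike[OF E, rotated]) auto
  qed
  have m_int: "((\<lambda>s. m (angular w r \<theta> s)) has_integral radial w r \<theta> t - r) {0..t}" if t: "t \<in> {0..T}" for t
  proof (rule has_integral_dominated_convergence[where h = "\<lambda>_. v"])
    show "((\<lambda>s. m (frozen_T (mesh k) w r \<theta> s)) has_integral euler_R (mesh k) w r \<theta> t - r) {0..t}" for k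
      using t by (intro euler_R_integral) auto
    show "\<forall>s\<in>{0..t}. norm (m (frozen_T (mesh k) w r \<theta> s)) \<le> v" for k
      using m_abs by simp
    show "\<forall>s\<in>{0..t}. (\<lambda>k. m (frozen_T (mesh k) w r \<theta> s)) \<longlonglongrightarrow> m (angular w r \<theta> s)"
    proof
      fix s assume "s \<in> {0..t}"
      then have "s \<in> {0..T}" using t by auto
      moreover have "isCont m (angular w r \<theta> s)"
        using m_continuous[of UNIV] by (simp add: continuous_on_eq_continuous_at)
      ultimately show "(\<lambda>k. m (frozen_T (mesh k) w r \<theta> s)) \<longlonglongrightarrow> m (angular w r \<theta> s)"
        by (intro isCont_tendsto_compose[where g = m] fT_lim) auto
    qed
    show "(\<lambda>_. v) integrable_on {0..t}" by (rule integrable_const_ivl)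
    show "(\<lambda>k. euler_R (mesh k) w r \<theta> t - r) \<longlonglongrightarrow> radial w r \<theta> t - r"
      using t by (intro tendsto_intros R_lim) auto
  qed
  show "perturbed_solution 0 (radial w r \<theta> T) T w r \<theta> (radial w r \<theta>) (angular w r \<theta>)
           (radial w r \<theta>) (angular w r \<theta>)"
    unfolding perturbed_solution_def using m_int g_int radial_ge by simp
qed

end

section \<open>Convergence at the hitting time\<close>

text \<open>A last passage of the path reversed in time and in sign.\<close>

lemma first_passage:
  fixes y :: "real \<Rightarrow> real"
  assumes cont: "continuous_on {s..t} y" and st: "s \<le> t" and "y s < c" "c \<le> y t"
  obtains q where "q \<in> {s..t}" "y q = c" "\<And>p. p \<in> {s..q} \<Longrightarrow> y p \<le> c"
proof -
  have "continuous_on {- t..- s} (\<lambda>q. - y (- q))"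
    by (intro continuous_intros continuous_on_compose2[OF cont]) auto
  then obtain q where q: "q \<in> {- t..- s}" "- y (- q) = - c" "\<And>p. p \<in> {q..- s} \<Longrightarrow> - c \<le> - y (- p)"
    using assms by (elim last_passage[of "- t" "- s" "\<lambda>q. - y (- q)" "- c"]) auto
  show ?thesis
  proof (rule that[of "- q"])
    show "y p \<le> c" if "p \<in> {s..- q}" for p
      using q(3)[of "- p"] that by auto
  qed (use q in auto)
qed

text \<open>Between the last visit to \<open>a\<close> before the first visit to \<open>b\<close>
  and that visit to \<open>b\<close>, the path stays in \<open>{a..b}\<close>, where the drift does
  not push upwards. The rise \<open>b - a\<close> would have to come from \<open>w\<close> alone,
  which oscillates less.\<close>

lemma no_upcrossing:
  fixes y f w :: "real \<Rightarrow> real"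
  assumes cont: "continuous_on {s..t} y" and st: "s \<le> t" and ab: "a < b"
    and eq: "\<And>p q. s \<le> p \<Longrightarrow> p \<le> q \<Longrightarrow> q \<le> t \<Longrightarrow> (f has_integral y q - y p - (w q - w p)) {p..q}"
    and sign: "\<And>q. q \<in> {s..t} \<Longrightarrow> y q \<in> {a..b} \<Longrightarrow> f q \<le> 0"
    and osc: "\<And>p q. p \<in> {s..t} \<Longrightarrow> q \<in> {s..t} \<Longrightarrow> \<bar>w q - w p\<bar> < b - a"
    and start: "y s \<le> a"
  shows "y t < b"
proof (rule ccontr)
  assume "\<not> y t < b"
  then obtain q where q: "q \<in> {s..t}" "y q = b" "\<And>p. p \<in> {s..q} \<Longrightarrow> y p \<le> b"
    using first_passage[OF cont st, of b] start ab by (metis dual_order.strict_trans2 linorder_not_less)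
  have "continuous_on {s..q} y" using cont q(1) by (auto intro: continuous_on_subset)
  then obtain p where p: "p \<in> {s..q}" "y p = a" "\<And>u. u \<in> {p..q} \<Longrightarrow> a \<le> y u"
    using last_passage[of s q y a] q start ab by (metis atLeastAtMost_iff)
  have "y q - y p - (w q - w p) \<le> 0"
  proof (rule has_integral_le[OF _ has_integral_0])
    show "(f has_integral y q - y p - (w q - w p)) {p..q}"
      using p q by (intro eq) auto
    show "f u \<le> 0" if "u \<in> {p..q}" for u
      using that p q by (intro sign) auto
  qed
  then show False using osc[of p q] p q by simp
qed

lemma no_downcrossing:
  fixes y f w :: "real \<Rightarrow> real"
  assumes cont: "continuous_on {s..t} y" and st: "s \<le> t" and ab: "a < b"
    and eq: "\<And>p q. s \<le> p \<Longrightarrow> p \<le> q \<Longrightarrow> q \<le> t \<Longrightarrow> (f has_integral y q - y p - (w q - w p)) {p..q}"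
    and sign: "\<And>q. q \<in> {s..t} \<Longrightarrow> y q \<in> {a..b} \<Longrightarrow> 0 \<le> f q"
    and osc: "\<And>p q. p \<in> {s..t} \<Longrightarrow> q \<in> {s..t} \<Longrightarrow> \<bar>w q - w p\<bar> < b - a"
    and start: "b \<le> y s"
  shows "a < y t"
proof -
  have "- y t < - a"
  proof (rule no_upcrossing[where y = "\<lambda>t. - y t" and f = "\<lambda>t. - f t" and w = "\<lambda>t. - w t" and a = "- b" and s = s])
    show "continuous_on {s..t} (\<lambda>t. - y t)" by (intro continuous_intros cont)
    show "((\<lambda>t. - f t) has_integral - y q - - y p - (- w q - - w p)) {p..q}"
      if "s \<le> p" "p \<le> q" "q \<le> t" for p q
      using has_integral_neg[OF eq[OF that]] by (simp add: algebra_simps)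
    show "\<bar>- w q - - w p\<bar> < - a - - b" if "p \<in> {s..t}" "q \<in> {s..t}" for p q
      using osc[OF that] by simp
  qed (use assms in auto)
  then show ?thesis by simp
qed

text \<open>Close to \<open>\<tau>\<close> the noise \<open>w\<close> hardly moves, so the path can cross an interval on which the drift \<open>f\<close>
  has a constant sign in one direction only, however large the drift is.\<close>

lemma left_limit_of_signed_drift:
  fixes y f w g :: "real \<Rightarrow> real"
  assumes tau_pos: "0 < \<tau>" and y: "\<And>T. 0 \<le> T \<Longrightarrow> T < \<tau> \<Longrightarrow> continuous_on {0..T} y" and w: "continuous_on {0..\<tau>} w"
    and eq: "\<And>p q. 0 \<le> p \<Longrightarrow> p \<le> q \<Longrightarrow> q < \<tau> \<Longrightarrow> (f has_integral y q - y p - (w q - w p)) {p..q}"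
    and f_pos: "\<And>q. 0 \<le> q \<Longrightarrow> q < \<tau> \<Longrightarrow> 0 \<le> g (y q) \<Longrightarrow> 0 \<le> f q"
    and f_neg: "\<And>q. 0 \<le> q \<Longrightarrow> q < \<tau> \<Longrightarrow> g (y q) \<le> 0 \<Longrightarrow> f q \<le> 0"
    and pieces: "\<And>a b. a < b \<Longrightarrow> \<exists>c d. a \<le> c \<and> c < d \<and> d \<le> b \<and>
      ((\<forall>x\<in>{c..d}. 0 \<le> g x) \<or> (\<forall>x\<in>{c..d}. g x \<le> 0))"
    and len_pos: "0 < len" and zero_above: "\<And>K. \<exists>a\<ge>K. \<forall>x\<in>{a..a + len}. g x = 0"
    and zero_below: "\<And>K. \<exists>a\<le>K. \<forall>x\<in>{a - len..a}. g x = 0"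
  shows "\<exists>l. (y \<longlongrightarrow> l) (at_left \<tau>)"
proof -
  have nontriv: "at_left \<tau> \<noteq> bot" by simp
  have osc: "\<exists>t0. 0 \<le> t0 \<and> t0 < \<tau> \<and> (\<forall>p\<in>{t0..<\<tau>}. \<forall>q\<in>{t0..<\<tau>}. \<bar>w q - w p\<bar> < \<eta>)" if "0 < \<eta>" for \<eta>
  proof -
    have "uniformly_continuous_on {0..\<tau>} w" using w by (rule compact_uniformly_continuous) simp
    then obtain e where e: "0 < e" "\<And>s t. s \<in> {0..\<tau>} \<Longrightarrow> t \<in> {0..\<tau>} \<Longrightarrow> dist s t < e \<Longrightarrow> dist (w s) (w t) < \<eta>"
      using \<open>0 < \<eta>\<close> unfolding uniformly_continuous_on_def by metis
    show ?thesis
      using e tau_pos by (intro exI[of _ "max 0 (\<tau> - e / 2)"]) (auto simp: dist_real_def)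
  qed
  \<comment> \<open>The time \<open>t0\<close> depends on the length \<open>\<eta>\<close> only, not
    on the position of \<open>{a..b}\<close>: to exclude infinite limits, the interval is chosen
    after \<open>t0\<close>, according to the value of \<open>y\<close> at that time.\<close>
  have up: "\<exists>t0. 0 \<le> t0 \<and> t0 < \<tau> \<and> (\<forall>a b s t. \<eta> \<le> b - a \<longrightarrow> (\<forall>x\<in>{a..b}. g x \<le> 0) \<longrightarrow> t0 \<le> s \<longrightarrow> s \<le> t \<longrightarrow>
      t < \<tau> \<longrightarrow> y s \<le> a \<longrightarrow> y t < b)" if \<eta>: "0 < \<eta>" for \<eta>
  proof -
    obtain t0 where t0: "0 \<le> t0" "t0 < \<tau>" and o: "\<And>p q. p \<in> {t0..<\<tau>} \<Longrightarrow> q \<in> {t0..<\<tau>} \<Longrightarrow> \<bar>w q - w p\<bar> < \<eta>"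
      using osc[OF \<eta>] by blast
    have "y t < b" if A: "\<eta> \<le> b - a" "\<forall>x\<in>{a..b}. g x \<le> 0" "t0 \<le> s" "s \<le> t" "t < \<tau>" "y s \<le> a" for a b s t
    proof (rule no_upcrossing[where y = y and t = t and f = f and w = w and s = s and a = a])
      show "continuous_on {s..t} y" by (rule continuous_on_subset[OF y[of t]]) (use A t0 in auto)
      show "(f has_integral y q - y p - (w q - w p)) {p..q}" if "s \<le> p" "p \<le> q" "q \<le> t" for p q
        using that A t0 by (intro eq) auto
      show "f q \<le> 0" if "q \<in> {s..t}" "y q \<in> {a..b}" for q
        using that A t0 by (intro f_neg) auto
      show "\<bar>w q - w p\<bar> < b - a" if "p \<in> {s..t}" "q \<in> {s..t}" for p q
        using o[of p q] that A by auto
    qed (use A \<eta> in auto)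
    with t0 show ?thesis by blast
  qed
  have down: "\<exists>t0. 0 \<le> t0 \<and> t0 < \<tau> \<and> (\<forall>a b s t. \<eta> \<le> b - a \<longrightarrow> (\<forall>x\<in>{a..b}. 0 \<le> g x) \<longrightarrow> t0 \<le> s \<longrightarrow> s \<le> t \<longrightarrow>
      t < \<tau> \<longrightarrow> b \<le> y s \<longrightarrow> a < y t)" if \<eta>: "0 < \<eta>" for \<eta>
  proof -
    obtain t0 where t0: "0 \<le> t0" "t0 < \<tau>" and o: "\<And>p q. p \<in> {t0..<\<tau>} \<Longrightarrow> q \<in> {t0..<\<tau>} \<Longrightarrow> \<bar>w q - w p\<bar> < \<eta>"
      using osc[OF \<eta>] by blast
    have "a < y t" if A: "\<eta> \<le> b - a" "\<forall>x\<in>{a..b}. 0 \<le> g x" "t0 \<le> s" "s \<le> t" "t < \<tau>" "b \<le> y s" for a b s t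
    proof (rule no_downcrossing[where y = y and t = t and f = f and w = w and s = s and b = b])
      show "continuous_on {s..t} y" by (rule continuous_on_subset[OF y[of t]]) (use A t0 in auto)
      show "(f has_integral y q - y p - (w q - w p)) {p..q}" if "s \<le> p" "p \<le> q" "q \<le> t" for p q
        using that A t0 by (intro eq) auto
      show "0 \<le> f q" if "q \<in> {s..t}" "y q \<in> {a..b}" for q
        using that A t0 by (intro f_pos) auto
      show "\<bar>w q - w p\<bar> < b - a" if "p \<in> {s..t}" "q \<in> {s..t}" for p q
        using o[of p q] that A by auto
    qed (use A \<eta> in auto)
    with t0 show ?thesis by blast
  qed
  define L where "L = Liminf (at_left \<tau>) (\<lambda>t. ereal (y t))"
  define U where "U = Limsup (at_left \<tau>) (\<lambda>t. ereal (y t))"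
  have below: "\<exists>t>t0. t < \<tau> \<and> y t < c" if "L < ereal c" "t0 < \<tau>" for c t0
  proof (rule ccontr)
    assume "\<not> ?thesis"
    then have "\<forall>\<^sub>F t in at_left \<tau>. ereal c \<le> ereal (y t)"
      using \<open>t0 < \<tau>\<close> unfolding eventually_at_left[OF \<open>t0 < \<tau>\<close>] by force
    then have "ereal c \<le> L" unfolding L_def by (rule Liminf_bounded)
    then show False using that by simp
  qed
  have above: "\<exists>t>t0. t < \<tau> \<and> c < y t" if "ereal c < U" "t0 < \<tau>" for c t0
  proof (rule ccontr)
    assume "\<not> ?thesis"
    then have "\<forall>\<^sub>F t in at_left \<tau>. ereal (y t) \<le> ereal c"
      using \<open>t0 < \<tau>\<close> unfolding eventually_at_left[OF \<open>t0 < \<tau>\<close>] by force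
    then have "U \<le> ereal c" unfolding U_def by (rule Limsup_bounded)
    then show False using that by simp
  qed
  \<comment> \<open>Otherwise some interval strictly between \<open>L\<close> and \<open>U\<close>
    carries a drift of constant sign, and the path crosses it in both directions at times
    arbitrarily close to \<open>\<tau>\<close>. One of the two directions is excluded.\<close>
  have "\<not> L < U"
  proof
    assume "L < U"
    then obtain a where a: "L < ereal a" "ereal a < U" using ereal_dense2 by blast
    then obtain b where b: "ereal a < ereal b" "ereal b < U" using ereal_dense2 by blast
    obtain c d where cd: "a \<le> c" "c < d" "d \<le> b" "(\<forall>x\<in>{c..d}. 0 \<le> g x) \<or> (\<forall>x\<in>{c..d}. g x \<le> 0)"
      using pieces[of a b] b by auto
    have Lc: "L < ereal c" using a(1) cd(1) by (meson ereal_less_eq(3) less_le_trans)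
    have Ud: "ereal d < U" using b(2) cd(3) by (meson ereal_less_eq(3) le_less_trans)
    from cd(4) show False
    proof
      assume pos: "\<forall>x\<in>{c..d}. 0 \<le> g x"
      obtain t0 where t0: "0 \<le> t0" "t0 < \<tau>" and D: "\<forall>a b s t. d - c \<le> b - a \<longrightarrow> (\<forall>x\<in>{a..b}. 0 \<le> g x) \<longrightarrow> t0 \<le> s \<longrightarrow> s \<le> t \<longrightarrow>
        t < \<tau> \<longrightarrow> b \<le> y s \<longrightarrow> a < y t"
        using down[of "d - c"] cd(2) by auto
      obtain s where s: "t0 < s" "s < \<tau>" "d < y s" using above[OF Ud t0(2)] by blast
      obtain t where t: "s < t" "t < \<tau>" "y t < c" using below[OF Lc s(2)] by blast
      show False using D[rule_format, of d c s t] pos s t by force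
    next
      assume neg: "\<forall>x\<in>{c..d}. g x \<le> 0"
      obtain t0 where t0: "0 \<le> t0" "t0 < \<tau>" and D: "\<forall>a b s t. d - c \<le> b - a \<longrightarrow> (\<forall>x\<in>{a..b}. g x \<le> 0) \<longrightarrow> t0 \<le> s \<longrightarrow> s \<le> t \<longrightarrow>
        t < \<tau> \<longrightarrow> y s \<le> a \<longrightarrow> y t < b"
        using up[of "d - c"] cd(2) by auto
      obtain s where s: "t0 < s" "s < \<tau>" "y s < c" using below[OF Lc t0(2)] by blast
      obtain t where t: "s < t" "t < \<tau>" "d < y t" using above[OF Ud s(2)] by blast
      show False using D[rule_format, of d c s t] neg s t by force
    qed
  qed
  moreover have "L \<le> U" unfolding L_def U_def by (rule Liminf_le_Limsup) simp
  ultimately have "L = U" by simp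
  then have lim: "((\<lambda>t. ereal (y t)) \<longlongrightarrow> L) (at_left \<tau>)"
    using tendsto_iff_Liminf_eq_Limsup[OF nontriv, of "\<lambda>t. ereal (y t)" L] by (simp add: L_def U_def)
  \<comment> \<open>On the way to infinity the path would cross an interval of length
    \<open>len\<close> on which \<open>g\<close> vanishes, and near \<open>\<tau>\<close> the noise
    alone cannot carry it across.\<close>
  have "L \<noteq> \<infinity>"
  proof
    assume "L = \<infinity>"
    obtain t0 where t0: "0 \<le> t0" "t0 < \<tau>" and D: "\<forall>a b s t. len \<le> b - a \<longrightarrow> (\<forall>x\<in>{a..b}. g x \<le> 0) \<longrightarrow> t0 \<le> s \<longrightarrow> s \<le> t \<longrightarrow>
        t < \<tau> \<longrightarrow> y s \<le> a \<longrightarrow> y t < b"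
      using up[OF len_pos] by auto
    obtain a where a: "y t0 \<le> a" "\<forall>x\<in>{a..a + len}. g x = 0" using zero_above by blast
    obtain t where "t0 < t" "t < \<tau>" "a + len < y t"
      using above[of "a + len" t0] t0 \<open>L = \<infinity>\<close> \<open>L = U\<close> by auto
    then show False using D[rule_format, of "a + len" a t0 t] a by force
  qed
  moreover have "L \<noteq> - \<infinity>"
  proof
    assume "L = - \<infinity>"
    obtain t0 where t0: "0 \<le> t0" "t0 < \<tau>" and D: "\<forall>a b s t. len \<le> b - a \<longrightarrow> (\<forall>x\<in>{a..b}. 0 \<le> g x) \<longrightarrow> t0 \<le> s \<longrightarrow> s \<le> t \<longrightarrow>
        t < \<tau> \<longrightarrow> b \<le> y s \<longrightarrow> a < y t"
      using down[OF len_pos] by auto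
    obtain b where b: "b \<le> y t0" "\<forall>x\<in>{b - len..b}. g x = 0" using zero_below by blast
    obtain t where "t0 < t" "t < \<tau>" "y t < b - len"
      using below[of "b - len" t0] t0 \<open>L = - \<infinity>\<close> by auto
    then show False using D[rule_format, of b "b - len" t0 t] b by force
  qed
  ultimately obtain l where "L = ereal l" by (cases L) auto
  with lim show ?thesis by auto
qed

section \<open>Brownian paths spend no time on Lipschitz curves\<close>

text \<open>If the level set had positive measure, then so would, uniformly in small \<open>h\<close>, the set of times
  \<open>s\<close> for which \<open>s\<close> and \<open>s + h\<close> both belong to it; at those times the increment of \<open>w\<close> is at most
  a multiple of \<open>h\<close>.\<close>

lemma no_occupation_of_small_increments:
  fixes w :: "real \<Rightarrow> real" and h :: "nat \<Rightarrow> real"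
  assumes w: "continuous_on {0..} w" and \<sigma>: "0 < \<sigma>"
    and h: "\<And>n. 0 < h n" "h \<longlonglongrightarrow> 0"
    and small: "\<And>c T :: nat.
      (\<lambda>n. measure lborel {s \<in> {0..real T}. \<bar>w (s + h n) - w s\<bar> \<le> real c * h n}) \<longlonglongrightarrow> 0"
  shows "no_occupation (\<lambda>t. \<sigma> * w t)"
  unfolding no_occupation_def
proof (intro allI impI)
  fix T L a :: real and z :: "real \<Rightarrow> real" assume z: "L-lipschitz_on {0..T} z"
  define E where "E = {s \<in> {0..T}. z s + \<sigma> * w s = a}"
  have "continuous_on {0..T} (\<lambda>s. z s + \<sigma> * w s)"
    by (intro continuous_intros lipschitz_on_continuous_on[OF z] continuous_on_subset[OF w]) auto
  then have "closed E"
    unfolding E_def by (rule continuous_closed_preimage_constant) simp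
  moreover have "bounded E"
    by (rule bounded_subset[of "{0..T}"]) (auto simp: E_def)
  ultimately have E: "compact E" by (simp add: compact_eq_bounded_closed)
  have Eb [measurable]: "E \<in> sets borel" using \<open>closed E\<close> by simp
  have Efin: "emeasure lborel E < \<infinity>" using emeasure_bounded_finite[OF \<open>bounded E\<close>] by simp
  have "measure lborel E \<le> 0 + e" if e: "0 < e" for e
  proof -
    obtain U where U: "open U" "E \<subseteq> U" "emeasure lebesgue (U - E) < ennreal e"
      using sets_lebesgue_outer_open[of E e] Eb e by (metis sets_completionI_sets sets_lborel)
    then have Ub [measurable]: "U \<in> sets borel" by simp
    have Ue: "emeasure lborel (U - E) < ennreal e" using U(3) by simp
    obtain \<delta> where \<delta>: "0 < \<delta>" "(\<Union>x\<in>E. ball x \<delta>) \<subseteq> U"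
      using compact_subset_open_imp_ball_epsilon_subset[OF E U(1,2)] by blast
    \<comment> \<open>Natural numbers dominate \<open>L / \<sigma>\<close> and \<open>T\<close>, so
      that the hypothesis on \<open>w\<close> consists of countably many statements, each of which
      can be established almost surely.\<close>
    obtain c :: nat where c: "L / \<sigma> \<le> real c" using real_arch_simple by blast
    obtain K :: nat where K: "T \<le> real K" using real_arch_simple by blast
    define S where "S n = {s \<in> {0..real K}. \<bar>w (s + h n) - w s\<bar> \<le> real c * h n}" for n
    have "measure lborel E \<le> measure lborel (S n) + e" if n: "h n < \<delta>" for n
    proof -
      have "continuous_on {0..real K} (\<lambda>s. w (s + h n) - w s)"
        using h(1)[of n]
        by (intro continuous_intros continuous_on_compose2[OF w] continuous_on_subset[OF w]) auto
      then have "closed ({0..real K} \<inter> (\<lambda>s. w (s + h n) - w s) -` {- (real c * h n)..real c * h n})"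
        by (rule continuous_closed_preimage) auto
      moreover have "S n = {0..real K} \<inter> (\<lambda>s. w (s + h n) - w s) -` {- (real c * h n)..real c * h n}"
        by (auto simp: S_def abs_le_iff)
      ultimately have Sb [measurable]: "S n \<in> sets borel" by simp
      have Sfin: "emeasure lborel (S n) < \<infinity>"
      proof -
        have "S n \<subseteq> {0..real K}" by (auto simp: S_def)
        then have "bounded (S n)" by (rule bounded_subset[rotated]) simp
        then show ?thesis using emeasure_bounded_finite by auto
      qed
      \<comment> \<open>A point of \<open>E\<close> shifted by \<open>h n\<close> remains in the
        neighbourhood \<open>U\<close>. Either it is again in \<open>E\<close>, and the Lipschitz
        bound for \<open>z\<close> forces a small increment of \<open>w\<close>, or it falls into
        \<open>U - E\<close>, whose measure is below \<open>e\<close> and is preserved by the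
        shift.\<close>
      have "E \<subseteq> S n \<union> (\<lambda>s. h n + s) -` (U - E)"
      proof
        fix s assume s: "s \<in> E"
        then have "h n + s \<in> ball s \<delta>" using n h(1)[of n] by (simp add: dist_real_def)
        then have "h n + s \<in> U" using \<delta>(2) s by blast
        moreover have "s \<in> S n" if sh: "h n + s \<in> E"
        proof -
          have "\<sigma> * (w (s + h n) - w s) = z s - z (s + h n)"
            using s sh by (simp add: E_def algebra_simps)
          moreover have "\<bar>z s - z (s + h n)\<bar> \<le> L * h n"
            using lipschitz_onD[OF z, of s "s + h n"] s sh h(1)[of n] by (simp add: E_def dist_real_def add.commute)
          ultimately have "\<sigma> * \<bar>w (s + h n) - w s\<bar> \<le> L * h n"
            using \<sigma> by (metis abs_mult abs_of_pos)
          also have "\<dots> \<le> (real c * \<sigma>) * h n"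
            using c \<sigma> h(1)[of n] by (intro mult_right_mono) (auto simp: field_simps)
          finally have "\<sigma> * \<bar>w (s + h n) - w s\<bar> \<le> \<sigma> * (real c * h n)" by (simp add: ac_simps)
          then have "\<bar>w (s + h n) - w s\<bar> \<le> real c * h n" using \<sigma> by simp
          then show ?thesis using s K by (auto simp: S_def E_def)
        qed
        ultimately show "s \<in> S n \<union> (\<lambda>s. h n + s) -` (U - E)" by blast
      qed
      moreover have [measurable]: "(\<lambda>s. h n + s) -` (U - E) \<in> sets borel"
        by (rule measurable_sets_borel[where M = borel]) measurable
      ultimately have "emeasure lborel E \<le> emeasure lborel (S n \<union> (\<lambda>s. h n + s) -` (U - E))"
        by (intro emeasure_mono) auto
      also have "\<dots> \<le> emeasure lborel (S n) + emeasure lborel ((\<lambda>s. h n + s) -` (U - E))"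
        by (intro emeasure_subadditive) auto
      also have "emeasure lborel ((\<lambda>s. h n + s) -` (U - E)) = emeasure (distr lborel borel ((+) (h n))) (U - E)"
        by (subst emeasure_distr) auto
      also have "\<dots> = emeasure lborel (U - E)" by (simp add: lborel_distr_plus)
      also have "emeasure lborel (S n) + emeasure lborel (U - E) \<le> ennreal (measure lborel (S n)) + ennreal e"
        using Ue Sfin by (intro add_mono) (auto simp: emeasure_eq_ennreal_measure)
      finally have "emeasure lborel E \<le> ennreal (measure lborel (S n) + e)"
        using e by simp
      then show ?thesis
        unfolding measure_def using e by (intro enn2real_leI) auto
    qed
    moreover have "\<forall>\<^sub>F n in sequentially. h n < \<delta>" using h(2) \<delta>(1) by (simp add: order_tendstoD)
    ultimately have ev: "\<forall>\<^sub>F n in sequentially. measure lborel E \<le> measure lborel (S n) + e"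
      by (auto elim: eventually_mono)
    have "(\<lambda>n. measure lborel (S n) + e) \<longlonglongrightarrow> 0 + e"
      using small[of K c] unfolding S_def by (intro tendsto_intros)
    then show ?thesis
      using ev by (rule tendsto_lowerbound) simp
  qed
  then have "measure lborel E \<le> 0" by (rule field_le_epsilon)
  then have "measure lborel E = 0" by (simp add: measure_le_0_iff)
  then have "emeasure lborel E = 0" using Efin by (simp add: emeasure_eq_ennreal_measure)
  then have "E \<in> null_sets lborel" using Eb by (auto intro: null_setsI)
  then show "negligible {s \<in> {0..T}. z s + \<sigma> * w s = a}"
    unfolding negligible_iff_null_sets E_def[symmetric] by (rule null_sets_completionI)
qed

text \<open>A version of \<open>B\<close> that is jointly measurable in time and
  \<open>\<omega>\<close>, as Fubini's theorem demands. The process itself has continuous paths only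
  almost surely, whereas each approximation uses countably many of its values; the two agree on
  continuous paths.\<close>

definition dyadic_limit :: "(real \<Rightarrow> 'a \<Rightarrow> real) \<Rightarrow> real \<Rightarrow> 'a \<Rightarrow> real" where
  "dyadic_limit B s \<omega> = lim (\<lambda>n. B (real (nat \<lfloor>2 ^ n * s\<rfloor>) / 2 ^ n) \<omega>)"

lemma dyadic_limit_measurable:
  assumes [measurable]: "\<And>t. 0 \<le> t \<Longrightarrow> B t \<in> borel_measurable M"
  shows "(\<lambda>(s, \<omega>). dyadic_limit B s \<omega>) \<in> borel_measurable (borel \<Otimes>\<^sub>M M)"
proof -
  have "(\<lambda>x. B (real (nat \<lfloor>(2 :: real) ^ n * fst x\<rfloor>) / 2 ^ n) (snd x)) \<in> borel_measurable (borel \<Otimes>\<^sub>M M)" for n :: nat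
  proof (rule measurable_compose_countable[where f = "\<lambda>k x. B (real k / 2 ^ n) (snd x)"
        and g = "\<lambda>x. nat \<lfloor>(2 :: real) ^ n * fst x\<rfloor>"])
    show "(\<lambda>x. B (real k / 2 ^ n) (snd x)) \<in> borel_measurable (borel \<Otimes>\<^sub>M M)" for k :: nat
      by (rule measurable_compose[OF measurable_snd]) simp
  qed measurable
  then show ?thesis
    unfolding dyadic_limit_def case_prod_beta by (rule borel_measurable_lim_metric)
qed

lemma dyadic_limit_eq:
  assumes "continuous_on {0..} (\<lambda>t. B t \<omega>)" "0 \<le> s"
  shows "dyadic_limit B s \<omega> = B s \<omega>"
proof -
  define q where "q n = real (nat \<lfloor>2 ^ n * s\<rfloor>) / 2 ^ n" for n :: nat
  have q: "s - (1 / 2) ^ n \<le> q n" "q n \<le> s" for n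
  proof -
    have "real (nat \<lfloor>2 ^ n * s\<rfloor>) = of_int \<lfloor>2 ^ n * s\<rfloor>" using assms(2) by simp
    moreover have "of_int \<lfloor>2 ^ n * s\<rfloor> \<le> 2 ^ n * s" "2 ^ n * s - 1 \<le> of_int \<lfloor>2 ^ n * s\<rfloor>" by linarith+
    ultimately have le: "real (nat \<lfloor>2 ^ n * s\<rfloor>) \<le> 2 ^ n * s" "2 ^ n * s - 1 \<le> real (nat \<lfloor>2 ^ n * s\<rfloor>)"
      by linarith+
    have "(2 ^ n * s - 1) / 2 ^ n \<le> q n" "q n \<le> (2 ^ n * s) / 2 ^ n"
      unfolding q_def by (intro divide_right_mono le; simp)+
    then show "s - (1 / 2) ^ n \<le> q n" "q n \<le> s" by (simp_all add: diff_divide_distrib power_one_over)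
  qed
  have "(\<lambda>n. s - (1 / 2) ^ n) \<longlonglongrightarrow> s - 0"
    by (intro tendsto_intros LIMSEQ_power_zero) simp
  then have q_lim: "q \<longlonglongrightarrow> s"
    using q by (intro tendsto_sandwich[of "\<lambda>n. s - (1 / 2) ^ n" q sequentially "\<lambda>_. s" s]) auto
  have "0 \<le> q n" for n by (simp add: q_def)
  then have "(\<lambda>n. B (q n) \<omega>) \<longlonglongrightarrow> B s \<omega>"
    using assms(2) by (intro continuous_on_tendsto_compose[OF assms(1) q_lim]) auto
  then show ?thesis unfolding dyadic_limit_def q_def by (rule limI)
qed

section \<open>Small Gaussian increments\<close>

lemma normal_density_le: "0 < s \<Longrightarrow> normal_density 0 s x \<le> 1 / (2 * s)"
proof -
  assume s: "0 < s"
  have "2 \<le> sqrt (2 * pi)" using pi_gt3 by (intro real_le_rsqrt) simp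
  then have "2 * s \<le> sqrt (2 * pi * s\<^sup>2)" using s by (simp add: real_sqrt_mult mult_right_mono)
  then have "1 / sqrt (2 * pi * s\<^sup>2) \<le> 1 / (2 * s)" using s by (intro divide_left_mono) auto
  moreover have "exp (- (x - 0)\<^sup>2 / (2 * s\<^sup>2)) \<le> 1" using s by simp
  ultimately have "1 / sqrt (2 * pi * s\<^sup>2) * exp (- (x - 0)\<^sup>2 / (2 * s\<^sup>2)) \<le> 1 / (2 * s) * 1"
    using s by (intro mult_mono) auto
  then show ?thesis by (simp add: normal_density_def)
qed

lemma normal_small_probability:
  assumes X: "distributed M lborel X (normal_density 0 s)" and s: "0 < s" and c: "0 \<le> c"
  shows "emeasure M {\<omega> \<in> space M. \<bar>X \<omega>\<bar> \<le> c} \<le> ennreal (c / s)"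
proof -
  have "{\<omega> \<in> space M. \<bar>X \<omega>\<bar> \<le> c} = X -` {- c..c} \<inter> space M" by (auto simp: abs_le_iff)
  then have "emeasure M {\<omega> \<in> space M. \<bar>X \<omega>\<bar> \<le> c} = (\<integral>\<^sup>+x. ennreal (normal_density 0 s x) * indicator {- c..c} x \<partial>lborel)"
    using distributed_emeasure[OF X, of "{- c..c}"] by simp
  also have "\<dots> \<le> (\<integral>\<^sup>+x. ennreal (1 / (2 * s)) * indicator {- c..c} x \<partial>lborel)"
    using normal_density_le[OF s] by (intro nn_integral_mono mult_right_mono ennreal_leI) auto
  also have "\<dots> = ennreal (1 / (2 * s)) * ennreal (2 * c)"
    using c by (simp add: nn_integral_cmult_indicator)
  also have "\<dots> = ennreal (c / s)"
    using s c by (simp flip: ennreal_mult)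
  finally show ?thesis .
qed

text \<open>With \<open>h = (1 / 4) ^ n\<close>, an increment over time \<open>h\<close> has
  standard deviation \<open>(1 / 2) ^ n\<close> and is at most \<open>c * h\<close> in size with
  probability at most \<open>c * (1 / 2) ^ n\<close>. By Fubini the expected measure of such times
  is at most \<open>c * T * (1 / 2) ^ n\<close>. These bounds are summable, so almost surely the
  measures themselves are summable and tend to 0.\<close>

lemma brownian_small_increments:
  fixes c T :: nat
  assumes M: "prob_space M" and [measurable]: "\<And>t. 0 \<le> t \<Longrightarrow> B t \<in> borel_measurable M"
    and cont: "AE \<omega> in M. continuous_on {0..} (\<lambda>t. B t \<omega>)"
    and normal: "\<And>s t. 0 \<le> s \<Longrightarrow> s < t \<Longrightarrow>
      distributed M lborel (\<lambda>\<omega>. B t \<omega> - B s \<omega>) (normal_density 0 (sqrt (t - s)))"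
  shows "AE \<omega> in M. (\<lambda>n. measure lborel {s \<in> {0..real T}. \<bar>B (s + (1 / 4) ^ n) \<omega> - B s \<omega>\<bar>
    \<le> real c * (1 / 4) ^ n}) \<longlonglongrightarrow> 0"
proof -
  interpret prob_space M by fact
  interpret pair_sigma_finite lborel M ..
  define h :: "nat \<Rightarrow> real" where "h n = (1 / 4) ^ n" for n
  have h: "0 < h n" "sqrt (h n) = (1 / 2) ^ n" "h n = (1 / 2) ^ n * (1 / 2) ^ n" for n
  proof -
    show "0 < h n" by (simp add: h_def)
    show *: "h n = (1 / 2) ^ n * (1 / 2) ^ n" by (simp add: h_def flip: power_mult_distrib)
    show "sqrt (h n) = (1 / 2) ^ n" unfolding * by simp
  qed
  define W where "W = dyadic_limit B"
  have W [measurable]: "(\<lambda>(s, \<omega>). W s \<omega>) \<in> borel_measurable (borel \<Otimes>\<^sub>M M)"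
    unfolding W_def by (rule dyadic_limit_measurable) simp
  define A where "A n = {x \<in> space (lborel \<Otimes>\<^sub>M M). 0 \<le> fst x \<and> fst x \<le> real T \<and>
      \<bar>W (fst x + h n) (snd x) - W (fst x) (snd x)\<bar> \<le> real c * h n}" for n
  have A [measurable]: "A n \<in> sets (lborel \<Otimes>\<^sub>M M)" for n
  proof -
    have 1: "(\<lambda>x. W (fst x + h n) (snd x)) \<in> borel_measurable (lborel \<Otimes>\<^sub>M M)"
      using measurable_compose[OF _ W, of "\<lambda>x. (fst x + h n, snd x)" "lborel \<Otimes>\<^sub>M M"] by simp
    have 2: "(\<lambda>x. W (fst x) (snd x)) \<in> borel_measurable (lborel \<Otimes>\<^sub>M M)"
      using measurable_compose[OF _ W, of "\<lambda>x. (fst x, snd x)" "lborel \<Otimes>\<^sub>M M"] by simp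
    show ?thesis unfolding A_def using 1 2 by measurable
  qed
  define \<phi> where "\<phi> n \<omega> = emeasure lborel ((\<lambda>s. (s, \<omega>)) -` A n)" for n \<omega>
  have \<phi>_meas [measurable]: "\<phi> n \<in> borel_measurable M" for n
    unfolding \<phi>_def by (rule measurable_emeasure_Pair2[OF A])
  have sect: "emeasure M (Pair s -` A n) \<le> ennreal (real c * (1 / 2) ^ n) * indicator {0..real T} s" for n s
  proof (cases "s \<in> {0..real T}")
    case True
    \<comment> \<open>At a fixed time the version \<open>W\<close> may be exchanged for
      \<open>B\<close> outside a null set, and the increment of \<open>B\<close> is
      Gaussian.\<close>
    have "emeasure M (Pair s -` A n) = emeasure M {\<omega> \<in> space M. \<bar>B (s + h n) \<omega> - B s \<omega>\<bar> \<le> real c * h n}"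
    proof (rule emeasure_eq_AE)
      show "AE \<omega> in M. (\<omega> \<in> Pair s -` A n) = (\<omega> \<in> {\<omega> \<in> space M. \<bar>B (s + h n) \<omega> - B s \<omega>\<bar> \<le> real c * h n})"
        using cont
      proof eventually_elim
        case (elim \<omega>)
        have "W s \<omega> = B s \<omega>" "W (s + h n) \<omega> = B (s + h n) \<omega>"
          unfolding W_def using True h(1)[of n] by (auto intro!: dyadic_limit_eq elim)
        then show ?case using True by (auto simp: A_def space_pair_measure)
      qed
      show "Pair s -` A n \<in> sets M" using A by (rule sets_Pair1)
      show "{\<omega> \<in> space M. \<bar>B (s + h n) \<omega> - B s \<omega>\<bar> \<le> real c * h n} \<in> sets M"
      proof -
        have [measurable]: "B s \<in> borel_measurable M" "B (s + h n) \<in> borel_measurable M"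
          using True h(1)[of n] by auto
        show ?thesis by measurable
      qed
    qed
    also have "\<dots> \<le> ennreal (real c * h n / sqrt (h n))"
      using True h(1)[of n] normal[of s "s + h n"] by (intro normal_small_probability) auto
    also have "real c * h n / sqrt (h n) = real c * (1 / 2) ^ n"
      unfolding h(2) by (subst h(3)) simp
    finally show ?thesis using True by simp
  next
    case False
    then have "Pair s -` A n = {}" by (auto simp: A_def)
    then show ?thesis by simp
  qed
  have int: "(\<integral>\<^sup>+\<omega>. \<phi> n \<omega> \<partial>M) \<le> ennreal (real c * real T * (1 / 2) ^ n)" for n
  proof -
    have "(\<integral>\<^sup>+\<omega>. \<phi> n \<omega> \<partial>M) = emeasure (lborel \<Otimes>\<^sub>M M) (A n)"
      unfolding \<phi>_def by (rule emeasure_pair_measure_alt2[OF A, symmetric])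
    also have "\<dots> = (\<integral>\<^sup>+s. emeasure M (Pair s -` A n) \<partial>lborel)"
      by (rule sigma_finite_measure.emeasure_pair_measure_alt[OF prob_space_imp_sigma_finite[OF M] A])
    also have "\<dots> \<le> (\<integral>\<^sup>+s. ennreal (real c * (1 / 2) ^ n) * indicator {0..real T} s \<partial>lborel)"
      by (intro nn_integral_mono sect)
    also have "\<dots> = ennreal (real c * (1 / 2) ^ n) * ennreal (real T)"
      by (simp add: nn_integral_cmult_indicator)
    also have "\<dots> = ennreal (real c * real T * (1 / 2) ^ n)"
      by (simp add: ac_simps flip: ennreal_mult)
    finally show ?thesis .
  qed
  have "(\<integral>\<^sup>+\<omega>. (\<Sum>n. \<phi> n \<omega>) \<partial>M) = (\<Sum>n. \<integral>\<^sup>+\<omega>. \<phi> n \<omega> \<partial>M)"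
    by (intro nn_integral_suminf) simp
  also have "\<dots> \<le> (\<Sum>n. ennreal (real c * real T * (1 / 2) ^ n))"
    by (intro suminf_le int) auto
  also have "\<dots> < \<infinity>"
  proof -
    have "summable (\<lambda>n. real c * real T * (1 / 2) ^ n)" by (intro summable_mult summable_geometric) simp
    then show ?thesis by (subst suminf_ennreal2) auto
  qed
  finally have "(\<integral>\<^sup>+\<omega>. (\<Sum>n. \<phi> n \<omega>) \<partial>M) \<noteq> \<infinity>" by simp
  then have "AE \<omega> in M. (\<Sum>n. \<phi> n \<omega>) \<noteq> \<infinity>"
    by (intro nn_integral_noteq_infinite) measurable
  then show ?thesis
    using cont AE_space
  proof eventually_elim
    case (elim \<omega>)
    define m where "m n = measure lborel {s \<in> {0..real T}. \<bar>B (s + (1 / 4) ^ n) \<omega> - B s \<omega>\<bar> \<le> real c * (1 / 4) ^ n}" for n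
    have "(\<lambda>s. (s, \<omega>)) -` A n = {s \<in> {0..real T}. \<bar>B (s + (1 / 4) ^ n) \<omega> - B s \<omega>\<bar> \<le> real c * (1 / 4) ^ n}" for n
    proof -
      have "W s \<omega> = B s \<omega>" "W (s + h n) \<omega> = B (s + h n) \<omega>" if "0 \<le> s" for s
        unfolding W_def using that h(1)[of n] by (auto intro!: dyadic_limit_eq elim)
      then show ?thesis using elim(3) by (auto simp: A_def space_pair_measure h_def)
    qed
    then have "\<phi> n \<omega> = ennreal (m n)" for n
      unfolding \<phi>_def m_def
      by (simp, intro emeasure_eq_ennreal_measure)
        (metis (no_types, lifting) bounded_closed_interval bounded_subset emeasure_bounded_finite infinity_ennreal_def
          less_irrefl mem_Collect_eq subsetI)
    then have "(\<Sum>n. ennreal (m n)) \<noteq> top" using elim(1) by simp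
    then have "summable m" by (intro summable_suminf_not_top) (auto simp: m_def)
    then have "m \<longlonglongrightarrow> 0" by (rule summable_LIMSEQ_zero)
    then show ?case unfolding m_def .
  qed
qed

lemma brownian_no_occupation:
  assumes fps: "filtered_prob_space M F" and bm: "brownian_motion M F B" and \<sigma>: "0 < \<sigma>"
  shows "AE \<omega> in M. no_occupation (\<lambda>t. \<sigma> * B t \<omega>)"
proof -
  have M: "prob_space M" using fps by (simp add: filtered_prob_space_def)
  have B: "B t \<in> borel_measurable M" if "0 \<le> t" for t
    using fps bm that unfolding filtered_prob_space_def brownian_motion_def
    by (meson measurable_from_subalg)
  have cont: "AE \<omega> in M. continuous_on {0..} (\<lambda>t. B t \<omega>)"
    using bm by (simp add: brownian_motion_def)
  have "AE \<omega> in M. \<forall>c T :: nat. (\<lambda>n. measure lborel {s \<in> {0..real T}. \<bar>B (s + (1 / 4) ^ n) \<omega> - B s \<omega>\<bar>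
    \<le> real c * (1 / 4) ^ n}) \<longlonglongrightarrow> 0"
    using bm unfolding AE_all_countable brownian_motion_def
    by (intro allI brownian_small_increments[OF M B cont]) auto
  with cont show ?thesis
  proof eventually_elim
    case (elim \<omega>)
    show ?case
    proof (rule no_occupation_of_small_increments[OF elim(1) \<sigma>])
      show "(\<lambda>n. (1 / 4 :: real) ^ n) \<longlonglongrightarrow> 0" by (rule LIMSEQ_power_zero) simp
    qed (use elim(2) in auto)
  qed
qed

section \<open>The sailboat coefficients\<close>

text \<open>The coefficients have period \<open>\<pi>\<close>. On \<open>[0,\<pi>)\<close> they are \<open>- v\<close> and \<open>v / r\<close> times the following
  profiles.\<close>

definition speed_profile :: "real \<Rightarrow> real" where
  "speed_profile u = (if u < pi / 4 then cos u else if u < pi / 2 then sin u else 1)"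

definition drift_profile :: "real \<Rightarrow> real" where
  "drift_profile u = (if u < pi / 4 then sin u else if u < pi / 2 then - cos u else 0)"

text \<open>The parity of \<open>n\<close> decides whether the reduced angle is \<open>u\<close> or
  \<open>pi + u\<close>. In the second case the sign changes of sine and cosine cancel those in the
  definition of the coefficients.\<close>

lemma sail_mu_profile:
  assumes u: "0 \<le> u" "u < pi"
  shows "sail_mu1 v r (of_int n * pi + u) = - v * speed_profile u"
    and "sail_mu2 v r (of_int n * pi + u) = v * drift_profile u / r"
proof -
  have "sail_mu1 v r (of_int n * pi + u) = - v * speed_profile u \<and>
    sail_mu2 v r (of_int n * pi + u) = v * drift_profile u / r"
  proof (cases "even n")
    case True
    then obtain k where k: "n = 2 * k" by (rule evenE)
    have "(of_int n * pi + u) rmod (2 * pi) = u"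
      using u by (intro rmod_unique[where n = k]) (auto simp: k)
    then show ?thesis
      using u by (simp add: sail_mu1_def sail_mu2_def speed_profile_def drift_profile_def Let_def)
  next
    case False
    then obtain k where k: "n = 2 * k + 1" by (rule oddE)
    have \<phi>: "(of_int n * pi + u) rmod (2 * pi) = pi + u"
      using u by (intro rmod_unique[where n = k]) (auto simp: k algebra_simps)
    have "pi + u < 5 * pi / 4 \<longleftrightarrow> u < pi / 4" "pi + u < 3 * pi / 2 \<longleftrightarrow> u < pi / 2" by auto
    moreover have "\<not> pi + u < pi / 4" "\<not> pi + u < pi / 2" "\<not> pi + u < pi" using u pi_gt_zero by auto
    ultimately show ?thesis
      by (simp add: sail_mu1_def sail_mu2_def speed_profile_def drift_profile_def Let_def \<phi> cos_add sin_add)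
  qed
  then show "sail_mu1 v r (of_int n * pi + u) = - v * speed_profile u"
    and "sail_mu2 v r (of_int n * pi + u) = v * drift_profile u / r" by auto
qed

lemma half_period_representation:
  obtains n :: int and u :: real where "x = of_int n * pi + u" "0 \<le> u" "u < pi"
proof -
  have "of_int \<lfloor>x / pi\<rfloor> * pi \<le> x" "x < (of_int \<lfloor>x / pi\<rfloor> + 1) * pi"
    by (rule floor_divide_lower floor_divide_upper; simp)+
  then show ?thesis
    by (intro that[of "\<lfloor>x / pi\<rfloor>" "x - of_int \<lfloor>x / pi\<rfloor> * pi"]) (auto simp: algebra_simps)
qed

text \<open>For points in different periods, the increment of \<open>f\<close> splits into one of
  \<open>\<kappa>\<close> from \<open>t\<close> to \<open>pi\<close> and one from 0 to
  \<open>u\<close>; the two match because of \<open>\<kappa> 0 = \<kappa> pi\<close>, and full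
  periods in between contribute nothing.\<close>

lemma one_sided_lipschitz_of_profile:
  fixes f \<kappa> :: "real \<Rightarrow> real"
  assumes f: "\<And>n u. 0 \<le> u \<Longrightarrow> u < pi \<Longrightarrow> f (of_int n * pi + u) = \<kappa> u"
    and \<kappa>: "\<And>a b. 0 \<le> a \<Longrightarrow> a \<le> b \<Longrightarrow> b \<le> pi \<Longrightarrow> \<kappa> b - \<kappa> a \<le> b - a"
    and periodic: "\<kappa> 0 = \<kappa> pi" and xy: "y \<le> x"
  shows "f x - f y \<le> x - y"
proof -
  obtain n u where x: "x = of_int n * pi + u" "0 \<le> u" "u < pi" by (rule half_period_representation)
  obtain k t where y: "y = of_int k * pi + t" "0 \<le> t" "t < pi" by (rule half_period_representation)
  have fx: "f x = \<kappa> u" and fy: "f y = \<kappa> t" using f x y by auto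
  consider "n = k" | "k + 1 \<le> n" | "n + 1 \<le> k" by linarith
  then show ?thesis
  proof cases
    case 1
    then show ?thesis using \<kappa>[of t u] fx fy x y xy by simp
  next
    case 2
    then have "(of_int k + 1) * pi \<le> of_int n * pi"
      using pi_gt_zero by (intro mult_right_mono) linarith+
    then show ?thesis using \<kappa>[of 0 u] \<kappa>[of t pi] fx fy x y periodic by (simp add: algebra_simps)
  next
    case 3
    then have "(of_int n + 1) * pi \<le> of_int k * pi"
      using pi_gt_zero by (intro mult_right_mono) linarith+
    then have "x < y" using x y by (simp add: algebra_simps)
    then show ?thesis using xy by simp
  qed
qed

lemma abs_cos_diff_le: "\<bar>cos a - cos b\<bar> \<le> \<bar>a - b\<bar>" for a b :: real
proof -
  have "\<bar>cos a - cos b\<bar> = 2 * (\<bar>sin ((a + b) / 2)\<bar> * \<bar>sin ((b - a) / 2)\<bar>)"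
    by (simp add: cos_diff_cos abs_mult)
  also have "\<dots> \<le> 2 * (1 * \<bar>(b - a) / 2\<bar>)"
    by (intro mult_left_mono mult_mono abs_sin_x_le_abs_x) auto
  finally show ?thesis by simp
qed

lemma abs_sin_diff_le: "\<bar>sin a - sin b\<bar> \<le> \<bar>a - b\<bar>" for a b :: real
  using abs_cos_diff_le[of "pi / 2 - a" "pi / 2 - b"] by (simp add: cos_diff abs_minus_commute)

text \<open>The jump at \<open>pi / 4\<close> leads from the positive sine down to the negative
  \<open>- cos\<close>, which can only help an upper bound. Otherwise the pieces are 1-Lipschitz,
  and \<open>- cos\<close> joins the constant 0 continuously at \<open>pi / 2\<close>.\<close>

lemma drift_profile_one_sided:
  assumes "0 \<le> a" "a \<le> b"
  shows "drift_profile b - drift_profile a \<le> b - a"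
proof -
  have "0 \<le> sin a" if "a < pi / 4" using that assms by (intro sin_ge_zero) auto
  moreover have "0 \<le> cos b" if "b < pi / 2" using that assms by (intro cos_ge_zero) auto
  moreover have "cos a \<le> \<bar>a - pi / 2\<bar>" using abs_cos_diff_le[of a "pi / 2"] by simp
  ultimately show ?thesis
    using assms abs_sin_diff_le[of a b] abs_cos_diff_le[of a b] by (auto simp: drift_profile_def)
qed

lemma speed_profile_lipschitz:
  assumes "0 \<le> a" "a \<le> b"
  shows "\<bar>speed_profile b - speed_profile a\<bar> \<le> b - a"
proof -
  consider "b < pi / 4" | "a < pi / 4" "pi / 4 \<le> b" "b < pi / 2" | "a < pi / 4" "pi / 2 \<le> b"
    | "pi / 4 \<le> a" "b < pi / 2" | "pi / 4 \<le> a" "a < pi / 2" "pi / 2 \<le> b" | "pi / 2 \<le> a"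
    using assms by linarith
  then show ?thesis
  proof cases
    case 1
    then have "speed_profile a = cos a" "speed_profile b = cos b"
      using assms by (auto simp: speed_profile_def)
    then show ?thesis using abs_cos_diff_le[of a b] assms by (simp add: abs_minus_commute)
  next
    case 2
    then have "speed_profile a = cos a" "speed_profile b = sin b"
      by (auto simp: speed_profile_def)
    then show ?thesis using 2 abs_cos_diff_le[of a "pi / 4"] abs_sin_diff_le[of b "pi / 4"] cos_45 sin_45 by linarith
  next
    case 3
    then have "\<not> b < pi / 4" using pi_gt_zero by linarith
    with 3 have "speed_profile a = cos a" "speed_profile b = 1"
      by (auto simp: speed_profile_def)
    \<comment> \<open>Comparison with \<open>cos 0 = 1\<close> bounds the difference by
      \<open>a\<close>, and \<open>a < pi / 4 < b - a\<close>.\<close>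
    then show ?thesis using assms 3 abs_cos_diff_le[of a 0] unfolding cos_zero by linarith
  next
    case 4
    then have "speed_profile a = sin a" "speed_profile b = sin b"
      using assms by (auto simp: speed_profile_def)
    then show ?thesis using abs_sin_diff_le[of a b] assms by (simp add: abs_minus_commute)
  next
    case 5
    then have "\<not> b < pi / 4" using pi_gt_zero by linarith
    with 5 have "speed_profile a = sin a" "speed_profile b = 1"
      by (auto simp: speed_profile_def)
    then show ?thesis using 5 abs_sin_diff_le[of a "pi / 2"] unfolding sin_pi_half by linarith
  next
    case 6
    then have "\<not> a < pi / 4" "\<not> b < pi / 4" using pi_gt_zero assms by linarith+
    with 6 have "speed_profile a = 1" "speed_profile b = 1"
      using assms by (auto simp: speed_profile_def)
    then show ?thesis using assms by simp
  qed
qed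

lemma speed_profile_bounds:
  assumes "0 \<le> u"
  shows "1 / 2 \<le> speed_profile u" "speed_profile u \<le> 1"
proof -
  have half: "1 / 2 \<le> cos (pi / 4)" "1 / 2 \<le> sin (pi / 4)"
    using real_le_rsqrt[of 1 2] by (simp_all add: cos_45 sin_45)
  have "cos (pi / 4) \<le> cos u" if "u < pi / 4"
    using that assms by (intro cos_monotone_0_pi_le) auto
  moreover have "sin (pi / 4) \<le> sin u" if "\<not> u < pi / 4" "u < pi / 2"
    using that assms by (intro sin_monotone_2pi_le) auto
  ultimately show "1 / 2 \<le> speed_profile u" using half by (auto simp: speed_profile_def)
  show "speed_profile u \<le> 1" by (simp add: speed_profile_def)
qed

lemma sail_mu1_radius: "sail_mu1 v r x = sail_mu1 v 1 x"
  by (simp add: sail_mu1_def)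

lemma sail_mu2_radius: "sail_mu2 v r x = sail_mu2 v 1 x / r"
  by (simp add: sail_mu2_def Let_def)

lemma sail_drift_sail_mu:
  assumes v: "0 < v"
  shows "sail_drift (sail_mu1 v 1) (sail_mu2 v 1) v"
proof
  \<comment> \<open>The two-sided bound for the speed is obtained from one-sided bounds for it and
    for its negative, so that the same lemma on periodic profiles serves both coefficients.\<close>
  have 1: "- (sail_mu1 v 1 x / v) - - (sail_mu1 v 1 y / v) \<le> x - y" if "y \<le> x" for x y
  proof (rule one_sided_lipschitz_of_profile[where \<kappa> = speed_profile, OF _ _ _ that])
    show "- (sail_mu1 v 1 (of_int n * pi + u) / v) = speed_profile u" if "0 \<le> u" "u < pi" for n u
      using sail_mu_profile(1)[OF that] v by simp
    show "speed_profile b - speed_profile a \<le> b - a" if "0 \<le> a" "a \<le> b" for a b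
      using speed_profile_lipschitz[OF that] by (simp add: abs_le_iff)
  qed (simp add: speed_profile_def)
  have 2: "sail_mu1 v 1 x / v - sail_mu1 v 1 y / v \<le> x - y" if "y \<le> x" for x y
  proof (rule one_sided_lipschitz_of_profile[where \<kappa> = "\<lambda>u. - speed_profile u", OF _ _ _ that])
    show "sail_mu1 v 1 (of_int n * pi + u) / v = - speed_profile u" if "0 \<le> u" "u < pi" for n u
      using sail_mu_profile(1)[OF that] v by simp
    show "- speed_profile b - - speed_profile a \<le> b - a" if "0 \<le> a" "a \<le> b" for a b
      using speed_profile_lipschitz[OF that] by (simp add: abs_le_iff)
  qed (simp add: speed_profile_def)
  have 3: "sail_mu2 v 1 x / v - sail_mu2 v 1 y / v \<le> x - y" if "y \<le> x" for x y
  proof (rule one_sided_lipschitz_of_profile[where \<kappa> = drift_profile, OF _ _ _ that])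
    show "sail_mu2 v 1 (of_int n * pi + u) / v = drift_profile u" if "0 \<le> u" "u < pi" for n u
      using sail_mu_profile(2)[OF that] v by simp
    show "drift_profile b - drift_profile a \<le> b - a" if "0 \<le> a" "a \<le> b" for a b
      by (rule drift_profile_one_sided[OF that])
  qed (simp add: drift_profile_def)
  have scale: "a - b \<le> v * c" if "a / v - b / v \<le> c" for a b c
    using that v by (simp add: pos_divide_le_eq mult.commute flip: diff_divide_distrib)
  show "0 < v" by fact
  have mu1_lip: "\<bar>sail_mu1 v 1 x - sail_mu1 v 1 y\<bar> \<le> v * (x - y)" if "y \<le> x" for x y
    using scale[OF 2[OF that]] scale[of "- sail_mu1 v 1 x" "- sail_mu1 v 1 y" "x - y"] 1[OF that]
    by (simp add: abs_le_iff)
  show "\<bar>sail_mu1 v 1 x - sail_mu1 v 1 y\<bar> \<le> v * \<bar>x - y\<bar>" for x y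
    using mu1_lip[of x y] mu1_lip[of y x] by (cases "y \<le> x") (simp_all add: abs_minus_commute)
  show "sail_mu2 v 1 x - sail_mu2 v 1 y \<le> v * (x - y)" if "y \<le> x" for x y
    by (rule scale[OF 3[OF that]])
  fix x
  obtain n u where x: "x = of_int n * pi + u" "0 \<le> u" "u < pi" by (rule half_period_representation)
  have "v * (1 / 2) \<le> v * speed_profile u" "v * speed_profile u \<le> v * 1"
    using speed_profile_bounds[OF x(2)] v by (auto simp del: mult_1_right intro: mult_left_mono)
  then show "- v \<le> sail_mu1 v 1 x" "sail_mu1 v 1 x \<le> - v / 2"
    using sail_mu_profile(1)[OF x(2,3)] x(1) by simp_all
  have "\<bar>drift_profile u\<bar> \<le> 1" by (simp add: drift_profile_def)
  then have "v * \<bar>drift_profile u\<bar> \<le> v * 1" using v by (intro mult_left_mono) auto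
  then show "\<bar>sail_mu2 v 1 x\<bar> \<le> v"
    using sail_mu_profile(2)[OF x(2,3), of v 1 n] x(1) v by (simp add: abs_mult)
qed

section \<open>Sign and zeros of the angular drift\<close>

lemma sail_mu2_sign_pieces:
  assumes v: "0 < v" and ab: "a < b"
  shows "\<exists>c d. a \<le> c \<and> c < d \<and> d \<le> b \<and>
    ((\<forall>x\<in>{c..d}. 0 \<le> sail_mu2 v 1 x) \<or> (\<forall>x\<in>{c..d}. sail_mu2 v 1 x \<le> 0))"
proof -
  obtain n u where a: "a = of_int n * pi + u" "0 \<le> u" "u < pi" by (rule half_period_representation)
  have ex: "\<exists>d>a. d \<le> b \<and> (\<forall>x\<in>{a..d}. P (sail_mu2 v 1 x))"
    if "u < e" "e \<le> pi" and P: "\<And>t. u \<le> t \<Longrightarrow> t < e \<Longrightarrow> P (v * drift_profile t)" for e P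
  proof -
    \<comment> \<open>The midpoint keeps the closed interval inside the half-open piece of the
      circle to which \<open>a\<close> belongs.\<close>
    define d where "d = min b (of_int n * pi + (u + e) / 2)"
    have "P (sail_mu2 v 1 x)" if x: "x \<in> {a..d}" for x
    proof -
      have "u \<le> x - of_int n * pi" "x - of_int n * pi < e"
        using x a(1) \<open>u < e\<close> by (auto simp: d_def field_simps)
      then show ?thesis
        using P[of "x - of_int n * pi"] sail_mu_profile(2)[of "x - of_int n * pi" v 1 n] a(2) \<open>e \<le> pi\<close> by simp
    qed
    moreover have "a < d" using ab a(1) \<open>u < e\<close> by (simp add: d_def)
    ultimately show ?thesis by (intro exI[of _ d]) (auto simp: d_def)
  qed
  consider "u < pi / 4" | "pi / 4 \<le> u" "u < pi / 2" | "pi / 2 \<le> u" by linarith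
  then show ?thesis
  proof cases
    case 1
    have "0 \<le> v * drift_profile t" if "u \<le> t" "t < pi / 4" for t
      using that v a(2) by (auto simp: drift_profile_def intro!: mult_nonneg_nonneg sin_ge_zero)
    then show ?thesis using ex[of "pi / 4" "\<lambda>y. 0 \<le> y"] 1 by auto
  next
    case 2
    have "v * drift_profile t \<le> 0" if "u \<le> t" "t < pi / 2" for t
      using that v 2 a(2) by (auto simp: drift_profile_def intro!: mult_nonneg_nonneg cos_ge_zero)
    then show ?thesis using ex[of "pi / 2" "\<lambda>y. y \<le> 0"] 2 by auto
  next
    case 3
    have "0 \<le> v * drift_profile t" if "u \<le> t" "t < pi" for t
      using that 3 by (auto simp: drift_profile_def)
    then show ?thesis using ex[of pi "\<lambda>y. 0 \<le> y"] a(3) by auto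
  qed
qed

lemma sail_mu2_zero_interval:
  assumes "x \<in> {of_int n * pi + pi / 2..of_int n * pi + pi / 2 + pi / 4}"
  shows "sail_mu2 v 1 x = 0"
proof -
  define u where "u = x - of_int n * pi"
  have u: "pi / 2 \<le> u" "u \<le> pi / 2 + pi / 4" using assms by (auto simp: u_def)
  then have "0 \<le> u" "u < pi" "\<not> u < pi / 4" using pi_gt_zero by linarith+
  then show ?thesis using sail_mu_profile(2)[of u v 1 n] u by (simp add: drift_profile_def u_def)
qed

lemma sail_mu2_zero_above: "\<exists>a\<ge>K. \<forall>x\<in>{a..a + pi / 4}. sail_mu2 v 1 x = 0"
proof -
  have "K \<le> of_int \<lceil>K / pi\<rceil> * pi" by (rule ceiling_divide_upper) simp
  then have "K \<le> of_int \<lceil>K / pi\<rceil> * pi + pi / 2" using pi_gt_zero by linarith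
  then show ?thesis using sail_mu2_zero_interval by blast
qed

lemma sail_mu2_zero_below: "\<exists>a\<le>K. \<forall>x\<in>{a - pi / 4..a}. sail_mu2 v 1 x = 0"
proof -
  \<comment> \<open>One period is subtracted so that the whole interval of zeros in period
    \<open>n\<close> lies below \<open>K\<close>.\<close>
  define n where "n = \<lfloor>K / pi\<rfloor> - 1"
  have "of_int \<lfloor>K / pi\<rfloor> * pi \<le> K" by (rule floor_divide_lower) simp
  then have "(of_int n + 1) * pi \<le> K" by (simp add: n_def)
  then have "of_int n * pi + pi / 2 + pi / 4 \<le> K"
    using pi_gt_zero unfolding distrib_right mult_1 by linarith
  moreover have "sail_mu2 v 1 x = 0"
    if "x \<in> {of_int n * pi + pi / 2 + pi / 4 - pi / 4..of_int n * pi + pi / 2 + pi / 4}" for x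
    using that by (intro sail_mu2_zero_interval[of _ n]) simp
  ultimately show ?thesis by blast
qed

section \<open>Strong solutions\<close>

lemma has_integral_increment:
  fixes f :: "real \<Rightarrow> real"
  assumes "(f has_integral a) {0..p}" "(f has_integral b) {0..q}" "0 \<le> p" "p \<le> q"
  shows "(f has_integral b - a) {p..q}"
proof -
  have int: "f integrable_on {0..q}" using assms(2) by (auto simp: integrable_on_def)
  then have "f integrable_on {p..q}" using assms by (auto intro: integrable_on_subinterval)
  then have "(f has_integral integral {p..q} f) {p..q}" by (rule integrable_integral)
  moreover have "integral {p..q} f = b - a"
    using Henstock_Kurzweil_Integration.integral_combine[OF assms(3,4) int] integral_unique[OF assms(1)] integral_unique[OF assms(2)]
    by simp
  ultimately show ?thesis by simp
qed

lemma hitting_time_eq: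
  assumes "0 \<le> \<tau>" "\<And>t. 0 \<le> t \<Longrightarrow> R t \<omega> = 0 \<longleftrightarrow> t = \<tau>"
  shows "hitting_time R \<omega> = ereal \<tau>"
proof -
  have "{t. 0 \<le> t \<and> R t \<omega> = 0} = {\<tau>}" using assms by auto
  then show ?thesis by (simp add: hitting_time_def)
qed

context sail_drift
begin

text \<open>At its first zero \<open>\<tau>\<close> the radial part is driven by a drift that blows up; there the angular part
  is continued by its left limit, taken along a sequence so that it stays measurable.\<close>

definition angular_closed :: "(real \<Rightarrow> real) \<Rightarrow> real \<Rightarrow> real \<Rightarrow> real \<Rightarrow> real" where
  "angular_closed w r \<theta> t = (if 0 < radial w r \<theta> t then angular w r \<theta> t
     else lim (\<lambda>k. angular w r \<theta> (t * (1 - 1 / real (k + 2)))))"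

section \<open>Measurable dependence of the construction on the path\<close>

lemma euler_grid_measurable:
  assumes w: "\<And>s. 0 \<le> s \<Longrightarrow> s \<le> t \<Longrightarrow> w s \<in> borel_measurable G"
    and h: "0 < h" and k: "real k * h \<le> t"
  shows "(\<lambda>\<omega>. fst (euler_grid h (\<lambda>s. w s \<omega>) r \<theta> k)) \<in> borel_measurable G"
    and "(\<lambda>\<omega>. snd (euler_grid h (\<lambda>s. w s \<omega>) r \<theta> k)) \<in> borel_measurable G"
proof -
  have m [measurable]: "m \<in> borel_measurable borel"
    by (rule borel_measurable_continuous_onI[OF m_continuous])
  have "(\<lambda>\<omega>. fst (euler_grid h (\<lambda>s. w s \<omega>) r \<theta> k)) \<in> borel_measurable G \<and>
    (\<lambda>\<omega>. snd (euler_grid h (\<lambda>s. w s \<omega>) r \<theta> k)) \<in> borel_measurable G"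
    using k
  proof (induction k)
    case (Suc k)
    have "real k * h \<le> real (Suc k) * h" using h by simp
    then have le: "real k * h \<le> t" using Suc.prems by (rule order_trans)
    then have [measurable]: "w (real k * h) \<in> borel_measurable G" "w (real (Suc k) * h) \<in> borel_measurable G"
      using Suc.prems h le by (auto intro!: w simp del: of_nat_Suc)
    have [measurable]: "(\<lambda>\<omega>. fst (euler_grid h (\<lambda>s. w s \<omega>) r \<theta> k)) \<in> borel_measurable G"
      "(\<lambda>\<omega>. snd (euler_grid h (\<lambda>s. w s \<omega>) r \<theta> k)) \<in> borel_measurable G"
      using Suc.IH le by auto
    show ?case by (simp add: case_prod_beta Let_def del: of_nat_Suc)
  qed simp
  then show "(\<lambda>\<omega>. fst (euler_grid h (\<lambda>s. w s \<omega>) r \<theta> k)) \<in> borel_measurable G"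
    and "(\<lambda>\<omega>. snd (euler_grid h (\<lambda>s. w s \<omega>) r \<theta> k)) \<in> borel_measurable G" by auto
qed

lemma euler_measurable:
  assumes w: "\<And>s. 0 \<le> s \<Longrightarrow> s \<le> t \<Longrightarrow> w s \<in> borel_measurable G" and h: "0 < h" and t: "0 \<le> t"
  shows "(\<lambda>\<omega>. euler_R h (\<lambda>s. w s \<omega>) r \<theta> t) \<in> borel_measurable G"
    and "(\<lambda>\<omega>. euler_T h (\<lambda>s. w s \<omega>) r \<theta> t) \<in> borel_measurable G"
proof -
  have m [measurable]: "m \<in> borel_measurable borel"
    by (rule borel_measurable_continuous_onI[OF m_continuous])
  note k = grid_index_bounds(1)[OF h t]
  have [measurable]: "w t \<in> borel_measurable G" "w (real (grid_index h t) * h) \<in> borel_measurable G"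
    using w k h t by auto
  have [measurable]: "(\<lambda>\<omega>. frozen_R h (\<lambda>s. w s \<omega>) r \<theta> t) \<in> borel_measurable G"
    "(\<lambda>\<omega>. frozen_T h (\<lambda>s. w s \<omega>) r \<theta> t) \<in> borel_measurable G"
    unfolding frozen_R_def frozen_T_def using euler_grid_measurable[of t w G h "grid_index h t" r \<theta>] w h k by auto
  show "(\<lambda>\<omega>. euler_R h (\<lambda>s. w s \<omega>) r \<theta> t) \<in> borel_measurable G"
    unfolding euler_R_def by measurable
  show "(\<lambda>\<omega>. euler_T h (\<lambda>s. w s \<omega>) r \<theta> t) \<in> borel_measurable G"
    unfolding euler_T_def by measurable
qed

text \<open>The construction evaluates the path at times up to \<open>t\<close> only, the
  approximating times in \<open>angular_closed\<close> included. The sigma-algebra \<open>G\<close>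
  is left open, to be taken from either filtration.\<close>

lemma solution_measurable:
  assumes w: "\<And>s. 0 \<le> s \<Longrightarrow> s \<le> t \<Longrightarrow> w s \<in> borel_measurable G" and t: "0 \<le> t"
  shows "(\<lambda>\<omega>. radial (\<lambda>s. w s \<omega>) r \<theta> t) \<in> borel_measurable G"
    and "(\<lambda>\<omega>. angular_closed (\<lambda>s. w s \<omega>) r \<theta> t) \<in> borel_measurable G"
proof -
  have mesh: "0 < mesh n" for n by simp
  show R [measurable]: "(\<lambda>\<omega>. radial (\<lambda>s. w s \<omega>) r \<theta> t) \<in> borel_measurable G"
    unfolding radial_def
    by (intro borel_measurable_real_of_ereal borel_measurable_limsup borel_measurable_ereal euler_measurable(1) w t mesh)
  have T: "(\<lambda>\<omega>. angular (\<lambda>s. w s \<omega>) r \<theta> q) \<in> borel_measurable G" if "0 \<le> q" "q \<le> t" for q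
    unfolding angular_def
    using that by (intro borel_measurable_lim_metric euler_measurable(2) w mesh) auto
  have [measurable]: "(\<lambda>\<omega>. angular (\<lambda>s. w s \<omega>) r \<theta> t) \<in> borel_measurable G" using t by (intro T) auto
  have [measurable]: "(\<lambda>\<omega>. angular (\<lambda>s. w s \<omega>) r \<theta> (t * (1 - 1 / real (k + 2)))) \<in> borel_measurable G" for k
  proof (rule T)
    show "0 \<le> t * (1 - 1 / real (k + 2))" using t by simp
    show "t * (1 - 1 / real (k + 2)) \<le> t" using t by (simp add: mult_left_le)
  qed
  show "(\<lambda>\<omega>. angular_closed (\<lambda>s. w s \<omega>) r \<theta> t) \<in> borel_measurable G"
    unfolding angular_closed_def by measurable
qed

text \<open>A speed of at least \<open>v / 2\<close> towards the origin forces a zero by time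
  \<open>2 * r / v\<close>, and strict monotonicity makes it unique. As the speed bounds hold for
  every \<open>w\<close>, the hitting time is finite and attained without an exceptional
  set.\<close>

lemma radial_zero:
  assumes r: "0 < r"
  obtains \<tau> where "0 < \<tau>" "\<And>t. 0 \<le> t \<Longrightarrow> 0 < radial w r \<theta> t \<longleftrightarrow> t < \<tau>"
    "\<And>t. 0 \<le> t \<Longrightarrow> radial w r \<theta> t = 0 \<longleftrightarrow> t = \<tau>"
proof -
  have "radial w r \<theta> (2 * r / v) \<le> 0"
    using radial_speed(2)[of 0 "2 * r / v" w r \<theta>] r v_pos by (simp add: radial_0)
  moreover have "continuous_on {0..2 * r / v} (radial w r \<theta>)"
    by (rule continuous_on_subset[OF radial_continuous]) auto
  ultimately have "\<exists>\<tau>\<ge>0. \<tau> \<le> 2 * r / v \<and> radial w r \<theta> \<tau> = 0"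
    using r v_pos by (intro IVT2') (auto simp: radial_0)
  then obtain \<tau> where \<tau>: "0 \<le> \<tau>" "radial w r \<theta> \<tau> = 0" by blast
  have "\<tau> \<noteq> 0" using \<tau>(2) r by (auto simp: radial_0)
  then have pos: "0 < \<tau>" using \<tau>(1) by simp
  have 1: "0 < radial w r \<theta> t" if "0 \<le> t" "t < \<tau>" for t
    using radial_strict_antimono[OF that, of w r \<theta>] \<tau>(2) by simp
  have 2: "radial w r \<theta> t < 0" if "\<tau> < t" for t
    using radial_strict_antimono[OF \<tau>(1) that, of w r \<theta>] \<tau>(2) by simp
  show ?thesis
    using 1 2 \<tau> by (intro that[OF pos]) (metis less_asym less_irrefl linorder_neqE_linordered_idom)+
qed

lemma angular_0: "angular w r \<theta> 0 = \<theta>"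
  by (simp add: angular_def euler_T_def frozen_T_def grid_index_def lim_const)

lemma coefficients_set_integrable:
  fixes R x :: "real \<Rightarrow> real"
  assumes R: "continuous_on {0..t} R" and x: "continuous_on {0..t} x"
    and pos: "\<And>s. s \<in> {0..t} \<Longrightarrow> 0 < R s" and t: "0 \<le> t"
  shows "set_integrable lborel {0..t} (\<lambda>s. m (x s))"
    and "set_integrable lborel {0..t} (\<lambda>s. g (x s) / R s)"
proof -
  have m [measurable]: "m \<in> borel_measurable borel"
    by (rule borel_measurable_continuous_onI[OF m_continuous])
  \<comment> \<open>Clamping the time to \<open>{0..t}\<close> extends the paths continuously to the
    whole line, which makes the integrands Borel measurable there.\<close>
  define c where "c s = max 0 (min t s)" for s
  have c: "continuous_on UNIV c" unfolding c_def by (intro continuous_intros)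
  have cr: "range c \<subseteq> {0..t}" using t by (auto simp: c_def)
  have c_id: "c s = s" if "s \<in> {0..t}" for s using that by (simp add: c_def)
  have [measurable]: "(\<lambda>s. R (c s)) \<in> borel_measurable borel" "(\<lambda>s. x (c s)) \<in> borel_measurable borel"
    using cr by (auto intro!: borel_measurable_continuous_onI continuous_on_compose2[OF R c] continuous_on_compose2[OF x c])
  obtain q where q: "q \<in> {0..t}" "\<And>s. s \<in> {0..t} \<Longrightarrow> R q \<le> R s"
    using continuous_attains_inf[OF _ _ R] t by auto
  have bound: "\<bar>g (x s) / R s\<bar> \<le> v / R q" if "s \<in> {0..t}" for s
    unfolding abs_divide using pos[OF q(1)] q(2)[OF that] g_bound v_pos by (intro frac_le) auto
  have fin: "emeasure lborel {0..t} < \<infinity>" using t by simp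
  have "set_integrable lborel {0..t} (\<lambda>s. m (x (c s)))"
    unfolding set_integrable_def
    by (rule integrableI_bounded_set_indicator[where B = v]) (use m_abs fin in auto)
  moreover have "set_integrable lborel {0..t} (\<lambda>s. m (x (c s))) = set_integrable lborel {0..t} (\<lambda>s. m (x s))"
    by (rule set_integrable_cong) (auto simp: c_id)
  ultimately show "set_integrable lborel {0..t} (\<lambda>s. m (x s))" by simp
  have "set_integrable lborel {0..t} (\<lambda>s. g (x (c s)) / R (c s))"
    unfolding set_integrable_def
    by (rule integrableI_bounded_set_indicator[where B = "v / R q"]) (use bound c_id fin in auto)
  moreover have "set_integrable lborel {0..t} (\<lambda>s. g (x (c s)) / R (c s)) = set_integrable lborel {0..t} (\<lambda>s. g (x s) / R s)"
    by (rule set_integrable_cong) (auto simp: c_id)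
  ultimately show "set_integrable lborel {0..t} (\<lambda>s. g (x s) / R s)" by simp
qed

lemma angular_closed_tendsto:
  assumes w: "continuous_on {0..} w" "w 0 = 0" "no_occupation w"
    and pieces: "\<And>a b. a < b \<Longrightarrow> \<exists>c d. a \<le> c \<and> c < d \<and> d \<le> b \<and>
      ((\<forall>x\<in>{c..d}. 0 \<le> g x) \<or> (\<forall>x\<in>{c..d}. g x \<le> 0))"
    and len: "0 < len" and zero_above: "\<And>K. \<exists>a\<ge>K. \<forall>x\<in>{a..a + len}. g x = 0"
    and zero_below: "\<And>K. \<exists>a\<le>K. \<forall>x\<in>{a - len..a}. g x = 0"
    and \<tau>: "0 < \<tau>" and pos: "\<And>t. 0 \<le> t \<Longrightarrow> 0 < radial w r \<theta> t \<longleftrightarrow> t < \<tau>"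
  shows "(angular_closed w r \<theta> \<longlongrightarrow> angular_closed w r \<theta> \<tau>) (at_left \<tau>)"
proof -
  have P: "perturbed_solution 0 (radial w r \<theta> T) T w r \<theta> (radial w r \<theta>) (angular w r \<theta>)
      (radial w r \<theta>) (angular w r \<theta>)" "continuous_on {0..T} (angular w r \<theta>)"
    if "0 \<le> T" "T < \<tau>" for T
    using limit_solution[OF w that(1), of r \<theta>] pos[OF that(1)] that by auto
  have "\<exists>l. (angular w r \<theta> \<longlongrightarrow> l) (at_left \<tau>)"
  proof (rule left_limit_of_signed_drift[OF \<tau> P(2) _ _ _ _ pieces len zero_above zero_below])
    show "continuous_on {0..\<tau>} w" using w(1) by (rule continuous_on_subset) auto
    show "((\<lambda>s. g (angular w r \<theta> s) / radial w r \<theta> s) has_integral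
        angular w r \<theta> q - angular w r \<theta> p - (w q - w p)) {p..q}" if "0 \<le> p" "p \<le> q" "q < \<tau>" for p q
    proof -
      have int: "((\<lambda>s. g (angular w r \<theta> s) / radial w r \<theta> s) has_integral angular w r \<theta> s - \<theta> - w s) {0..s}"
        if "s \<in> {0..q}" for s
        using P(1)[of q] \<open>0 \<le> p\<close> \<open>p \<le> q\<close> \<open>q < \<tau>\<close> that unfolding perturbed_solution_def by auto
      have "((\<lambda>s. g (angular w r \<theta> s) / radial w r \<theta> s) has_integral
          (angular w r \<theta> q - \<theta> - w q) - (angular w r \<theta> p - \<theta> - w p)) {p..q}"
        by (rule has_integral_increment[OF int int]) (use that in auto)
      then show ?thesis by (simp add: algebra_simps)
    qed
    show "0 \<le> g (angular w r \<theta> q) / radial w r \<theta> q" if "0 \<le> q" "q < \<tau>" "0 \<le> g (angular w r \<theta> q)" for q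
      using that pos[of q] by simp
    show "g (angular w r \<theta> q) / radial w r \<theta> q \<le> 0" if "0 \<le> q" "q < \<tau>" "g (angular w r \<theta> q) \<le> 0" for q
      using that pos[of q] by (simp add: divide_nonpos_pos)
  qed auto
  then obtain l where l: "(angular w r \<theta> \<longlongrightarrow> l) (at_left \<tau>)" by blast
  \<comment> \<open>These times approach \<open>\<tau>\<close> strictly from below, so the limit
    along them is the left limit just found.\<close>
  have "(\<lambda>k. \<tau> * (1 - 1 / real (k + 2))) \<longlonglongrightarrow> \<tau> * (1 - 0)"
    by (intro tendsto_intros LIMSEQ_ignore_initial_segment[OF lim_1_over_n])
  then have "filterlim (\<lambda>k. \<tau> * (1 - 1 / real (k + 2))) (at_left \<tau>) sequentially"
    using \<tau> by (auto simp: filterlim_at)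
  from filterlim_compose[OF l this] have "angular_closed w r \<theta> \<tau> = l"
    using pos[of \<tau>] \<tau> by (simp add: angular_closed_def limI)
  moreover have "\<forall>\<^sub>F t in at_left \<tau>. angular w r \<theta> t = angular_closed w r \<theta> t"
    unfolding eventually_at_left[OF \<tau>] using \<tau> pos by (intro exI[of _ 0]) (auto simp: angular_closed_def)
  ultimately show ?thesis using l by (auto cong: tendsto_cong)
qed

text \<open>This leads from the Lebesgue integrals of the definition to gauge integrals. The minimum
  of the radius over \<open>{0..t}\<close> serves as \<open>\<epsilon>\<close>; all smaller
  \<open>e\<close> are allowed, so that two solutions can be given a common lower bound.\<close>

lemma perturbed_solution_of_integral_equation:
  fixes R x :: "real \<Rightarrow> real"
  assumes t: "0 \<le> t" and cont: "continuous_on {0..t} (\<lambda>s. (R s, x s))"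
    and eq: "\<And>s. s \<in> {0..t} \<Longrightarrow> 0 < R s \<and> R s = r + (LINT q:{0..s}|lborel. m (x q)) \<and>
      x s = \<theta> + (LINT q:{0..s}|lborel. g (x q) / R q) + w s"
  shows "\<exists>\<epsilon>>0. \<forall>e\<le>\<epsilon>. perturbed_solution 0 e t w r \<theta> R x R x"
proof -
  have R: "continuous_on {0..t} R" and x: "continuous_on {0..t} x"
    using continuous_on_fst[OF cont] continuous_on_snd[OF cont] by simp_all
  obtain q where q: "q \<in> {0..t}" "\<And>s. s \<in> {0..t} \<Longrightarrow> R q \<le> R s"
    using continuous_attains_inf[OF _ _ R] t by auto
  have "((\<lambda>q. m (x q)) has_integral R s - r) {0..s} \<and> ((\<lambda>q. g (x q) / R q) has_integral x s - \<theta> - w s) {0..s}"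
    if s: "s \<in> {0..t}" for s
  proof -
    have Rs: "continuous_on {0..s} R" and xs: "continuous_on {0..s} x"
      using s by (auto intro: continuous_on_subset[OF R] continuous_on_subset[OF x])
    have pos: "0 < R p" if "p \<in> {0..s}" for p using eq[of p] s that by (metis atLeastAtMost_iff order_trans)
    have s0: "0 \<le> s" using s by simp
    note int = coefficients_set_integrable[OF Rs xs pos s0]
    show ?thesis
      using eq[OF s] set_borel_integral_eq_integral[OF int(1)] set_borel_integral_eq_integral[OF int(2)]
      by (auto simp: has_integral_iff)
  qed
  moreover have "0 < R q" using eq[OF q(1)] by simp
  ultimately show ?thesis
    using q(2) unfolding perturbed_solution_def by (intro exI[of _ "R q"]) (auto intro: order_trans)
qed

lemma strong_solution_exists:
  assumes fps: "filtered_prob_space M F" and bm: "brownian_motion M F B" and \<sigma>: "0 < \<sigma>" and r: "0 < r"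
    and pieces: "\<And>a b. a < b \<Longrightarrow> \<exists>c d. a \<le> c \<and> c < d \<and> d \<le> b \<and>
      ((\<forall>x\<in>{c..d}. 0 \<le> g x) \<or> (\<forall>x\<in>{c..d}. g x \<le> 0))"
    and len: "0 < len" and zero_above: "\<And>K. \<exists>a\<ge>K. \<forall>x\<in>{a..a + len}. g x = 0"
    and zero_below: "\<And>K. \<exists>a\<le>K. \<forall>x\<in>{a - len..a}. g x = 0"
  shows "strong_solution_upto_hitting M F B (\<lambda>_. m) (\<lambda>\<rho> x. g x / \<rho>) \<sigma> r \<theta>
    (\<lambda>t \<omega>. radial (\<lambda>s. \<sigma> * B s \<omega>) r \<theta> t) (\<lambda>t \<omega>. angular_closed (\<lambda>s. \<sigma> * B s \<omega>) r \<theta> t)"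
proof -
  define w where "w \<omega> s = \<sigma> * B s \<omega>" for \<omega> s
  define R where "R t \<omega> = radial (w \<omega>) r \<theta> t" for t \<omega>
  define \<Theta> where "\<Theta> t \<omega> = angular_closed (w \<omega>) r \<theta> t" for t \<omega>
  have "\<exists>T. 0 < T \<and> (\<forall>t\<ge>0. (0 < R t \<omega> \<longleftrightarrow> t < T) \<and> (R t \<omega> = 0 \<longleftrightarrow> t = T))" for \<omega>
    unfolding R_def by (rule radial_zero[OF r, of "w \<omega>" \<theta>]) blast
  then obtain T where T: "\<And>\<omega>. 0 < T \<omega>" "\<And>t \<omega>. 0 \<le> t \<Longrightarrow> 0 < R t \<omega> \<longleftrightarrow> t < T \<omega>"
    "\<And>t \<omega>. 0 \<le> t \<Longrightarrow> R t \<omega> = 0 \<longleftrightarrow> t = T \<omega>" by metis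
  have hit: "hitting_time R \<omega> = ereal (T \<omega>)" for \<omega>
    using T(3)[of _ \<omega>] less_imp_le[OF T(1)] by (intro hitting_time_eq) auto
  \<comment> \<open>Stated for any family \<open>G\<close> to which \<open>B\<close> is adapted, in
    order to cover the given and the augmented filtration at once.\<close>
  have adapted: "adapted_upto M G (hitting_time R) (\<lambda>t \<omega>. (R t \<omega>, \<Theta> t \<omega>))"
    if space: "\<And>t. 0 \<le> t \<Longrightarrow> space (G t) = space M"
      and B: "\<And>s t. 0 \<le> s \<Longrightarrow> s \<le> t \<Longrightarrow> B s \<in> borel_measurable (G t)" for G
    unfolding adapted_upto_def
  proof (intro allI impI ballI)
    fix t :: real and A :: "(real \<times> real) set" assume t: "0 \<le> t" and [measurable]: "A \<in> sets borel"
    have wm: "(\<lambda>\<omega>. w \<omega> s) \<in> borel_measurable (G t)" if "0 \<le> s" "s \<le> t" for s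
      unfolding w_def using B[OF that] by measurable
    have [measurable]: "R t \<in> borel_measurable (G t)" "\<Theta> t \<in> borel_measurable (G t)"
      unfolding R_def \<Theta>_def using solution_measurable[of t "\<lambda>s \<omega>. w \<omega> s" "G t" r \<theta>] wm t by auto
    have "{\<omega> \<in> space M. ereal t \<le> hitting_time R \<omega> \<and> (R t \<omega>, \<Theta> t \<omega>) \<in> A}
        = {\<omega> \<in> space (G t). 0 \<le> R t \<omega> \<and> (R t \<omega>, \<Theta> t \<omega>) \<in> A}"
      using T(2,3)[OF t] by (auto simp: hit space[OF t] le_less)
    also have "\<dots> \<in> sets (G t)" by measurable
    finally show "{\<omega> \<in> space M. ereal t \<le> hitting_time R \<omega> \<and> (R t \<omega>, \<Theta> t \<omega>) \<in> A} \<in> sets (G t)" .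
  qed
  have "adapted_upto M F (hitting_time R) (\<lambda>t \<omega>. (R t \<omega>, \<Theta> t \<omega>))"
  proof (rule adapted)
    show "space (F t) = space M" if "0 \<le> t" for t
      using fps that by (auto simp: filtered_prob_space_def subalgebra_def)
    show "B s \<in> borel_measurable (F t)" if "0 \<le> s" "s \<le> t" for s t
    proof -
      have "space (F s) = space M" "space (F t) = space M" "sets (F s) \<subseteq> sets (F t)"
        using fps that by (auto simp: filtered_prob_space_def subalgebra_def)
      then have "subalgebra (F t) (F s)" by (simp add: subalgebra_def)
      moreover have "B s \<in> borel_measurable (F s)" using bm that by (simp add: brownian_motion_def)
      ultimately show ?thesis by (rule measurable_from_subalg)
    qed
  qed
  moreover have "adapted_upto M (augmented_filtration M B) (hitting_time R) (\<lambda>t \<omega>. (R t \<omega>, \<Theta> t \<omega>))"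
  proof (rule adapted)
    show "space (augmented_filtration M B t) = space M" for t
      by (simp add: augmented_filtration_def space_measure_of_conv)
    have gen: "{B s -` A \<inter> space M | s A. 0 \<le> s \<and> s \<le> t \<and> A \<in> sets borel} \<union> null_sets (completion M) \<subseteq> Pow (space M)"
      for t :: real
      using sets.sets_into_space[of _ "completion M"] by (auto simp: null_sets_def)
    show "B s \<in> borel_measurable (augmented_filtration M B t)" if "0 \<le> s" "s \<le> t" for s t
    proof (rule measurableI)
      show "B s -` A \<inter> space (augmented_filtration M B t) \<in> sets (augmented_filtration M B t)" if "A \<in> sets borel" for A
        unfolding augmented_filtration_def space_measure_of_conv sets_measure_of[OF gen]
        using that \<open>0 \<le> s\<close> \<open>s \<le> t\<close> by (intro sigma_sets.Basic) blast
    qed simp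
  qed
  moreover have "AE \<omega> in M. R 0 \<omega> = r \<and> \<Theta> 0 \<omega> = \<theta>"
    using r by (simp add: R_def \<Theta>_def angular_closed_def radial_0 angular_0)
  moreover have "AE \<omega> in M. \<forall>t. hitting_time R \<omega> = ereal t \<longrightarrow> R t \<omega> = 0"
    using T(3) less_imp_le[OF T(1)] by (simp add: hit)
  moreover have good: "AE \<omega> in M. continuous_on {0..} (w \<omega>) \<and> w \<omega> 0 = 0 \<and> no_occupation (w \<omega>)"
  proof -
    have "AE \<omega> in M. B 0 \<omega> = 0" "AE \<omega> in M. continuous_on {0..} (\<lambda>t. B t \<omega>)"
      using bm by (auto simp: brownian_motion_def)
    then show ?thesis
      using brownian_no_occupation[OF fps bm \<sigma>]
    proof eventually_elim
      case (elim \<omega>)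
      then show ?case unfolding w_def by (auto intro: continuous_intros)
    qed
  qed
  have "AE \<omega> in M. \<forall>t. 0 \<le> t \<and> ereal t < hitting_time R \<omega> \<longrightarrow>
     R t \<omega> > 0 \<and>
     continuous_on {0..t} (\<lambda>s. (R s \<omega>, \<Theta> s \<omega>)) \<and>
     set_integrable lborel {0..t} (\<lambda>s. \<bar>m (\<Theta> s \<omega>)\<bar> + \<bar>g (\<Theta> s \<omega>) / R s \<omega>\<bar>) \<and>
     R t \<omega> = r + (LINT s:{0..t}|lborel. m (\<Theta> s \<omega>)) \<and>
     \<Theta> t \<omega> = \<theta> + (LINT s:{0..t}|lborel. g (\<Theta> s \<omega>) / R s \<omega>) + \<sigma> * B t \<omega>"
    using good
  proof eventually_elim
    case (elim \<omega>)
    then have w: "continuous_on {0..} (w \<omega>)" "w \<omega> 0 = 0" "no_occupation (w \<omega>)" by auto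
    show ?case
    proof (intro allI impI)
      fix t assume "0 \<le> t \<and> ereal t < hitting_time R \<omega>"
      then have t: "0 \<le> t" "t < T \<omega>" by (auto simp: hit)
      then have Rt: "0 < R t \<omega>" using T(2) by simp
      have pos: "0 < R s \<omega>" if "s \<in> {0..t}" for s using T(2)[of s \<omega>] that t by simp
      then have \<Theta>: "angular (w \<omega>) r \<theta> s = \<Theta> s \<omega>" if "s \<in> {0..t}" for s
        using that by (simp add: \<Theta>_def R_def angular_closed_def)
      note sol = limit_solution[OF w t(1) Rt[unfolded R_def]]
      have c\<Theta>: "continuous_on {0..t} (\<lambda>s. \<Theta> s \<omega>)"
        using sol(1) by (rule continuous_on_eq) (rule \<Theta>)
      have cR: "continuous_on {0..t} (\<lambda>s. R s \<omega>)"
        unfolding R_def by (rule continuous_on_subset[OF radial_continuous]) auto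
      note int = coefficients_set_integrable[OF cR c\<Theta> pos t(1)]
      have tt: "t \<in> {0..t}" using t(1) by simp
      have "((\<lambda>s. m (angular (w \<omega>) r \<theta> s)) has_integral R t \<omega> - r) {0..t}"
        "((\<lambda>s. g (angular (w \<omega>) r \<theta> s) / R s \<omega>) has_integral \<Theta> t \<omega> - \<theta> - w \<omega> t) {0..t}"
        using bspec[OF sol(2)[unfolded perturbed_solution_def] tt] \<Theta>[OF tt] unfolding R_def by auto
      then have "((\<lambda>s. m (\<Theta> s \<omega>)) has_integral R t \<omega> - r) {0..t}"
        "((\<lambda>s. g (\<Theta> s \<omega>) / R s \<omega>) has_integral \<Theta> t \<omega> - \<theta> - w \<omega> t) {0..t}"
        using \<Theta> by (auto elim!: has_integral_eq[rotated])
      then have "(LINT s:{0..t}|lborel. m (\<Theta> s \<omega>)) = R t \<omega> - r"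
        "(LINT s:{0..t}|lborel. g (\<Theta> s \<omega>) / R s \<omega>) = \<Theta> t \<omega> - \<theta> - w \<omega> t"
        using set_borel_integral_eq_integral(2)[OF int(1)] set_borel_integral_eq_integral(2)[OF int(2)]
        by (simp_all add: integral_unique)
      moreover have "set_integrable lborel {0..t} (\<lambda>s. \<bar>m (\<Theta> s \<omega>)\<bar> + \<bar>g (\<Theta> s \<omega>) / R s \<omega>\<bar>)"
        using int by (intro set_integral_add set_integrable_abs)
      ultimately show "R t \<omega> > 0 \<and>
        continuous_on {0..t} (\<lambda>s. (R s \<omega>, \<Theta> s \<omega>)) \<and>
        set_integrable lborel {0..t} (\<lambda>s. \<bar>m (\<Theta> s \<omega>)\<bar> + \<bar>g (\<Theta> s \<omega>) / R s \<omega>\<bar>) \<and>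
        R t \<omega> = r + (LINT s:{0..t}|lborel. m (\<Theta> s \<omega>)) \<and>
        \<Theta> t \<omega> = \<theta> + (LINT s:{0..t}|lborel. g (\<Theta> s \<omega>) / R s \<omega>) + \<sigma> * B t \<omega>"
        using Rt cR c\<Theta> by (simp add: w_def continuous_on_Pair)
    qed
  qed
  moreover have "AE \<omega> in M. \<exists>l.
     ((\<lambda>s. (R (real_of_ereal s) \<omega>, \<Theta> (real_of_ereal s) \<omega>)) \<longlongrightarrow> l) (at_left (hitting_time R \<omega>)) \<and>
     (\<forall>t. hitting_time R \<omega> = ereal t \<longrightarrow> (R t \<omega>, \<Theta> t \<omega>) = l)"
    using good
  proof eventually_elim
    case (elim \<omega>)
    have "((\<lambda>t. \<Theta> t \<omega>) \<longlongrightarrow> \<Theta> (T \<omega>) \<omega>) (at_left (T \<omega>))"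
      unfolding \<Theta>_def using elim T(2)[of _ \<omega>] unfolding R_def
      by (intro angular_closed_tendsto[OF _ _ _ pieces len zero_above zero_below T(1)]) auto
    moreover have "((\<lambda>t. R t \<omega>) \<longlongrightarrow> R (T \<omega>) \<omega>) (at_left (T \<omega>))"
    proof -
      have "continuous_on {0<..} (\<lambda>t. R t \<omega>)"
        unfolding R_def by (rule continuous_on_subset[OF radial_continuous]) auto
      then have "isCont (\<lambda>t. R t \<omega>) (T \<omega>)"
        using T(1)[of \<omega>] by (simp add: continuous_on_eq_continuous_at)
      then show ?thesis
        unfolding isCont_def by (rule tendsto_mono[OF at_le, rotated]) simp
    qed
    ultimately have "((\<lambda>t. (R t \<omega>, \<Theta> t \<omega>)) \<longlongrightarrow> (R (T \<omega>) \<omega>, \<Theta> (T \<omega>) \<omega>)) (at_left (T \<omega>))"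
      by (intro tendsto_Pair)
    \<comment> \<open>The hitting time is finite, so the left limit in the extended reals is an
      ordinary left limit.\<close>
    then show ?case
      by (simp add: hit at_left_ereal filterlim_filtermap)
  qed
  ultimately have "strong_solution_upto_hitting M F B (\<lambda>_. m) (\<lambda>\<rho> x. g x / \<rho>) \<sigma> r \<theta> R \<Theta>"
    unfolding strong_solution_upto_hitting_def Let_def by blast
  then show ?thesis unfolding R_def \<Theta>_def w_def .
qed

text \<open>Before both hitting times the stability estimate at \<open>\<delta> = 0\<close> makes
  the solutions equal. Left limits extend this to the hitting times, which are kept as extended
  reals since an arbitrary solution comes without a finite one.\<close>

lemma pathwise_unique:
  assumes r: "0 < r"
  shows "pathwise_unique_upto_hitting M F B (\<lambda>_. m) (\<lambda>\<rho> x. g x / \<rho>) \<sigma> r \<theta>"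
  unfolding pathwise_unique_upto_hitting_def
proof (intro allI impI)
  fix R \<Theta> R' \<Theta>'
  assume A: "strong_solution_upto_hitting M F B (\<lambda>_. m) (\<lambda>\<rho> x. g x / \<rho>) \<sigma> r \<theta> R \<Theta> \<and>
    strong_solution_upto_hitting M F B (\<lambda>_. m) (\<lambda>\<rho> x. g x / \<rho>) \<sigma> r \<theta> R' \<Theta>'"
  define good where "good R \<Theta> \<omega> \<longleftrightarrow> R 0 \<omega> = r \<and> (\<forall>t. hitting_time R \<omega> = ereal t \<longrightarrow> R t \<omega> = 0) \<and>
    (\<forall>t. 0 \<le> t \<and> ereal t < hitting_time R \<omega> \<longrightarrow> 0 < R t \<omega> \<and> continuous_on {0..t} (\<lambda>s. (R s \<omega>, \<Theta> s \<omega>)) \<and>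
       R t \<omega> = r + (LINT s:{0..t}|lborel. m (\<Theta> s \<omega>)) \<and>
       \<Theta> t \<omega> = \<theta> + (LINT s:{0..t}|lborel. g (\<Theta> s \<omega>) / R s \<omega>) + \<sigma> * B t \<omega>) \<and>
    (\<exists>l. ((\<lambda>s. (R (real_of_ereal s) \<omega>, \<Theta> (real_of_ereal s) \<omega>)) \<longlongrightarrow> l) (at_left (hitting_time R \<omega>)) \<and>
     (\<forall>t. hitting_time R \<omega> = ereal t \<longrightarrow> (R t \<omega>, \<Theta> t \<omega>) = l))"
    for R \<Theta> :: "real \<Rightarrow> 'a \<Rightarrow> real" and \<omega>
  have good: "AE \<omega> in M. good R \<Theta> \<omega>"
    if "strong_solution_upto_hitting M F B (\<lambda>_. m) (\<lambda>\<rho> x. g x / \<rho>) \<sigma> r \<theta> R \<Theta>" for R \<Theta>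
  proof -
    note D = that[unfolded strong_solution_upto_hitting_def Let_def, THEN conjunct2, THEN conjunct2]
    from D[THEN conjunct1] D[THEN conjunct2, THEN conjunct1] D[THEN conjunct2, THEN conjunct2, THEN conjunct1]
      D[THEN conjunct2, THEN conjunct2, THEN conjunct2]
    show ?thesis
    proof eventually_elim
      case (elim \<omega>)
      then show ?case unfolding good_def by blast
    qed
  qed
  have at_hit: "0 < t \<and> ((\<lambda>s. (R s \<omega>, \<Theta> s \<omega>)) \<longlongrightarrow> (R t \<omega>, \<Theta> t \<omega>)) (at_left t)"
    if G: "good R \<Theta> \<omega>" and t: "hitting_time R \<omega> = ereal t" for R \<Theta> \<omega> t
  proof -
    have "ereal 0 \<le> hitting_time R \<omega>" unfolding hitting_time_def by (intro INF_greatest) auto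
    moreover have "R t \<omega> = 0" "R 0 \<omega> = r" using G t by (auto simp: good_def)
    ultimately have "0 < t" using t r by (cases "t = 0") auto
    moreover have "((\<lambda>s. (R (real_of_ereal s) \<omega>, \<Theta> (real_of_ereal s) \<omega>)) \<longlongrightarrow> (R t \<omega>, \<Theta> t \<omega>)) (at_left (ereal t))"
      using G t by (auto simp: good_def)
    ultimately show ?thesis by (simp add: at_left_ereal filterlim_filtermap)
  qed
  have before: "R t \<omega> = R' t \<omega> \<and> \<Theta> t \<omega> = \<Theta>' t \<omega>"
    if G: "good R \<Theta> \<omega>" "good R' \<Theta>' \<omega>" and t: "0 \<le> t" "ereal t < hitting_time R \<omega>" "ereal t < hitting_time R' \<omega>"
    for R \<Theta> R' \<Theta>' \<omega> t
  proof -
    have E: "\<exists>\<epsilon>>0. \<forall>e\<le>\<epsilon>. perturbed_solution 0 e t (\<lambda>s. \<sigma> * B s \<omega>) r \<theta> (\<lambda>s. R s \<omega>) (\<lambda>s. \<Theta> s \<omega>) (\<lambda>s. R s \<omega>) (\<lambda>s. \<Theta> s \<omega>)"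
      if "good R \<Theta> \<omega>" "ereal t < hitting_time R \<omega>" for R \<Theta>
    proof (rule perturbed_solution_of_integral_equation[OF t(1)])
      show "continuous_on {0..t} (\<lambda>s. (R s \<omega>, \<Theta> s \<omega>))" using that t(1) by (simp add: good_def)
      fix s assume s: "s \<in> {0..t}"
      then have "ereal s < hitting_time R \<omega>" using that(2) by (metis atLeastAtMost_iff ereal_less_eq(3) le_less_trans)
      then show "0 < R s \<omega> \<and> R s \<omega> = r + (LINT q:{0..s}|lborel. m (\<Theta> q \<omega>)) \<and>
        \<Theta> s \<omega> = \<theta> + (LINT q:{0..s}|lborel. g (\<Theta> q \<omega>) / R q \<omega>) + \<sigma> * B s \<omega>"
        using that(1) s unfolding good_def atLeastAtMost_iff by blast
    qed
    obtain \<epsilon> where \<epsilon>: "0 < \<epsilon>" "\<And>e. e \<le> \<epsilon> \<Longrightarrow> perturbed_solution 0 e t (\<lambda>s. \<sigma> * B s \<omega>) r \<theta> (\<lambda>s. R s \<omega>) (\<lambda>s. \<Theta> s \<omega>) (\<lambda>s. R s \<omega>) (\<lambda>s. \<Theta> s \<omega>)"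
      using E[OF G(1) t(2)] by blast
    obtain \<epsilon>' where \<epsilon>': "0 < \<epsilon>'" "\<And>e. e \<le> \<epsilon>' \<Longrightarrow> perturbed_solution 0 e t (\<lambda>s. \<sigma> * B s \<omega>) r \<theta> (\<lambda>s. R' s \<omega>) (\<lambda>s. \<Theta>' s \<omega>) (\<lambda>s. R' s \<omega>) (\<lambda>s. \<Theta>' s \<omega>)"
      using E[OF G(2) t(3)] by blast
    have "\<bar>R t \<omega> - R' t \<omega>\<bar> + \<bar>\<Theta> t \<omega> - \<Theta>' t \<omega>\<bar> \<le> 4 * 0 * exp ((v + v / min \<epsilon> \<epsilon>' + v / (min \<epsilon> \<epsilon>')\<^sup>2) * t)"
      using \<epsilon>(1) \<epsilon>'(1) t(1)
      by (intro perturbed_solution_stability[OF \<epsilon>(2)[of "min \<epsilon> \<epsilon>'"] \<epsilon>'(2)[of "min \<epsilon> \<epsilon>'"]]) auto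
    then have "\<bar>R t \<omega> - R' t \<omega>\<bar> + \<bar>\<Theta> t \<omega> - \<Theta>' t \<omega>\<bar> \<le> 0" by simp
    then show ?thesis by linarith
  qed
  \<comment> \<open>A solution still positive at the hitting time of the other would be continuous
    there, yet have the left limit 0 of the other.\<close>
  have not_less: "\<not> hitting_time R \<omega> < hitting_time R' \<omega>" if G: "good R \<Theta> \<omega>" "good R' \<Theta>' \<omega>" for R \<Theta> R' \<Theta>' \<omega>
  proof
    assume less: "hitting_time R \<omega> < hitting_time R' \<omega>"
    have "ereal 0 \<le> hitting_time R \<omega>" unfolding hitting_time_def by (intro INF_greatest) auto
    \<comment> \<open>The smaller of two different hitting times is finite.\<close>
    then obtain t where t: "hitting_time R \<omega> = ereal t" using less by (cases "hitting_time R \<omega>") auto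
    note H = at_hit[OF G(1) t]
    have "ereal t < hitting_time R' \<omega>" using less t by simp
    then have R't: "0 < R' t \<omega>" and "continuous_on {0..t} (\<lambda>s. (R' s \<omega>, \<Theta>' s \<omega>))"
      using G(2) less_imp_le[OF conjunct1[OF H]] unfolding good_def by blast+
    then have "continuous_on {0..t} (\<lambda>s. R' s \<omega>)" using continuous_on_fst by fastforce
    from continuous_on_Icc_at_leftD[OF this conjunct1[OF H]]
    have lim': "((\<lambda>s. R' s \<omega>) \<longlongrightarrow> R' t \<omega>) (at_left t)" .
    have lim: "((\<lambda>s. R s \<omega>) \<longlongrightarrow> R t \<omega>) (at_left t)"
      using tendsto_fst[OF conjunct2[OF H]] by simp
    have "\<forall>\<^sub>F s in at_left t. R s \<omega> = R' s \<omega>"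
      unfolding eventually_at_left[OF conjunct1[OF H]]
    proof (intro exI[of _ 0] conjI allI impI)
      fix s assume s: "0 < s" "s < t"
      then have "ereal s < hitting_time R \<omega>" "ereal s < hitting_time R' \<omega>"
        using less s(2) unfolding t by (auto intro: less_trans[of "ereal s" "ereal t"])
      then show "R s \<omega> = R' s \<omega>" using before[OF G, of s] s by simp
    qed (use H in simp)
    from Lim_transform_eventually[OF lim this] have "R t \<omega> = R' t \<omega>"
      by (rule tendsto_unique[OF trivial_limit_at_left_real _ lim'])
    moreover have "R t \<omega> = 0" using G(1) t by (simp add: good_def)
    ultimately show False using R't by simp
  qed
  from A have "AE \<omega> in M. good R \<Theta> \<omega>" "AE \<omega> in M. good R' \<Theta>' \<omega>" using good by auto
  then show "AE \<omega> in M. hitting_time R \<omega> = hitting_time R' \<omega> \<and>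
    (\<forall>t. 0 \<le> t \<and> ereal t \<le> hitting_time R \<omega> \<longrightarrow> R t \<omega> = R' t \<omega> \<and> \<Theta> t \<omega> = \<Theta>' t \<omega>)"
  proof eventually_elim
    case (elim \<omega>)
    have eq: "hitting_time R \<omega> = hitting_time R' \<omega>"
      using not_less[OF elim(1,2)] not_less[OF elim(2,1)] by simp
    have "R t \<omega> = R' t \<omega> \<and> \<Theta> t \<omega> = \<Theta>' t \<omega>" if t: "0 \<le> t" "ereal t \<le> hitting_time R \<omega>" for t
    proof (cases "ereal t = hitting_time R \<omega>")
      case True
      note H = at_hit[OF elim(1) True[symmetric]]
      note H' = at_hit[OF elim(2) trans[OF eq[symmetric] True[symmetric]]]
      have "\<forall>\<^sub>F s in at_left t. (R s \<omega>, \<Theta> s \<omega>) = (R' s \<omega>, \<Theta>' s \<omega>)"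
        unfolding eventually_at_left[OF conjunct1[OF H]]
      proof (intro exI[of _ 0] conjI allI impI)
        fix s assume s: "0 < s" "s < t"
        then have "ereal s < hitting_time R \<omega>" "ereal s < hitting_time R' \<omega>"
          unfolding eq[symmetric] True[symmetric] by simp_all
        then show "(R s \<omega>, \<Theta> s \<omega>) = (R' s \<omega>, \<Theta>' s \<omega>)" using before[OF elim, of s] s by simp
      qed (use H in simp)
      from Lim_transform_eventually[OF conjunct2[OF H] this] have "(R t \<omega>, \<Theta> t \<omega>) = (R' t \<omega>, \<Theta>' t \<omega>)"
        by (rule tendsto_unique[OF trivial_limit_at_left_real _ conjunct2[OF H']])
      then show ?thesis by simp
    next
      case False
      then have "ereal t < hitting_time R \<omega>" using t(2) by simp
      then show ?thesis using before[OF elim t(1)] eq by simp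
    qed
    with eq show ?case by blast
  qed
qed

end

theorem theorem3p2:
  fixes M :: "'a measure" and F :: "real \<Rightarrow> 'a measure" and B :: "real \<Rightarrow> 'a \<Rightarrow> real"
    and v \<sigma> r \<theta> :: real
  assumes "filtered_prob_space M F"
    and "brownian_motion M F B"
    and "v > 0" and "\<sigma> > 0" and "r > 0"
  shows "(\<exists>R \<Theta>. strong_solution_upto_hitting M F B (sail_mu1 v) (sail_mu2 v) \<sigma> r \<theta> R \<Theta>) \<and>
         pathwise_unique_upto_hitting M F B (sail_mu1 v) (sail_mu2 v) \<sigma> r \<theta>"
proof -
  interpret sail_drift "sail_mu1 v 1" "sail_mu2 v 1" v
    by (rule sail_drift_sail_mu[OF assms(3)])
  have mu1: "sail_mu1 v = (\<lambda>_. sail_mu1 v 1)"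
    by (intro ext) (rule sail_mu1_radius)
  have mu2: "sail_mu2 v = (\<lambda>\<rho> x. sail_mu2 v 1 x / \<rho>)"
    by (intro ext) (rule sail_mu2_radius)
  have "0 < pi / 4" by simp
  from strong_solution_exists[OF assms(1,2,4,5) sail_mu2_sign_pieces[OF assms(3)] this
      sail_mu2_zero_above sail_mu2_zero_below, of \<theta>]
  have "\<exists>R \<Theta>. strong_solution_upto_hitting M F B (sail_mu1 v) (sail_mu2 v) \<sigma> r \<theta> R \<Theta>"
    by (subst mu1, subst mu2) blast
  moreover have "pathwise_unique_upto_hitting M F B (sail_mu1 v) (sail_mu2 v) \<sigma> r \<theta>"
    by (subst mu1, subst mu2) (rule pathwise_unique[OF assms(5)])
  ultimately show ?thesis by blast
qed

end
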